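(* Let $R$ be a Frobenius-separable $k$-algebra with idempotent Frobenius system $(\phi,e)$, and let $H$ be a finite dimensional $\times_R$-bialgebra. Then the weak bialgebra corresponding to $H^\vee$ is the opposite $(H^* )^{\mathrm{op}}$ of the dual $H^*$ of the weak bialgebra corresponding to $H$.
   Context: $k$ is a field; algebras (unital, associative), coalgebras, $\otimes$ and dimensions are over $k$. Frobenius systems: A Frobenius system for a $k$-algebra $R$ is a pair $(\phi,e)$ of a linear map $\phi\colon R\to k$ and $e=e^{(1)}\otimes e^{(2)}\in R\otimes R$ with $r=\phi(re^{(1)})e^{(2)}=e^{(1)}\phi(e^{(2)}r)$ for all $r\in R$; it is idempotent if $e^{(1)}e^{(2)}=1$. $R$ is Frobenius-separable if an idempotent Frobenius system exists. Weak bialgebra: an algebra and coalgebra $H$ with $\Delta(gh)=\Delta(g)\Delta(h)$ and, for all $f,g,h\in H$: $\epsilon(fgh)=\epsilon(fg_{(1)})\epsilon(g_{(2)}h)=\epsilon(fg_{(2)})\epsilon(g_{(1)}h)$, and $1_{(1)}\otimes1_{(2)}\otimes1_{(3)}=(\Delta(1)\otimes1)(1\otimes\Delta(1))=(1\otimes\Delta(1))(\Delta(1)\otimes1)$. The dual $H^*$ of a finite-dimensional weak bialgebra is a weak bialgebra with the dual algebra structure of the coalgebra $H$ (convolution) and the dual coalgebra structure of the algebra $H$; $(\cdot)^{\mathrm{op}}$ denotes opposite multiplication with the same comultiplication. $\times_R$-bialgebras: $\overline R$ is the opposite algebra of $R$, $r\mapsto\overline r$ the canonical anti-isomorphism $R\to\overline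 R$, $R^e=R\otimes\overline R$, $r\overline s:=r\otimes\overline s$. An $R^e$-ring is a $k$-algebra $L$ with an algebra map $R^e\to L$; one writes $r,\overline s$ also for images in $L$. For left $R^e$-modules $M,N$, $M\diamond N:=M\otimes N/\langle\overline rm\otimes n-m\otimes rn\rangle$. For $R^e$-bimodules $M,N$, $M\times_RN\subset M\diamond N$ is the subspace of all $\sum m_i\otimes n_i$ with $\sum m_i\overline s\otimes n_i=\sum m_i\otimes n_is$ for all $s\in R$; if $M,N$ are $R^e$-rings, it is an $R^e$-ring with factorwise multiplication and structure map $r\otimes\overline s\mapsto r\otimes\overline s$. $\operatorname{End}(R)$ ($k$-linear endomorphisms) is an $R^e$-ring via $r\otimes\overline s\mapsto(t\mapsto rts)$. A $\times_R$-bialgebra is an $R^e$-ring $L$ with homomorphisms of $R^e$-rings $\Gamma\colon L\to L\times_RL$, $\Gamma(\ell)=\ell_{[1]}\otimes\ell_{[2]}$, and $C\colon L\to\operatorname{End}(R)$ such that the induced map $\Gamma_0\colon L\to L\diamond L$ satisfies $(\Gamma_0\diamond L)\Gamma_0=(L\diamond\Gamma_0)\Gamma_0$, and $\overline{C(\ell_{[2]})(1)}\,\ell_{[1]}=\ell=C(\ell_{[1]})(1)\,\ell_{[2]}$ for all $\ell\in L$. Corresponding weak bialgebra: for a $\times_R$-bialgebra $(L,\Gamma,C)$ with $R$ Frobenius-separable and fixed $(\phi,e)$, the algebra $L$ is a weak bialgebra with $\Delta(\ell)=\overline{e^{(1)}}\ell_{[1]}\otimes e^{(2)}\ell_{[2]}$,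 $\epsilon(\ell)=\phi(C(\ell)(1))$. This is the weak bialgebra corresponding to $L$. Skew pairings and $H^\vee$: a skew pairing between $\times_R$-bialgebras $\Lambda,H$ is a $k$-linear map $\tau\colon\Lambda\otimes H\to R$, written $\tau(\xi|h)$, such that for all $r,s,t,u,v\in R$, $\xi,\zeta\in\Lambda$, $g,h\in H$: $\tau((r\otimes\overline s)\xi(t\otimes\overline u)|h)v=r\tau(\xi|(t\otimes\overline v)h(u\otimes\overline s))$; $\tau(\xi|gh)=\tau(\overline{\tau(\xi_{[2]}|h)}\,\xi_{[1]}|g)$, $\tau(\xi|1)=C(\xi)(1)$; $\tau(\xi\zeta|g)=\tau(\xi|\tau(\zeta|g_{[1]})g_{[2]})$, $\tau(1|h)=C(h)(1)$. If $H$ is finitely generated projective as a left $\overline R$-module (for Frobenius-separable $R$ this is equivalent to $\dim_kH<\infty$), let $H^\vee:=\operatorname{Hom}_{\overline R-}(H,R)$ be the space of $k$-linear maps $\xi\colon H\to R$ with $\xi(\overline vh)=\xi(h)v$ for $v\in R$, $h\in H$. It is known that there is a unique $\times_R$-bialgebra structure on $H^\vee$ such that evaluation $\tau(\xi|h)=\xi(h)$ is a skew pairing between $H^\vee$ and $H$; $H^\vee$ carries this structure. *)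

theory Defs
  imports "Jordan_Normal_Form.Missing_VectorSpace"
begin

section \<open>Algebras over a field\<close>

definition k_algebra :: "('k, 'x) ring_scheme \<Rightarrow> ('k, 'a, 'm) module_scheme \<Rightarrow> bool" where
  "k_algebra K A \<longleftrightarrow> vectorspace K A \<and> ring A \<and>
     (\<forall>c\<in>carrier K. \<forall>x\<in>carrier A. \<forall>y\<in>carrier A.
        (c \<odot>\<^bsub>A\<^esub> x) \<otimes>\<^bsub>A\<^esub> y = c \<odot>\<^bsub>A\<^esub> (x \<otimes>\<^bsub>A\<^esub> y) \<and>
        x \<otimes>\<^bsub>A\<^esub> (c \<odot>\<^bsub>A\<^esub> y) = c \<odot>\<^bsub>A\<^esub> (x \<otimes>\<^bsub>A\<^esub> y))"

text \<open>The field as a one-dimensional vector space over itself.\<close>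

definition base_module :: "('k, 'x) ring_scheme \<Rightarrow> ('k, 'k) module" where
  "base_module K = \<lparr>carrier = carrier K, mult = mult K, one = one K, zero = zero K,
     add = add K, smult = mult K\<rparr>"

definition bilinear_map :: "('k, 'x) ring_scheme \<Rightarrow> ('k, 'a, 'm) module_scheme \<Rightarrow>
    ('k, 'b, 'n) module_scheme \<Rightarrow> ('k, 'c, 'p) module_scheme \<Rightarrow> ('a \<Rightarrow> 'b \<Rightarrow> 'c) \<Rightarrow> bool" where
  "bilinear_map K M N P f \<longleftrightarrow>
     (\<forall>m\<in>carrier M. f m \<in> module_hom K N P) \<and>
     (\<forall>n\<in>carrier N. (\<lambda>m. f m n) \<in> module_hom K M P)"

definition lsum :: "('a, 'm) ring_scheme \<Rightarrow> 'a list \<Rightarrow> 'a" where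
  "lsum A xs = foldr (\<lambda>x s. x \<oplus>\<^bsub>A\<^esub> s) xs \<zero>\<^bsub>A\<^esub>"


section \<open>Tensor products by generators and relations\<close>

text \<open>A list over \<open>X\<close> stands for the formal sum of its entries. \<open>fsum_eq X G\<close> is the congruence on
  formal sums generated by commutativity and the relations \<open>G\<close>. An element of a tensor product is
  an equivalence class of formal sums of pure tensors, a pure tensor being a pair
  (or a triple, for threefold products).\<close>

inductive fsum_eq :: "'x set \<Rightarrow> ('x list \<times> 'x list) set \<Rightarrow> 'x list \<Rightarrow> 'x list \<Rightarrow> bool"
  for X :: "'x set" and G :: "('x list \<times> 'x list) set" where
  gen: "(xs, ys) \<in> G \<Longrightarrow> xs \<in> lists X \<Longrightarrow> ys \<in> lists X \<Longrightarrow> fsum_eq X G xs ys"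
| refl: "xs \<in> lists X \<Longrightarrow> fsum_eq X G xs xs"
| sym: "fsum_eq X G xs ys \<Longrightarrow> fsum_eq X G ys xs"
| trans: "fsum_eq X G xs ys \<Longrightarrow> fsum_eq X G ys zs \<Longrightarrow> fsum_eq X G xs zs"
| append: "fsum_eq X G xs ys \<Longrightarrow> fsum_eq X G us vs \<Longrightarrow> fsum_eq X G (xs @ us) (ys @ vs)"
| comm: "xs \<in> lists X \<Longrightarrow> ys \<in> lists X \<Longrightarrow> fsum_eq X G (xs @ ys) (ys @ xs)"

definition fsum_class :: "'x set \<Rightarrow> ('x list \<times> 'x list) set \<Rightarrow> 'x list \<Rightarrow> 'x list set" where
  "fsum_class X G xs = {ys. fsum_eq X G xs ys}"

definition fsum_quot :: "'x set \<Rightarrow> ('x list \<times> 'x list) set \<Rightarrow> 'x list set set" where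
  "fsum_quot X G = fsum_class X G ` lists X"

text \<open>Sweedler notation: \<open>(a, b) \<leftarrow> rep t\<close> lets \<open>a\<close> and \<open>b\<close> run through the tensor factors of some
  representative of \<open>t\<close>. It is only used in expressions that are well defined on the tensor product
  (for the multiplicativity of \<open>Gam\<close> below: on \<open>times_R\<close>), so that the choice of the representative
  does not matter.\<close>

definition rep :: "'x list set \<Rightarrow> 'x list" where
  "rep t = (SOME xs. xs \<in> t)"

inductive_set tensor_rels :: "('k, 'x) ring_scheme \<Rightarrow> ('k, 'a, 'm) module_scheme \<Rightarrow>
    ('k, 'b, 'n) module_scheme \<Rightarrow> (('a \<times> 'b) list \<times> ('a \<times> 'b) list) set"
  for K :: "('k, 'x) ring_scheme" and M :: "('k, 'a, 'm) module_scheme"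
    and N :: "('k, 'b, 'n) module_scheme" where
  add_left: "m \<in> carrier M \<Longrightarrow> m' \<in> carrier M \<Longrightarrow> n \<in> carrier N \<Longrightarrow>
    ([(m \<oplus>\<^bsub>M\<^esub> m', n)], [(m, n), (m', n)]) \<in> tensor_rels K M N"
| add_right: "m \<in> carrier M \<Longrightarrow> n \<in> carrier N \<Longrightarrow> n' \<in> carrier N \<Longrightarrow>
    ([(m, n \<oplus>\<^bsub>N\<^esub> n')], [(m, n), (m, n')]) \<in> tensor_rels K M N"
| zero_left: "n \<in> carrier N \<Longrightarrow> ([(\<zero>\<^bsub>M\<^esub>, n)], []) \<in> tensor_rels K M N"
| zero_right: "m \<in> carrier M \<Longrightarrow> ([(m, \<zero>\<^bsub>N\<^esub>)], []) \<in> tensor_rels K M N"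
| scalar: "c \<in> carrier K \<Longrightarrow> m \<in> carrier M \<Longrightarrow> n \<in> carrier N \<Longrightarrow>
    ([(c \<odot>\<^bsub>M\<^esub> m, n)], [(m, c \<odot>\<^bsub>N\<^esub> n)]) \<in> tensor_rels K M N"

definition tensor :: "('k, 'x) ring_scheme \<Rightarrow> ('k, 'a, 'm) module_scheme \<Rightarrow>
    ('k, 'b, 'n) module_scheme \<Rightarrow> ('a \<times> 'b) list set set" where
  "tensor K M N = fsum_quot (carrier M \<times> carrier N) (tensor_rels K M N)"

definition tensor_class :: "('k, 'x) ring_scheme \<Rightarrow> ('k, 'a, 'm) module_scheme \<Rightarrow>
    ('k, 'b, 'n) module_scheme \<Rightarrow> ('a \<times> 'b) list \<Rightarrow> ('a \<times> 'b) list set" where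
  "tensor_class K M N = fsum_class (carrier M \<times> carrier N) (tensor_rels K M N)"

text \<open>Relations for a threefold product: those of the twofold product in the first two and in
  the last two factors.\<close>

definition triple_rels :: "'a set \<Rightarrow> (('a \<times> 'a) list \<times> ('a \<times> 'a) list) set \<Rightarrow>
    (('a \<times> 'a \<times> 'a) list \<times> ('a \<times> 'a \<times> 'a) list) set" where
  "triple_rels X G =
     {([(a, b, c). (a, b) \<leftarrow> xs], [(a, b, c). (a, b) \<leftarrow> ys]) |xs ys c. (xs, ys) \<in> G \<and> c \<in> X} \<union>
     {([(c, a, b). (a, b) \<leftarrow> xs], [(c, a, b). (a, b) \<leftarrow> ys]) |xs ys c. (xs, ys) \<in> G \<and> c \<in> X}"

text \<open>In the next two definitions \<open>G\<close> is one of \<open>tensor_rels K A A\<close> or (see below) the relations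
  defining \<open>A \<diamondop> A\<close>; \<open>D\<close> is a map from \<open>A\<close> to the quotient.\<close>

definition linear_into :: "('k, 'x) ring_scheme \<Rightarrow> ('k, 'a, 'm) module_scheme \<Rightarrow>
    (('a \<times> 'a) list \<times> ('a \<times> 'a) list) set \<Rightarrow> ('a \<Rightarrow> ('a \<times> 'a) list set) \<Rightarrow> bool" where
  "linear_into K A G D \<longleftrightarrow>
     (\<forall>x\<in>carrier A. D x \<in> fsum_quot (carrier A \<times> carrier A) G) \<and>
     (\<forall>x\<in>carrier A. \<forall>y\<in>carrier A.
        D (x \<oplus>\<^bsub>A\<^esub> y) = fsum_class (carrier A \<times> carrier A) G (rep (D x) @ rep (D y))) \<and>
     (\<forall>c\<in>carrier K. \<forall>x\<in>carrier A.
        D (c \<odot>\<^bsub>A\<^esub> x) = fsum_class (carrier A \<times> carrier A) G [(c \<odot>\<^bsub>A\<^esub> a, b). (a, b) \<leftarrow> rep (D x)])"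

definition coassociative :: "('k, 'a, 'm) module_scheme \<Rightarrow>
    (('a \<times> 'a) list \<times> ('a \<times> 'a) list) set \<Rightarrow> ('a \<Rightarrow> ('a \<times> 'a) list set) \<Rightarrow> bool" where
  "coassociative A G D \<longleftrightarrow>
     (\<forall>x\<in>carrier A. fsum_eq (carrier A \<times> carrier A \<times> carrier A) (triple_rels (carrier A) G)
        [(a, b, n). (m, n) \<leftarrow> rep (D x), (a, b) \<leftarrow> rep (D m)]
        [(m, a, b). (m, n) \<leftarrow> rep (D x), (a, b) \<leftarrow> rep (D n)])"


section \<open>Frobenius systems\<close>

definition frobenius_system :: "('k, 'x) ring_scheme \<Rightarrow> ('k, 'r, 'm) module_scheme \<Rightarrow>
    ('r \<Rightarrow> 'k) \<Rightarrow> ('r \<times> 'r) list set \<Rightarrow> bool" where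
  "frobenius_system K R \<phi> e \<longleftrightarrow>
     \<phi> \<in> module_hom K R (base_module K) \<and> e \<in> tensor K R R \<and>
     (\<forall>r\<in>carrier R.
        r = lsum R [\<phi> (r \<otimes>\<^bsub>R\<^esub> a) \<odot>\<^bsub>R\<^esub> b. (a, b) \<leftarrow> rep e] \<and>
        r = lsum R [\<phi> (b \<otimes>\<^bsub>R\<^esub> r) \<odot>\<^bsub>R\<^esub> a. (a, b) \<leftarrow> rep e])"

definition idempotent_frobenius_system :: "('k, 'x) ring_scheme \<Rightarrow> ('k, 'r, 'm) module_scheme \<Rightarrow>
    ('r \<Rightarrow> 'k) \<Rightarrow> ('r \<times> 'r) list set \<Rightarrow> bool" where
  "idempotent_frobenius_system K R \<phi> e \<longleftrightarrow>
     frobenius_system K R \<phi> e \<and> lsum R [a \<otimes>\<^bsub>R\<^esub> b. (a, b) \<leftarrow> rep e] = \<one>\<^bsub>R\<^esub>"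


section \<open>Weak bialgebras\<close>

record ('k, 'a) bialg = "('k, 'a) module" +
  comul :: "'a \<Rightarrow> ('a \<times> 'a) list set"
  counit :: "'a \<Rightarrow> 'k"

definition weak_bialgebra :: "('k, 'x) ring_scheme \<Rightarrow> ('k, 'a, 'm) bialg_scheme \<Rightarrow> bool" where
  "weak_bialgebra K A \<longleftrightarrow>
     k_algebra K A \<and>
     linear_into K A (tensor_rels K A A) (comul A) \<and>
     coassociative A (tensor_rels K A A) (comul A) \<and>
     counit A \<in> module_hom K A (base_module K) \<and>
     (\<forall>x\<in>carrier A.
        lsum A [counit A a \<odot>\<^bsub>A\<^esub> b. (a, b) \<leftarrow> rep (comul A x)] = x \<and>
        lsum A [counit A b \<odot>\<^bsub>A\<^esub> a. (a, b) \<leftarrow> rep (comul A x)] = x) \<and>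
     (\<forall>g\<in>carrier A. \<forall>h\<in>carrier A.
        comul A (g \<otimes>\<^bsub>A\<^esub> h) = tensor_class K A A
          [(a \<otimes>\<^bsub>A\<^esub> c, b \<otimes>\<^bsub>A\<^esub> d). (a, b) \<leftarrow> rep (comul A g), (c, d) \<leftarrow> rep (comul A h)]) \<and>
     (\<forall>f\<in>carrier A. \<forall>g\<in>carrier A. \<forall>h\<in>carrier A.
        counit A (f \<otimes>\<^bsub>A\<^esub> g \<otimes>\<^bsub>A\<^esub> h) =
          lsum K [counit A (f \<otimes>\<^bsub>A\<^esub> a) \<otimes>\<^bsub>K\<^esub> counit A (b \<otimes>\<^bsub>A\<^esub> h). (a, b) \<leftarrow> rep (comul A g)] \<and>
        counit A (f \<otimes>\<^bsub>A\<^esub> g \<otimes>\<^bsub>A\<^esub> h) =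
          lsum K [counit A (f \<otimes>\<^bsub>A\<^esub> b) \<otimes>\<^bsub>K\<^esub> counit A (a \<otimes>\<^bsub>A\<^esub> h). (a, b) \<leftarrow> rep (comul A g)]) \<and>
     (let D = rep (comul A \<one>\<^bsub>A\<^esub>);
          eq3 = fsum_eq (carrier A \<times> carrier A \<times> carrier A)
                  (triple_rels (carrier A) (tensor_rels K A A))
      in eq3 [(a, b, n). (m, n) \<leftarrow> D, (a, b) \<leftarrow> rep (comul A m)]
             [(a, b \<otimes>\<^bsub>A\<^esub> c, d). (a, b) \<leftarrow> D, (c, d) \<leftarrow> D] \<and>
         eq3 [(a, b, n). (m, n) \<leftarrow> D, (a, b) \<leftarrow> rep (comul A m)]
             [(a, c \<otimes>\<^bsub>A\<^esub> b, d). (a, b) \<leftarrow> D, (c, d) \<leftarrow> D])"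

definition weak_bialgebra_iso :: "('k, 'x) ring_scheme \<Rightarrow> ('k, 'a, 'm) bialg_scheme \<Rightarrow>
    ('k, 'b, 'n) bialg_scheme \<Rightarrow> ('a \<Rightarrow> 'b) \<Rightarrow> bool" where
  "weak_bialgebra_iso K A B F \<longleftrightarrow>
     weak_bialgebra K A \<and> weak_bialgebra K B \<and>
     bij_betw F (carrier A) (carrier B) \<and> F \<in> module_hom K A B \<and>
     (\<forall>x\<in>carrier A. \<forall>y\<in>carrier A. F (x \<otimes>\<^bsub>A\<^esub> y) = F x \<otimes>\<^bsub>B\<^esub> F y) \<and>
     F \<one>\<^bsub>A\<^esub> = \<one>\<^bsub>B\<^esub> \<and>
     (\<forall>x\<in>carrier A.
        comul B (F x) = tensor_class K B B [(F a, F b). (a, b) \<leftarrow> rep (comul A x)]) \<and>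
     (\<forall>x\<in>carrier A. counit B (F x) = counit A x)"

text \<open>Linear forms on \<open>A\<close> are made extensional (\<open>undefined\<close> off the carrier), so that they are
  determined by their values on \<open>A\<close>.\<close>

definition dual_space :: "('k, 'x) ring_scheme \<Rightarrow> ('k, 'a, 'm) module_scheme \<Rightarrow> ('a \<Rightarrow> 'k) set" where
  "dual_space K A = module_hom K A (base_module K) \<inter> extensional (carrier A)"

definition dual_module :: "('k, 'x) ring_scheme \<Rightarrow> ('k, 'a, 'm) bialg_scheme \<Rightarrow>
    ('k, 'a \<Rightarrow> 'k) module" where
  "dual_module K A = \<lparr>
     carrier = dual_space K A,
     mult = (\<lambda>f g. \<lambda>h\<in>carrier A. lsum K [f a \<otimes>\<^bsub>K\<^esub> g b. (a, b) \<leftarrow> rep (comul A h)]),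
     one = (\<lambda>h\<in>carrier A. counit A h),
     zero = (\<lambda>h\<in>carrier A. \<zero>\<^bsub>K\<^esub>),
     add = (\<lambda>f g. \<lambda>h\<in>carrier A. f h \<oplus>\<^bsub>K\<^esub> g h),
     smult = (\<lambda>c f. \<lambda>h\<in>carrier A. c \<otimes>\<^bsub>K\<^esub> f h)\<rparr>"

text \<open>The comultiplication of the dual is the transpose of the multiplication, followed by the
  inverse of the canonical injection of the tensor square of the dual into the dual of the
  tensor square, which exists when \<open>A\<close> is finite dimensional.\<close>

definition dual_bialg :: "('k, 'x) ring_scheme \<Rightarrow> ('k, 'a, 'm) bialg_scheme \<Rightarrow>
    ('k, 'a \<Rightarrow> 'k) bialg" where
  "dual_bialg K A = module.extend (dual_module K A) \<lparr>
     comul = (\<lambda>f. THE t. t \<in> tensor K (dual_module K A) (dual_module K A) \<and>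
        (\<forall>g\<in>carrier A. \<forall>h\<in>carrier A.
           lsum K [f1 g \<otimes>\<^bsub>K\<^esub> f2 h. (f1, f2) \<leftarrow> rep t] = f (g \<otimes>\<^bsub>A\<^esub> h))),
     counit = (\<lambda>f. f \<one>\<^bsub>A\<^esub>)\<rparr>"

definition op_bialg :: "('k, 'a, 'm) bialg_scheme \<Rightarrow> ('k, 'a, 'm) bialg_scheme" where
  "op_bialg A = A\<lparr>mult := \<lambda>x y. y \<otimes>\<^bsub>A\<^esub> x\<rparr>"


section \<open>Bialgebras over a noncommutative base\<close>

text \<open>\<open>emb L r s\<close> is the image in \<open>L\<close> of \<open>r \<otimes> s\<close>, \<open>s\<close> taken in the opposite algebra, under the
  structure map of the \<open>R\<^sup>e\<close>-ring \<open>L\<close>; so \<open>src R L r\<close> and \<open>tgt R L s\<close> are the elements written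
  \<open>r\<close> and (overlined) \<open>s\<close> of \<open>L\<close>. \<open>Gam L\<close> takes values in \<open>L \<diamondop> L\<close>, and \<open>Cou L l\<close> is an endomorphism of \<open>R\<close>.\<close>

record ('k, 'r, 'l) times_bialg = "('k, 'l) module" +
  emb :: "'r \<Rightarrow> 'r \<Rightarrow> 'l"
  Gam :: "'l \<Rightarrow> ('l \<times> 'l) list set"
  Cou :: "'l \<Rightarrow> 'r \<Rightarrow> 'r"

definition src :: "('k, 'r, 'm) module_scheme \<Rightarrow> ('k, 'r, 'l, 'n) times_bialg_scheme \<Rightarrow> 'r \<Rightarrow> 'l" where
  "src R L r = emb L r \<one>\<^bsub>R\<^esub>"

definition tgt :: "('k, 'r, 'm) module_scheme \<Rightarrow> ('k, 'r, 'l, 'n) times_bialg_scheme \<Rightarrow> 'r \<Rightarrow> 'l" where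
  "tgt R L s = emb L \<one>\<^bsub>R\<^esub> s"

text \<open>An algebra map out of the enveloping algebra is given by its bilinear map on pure tensors.
  The second argument lives in the opposite algebra, hence \<open>s' \<otimes> s\<close> below.\<close>

definition Re_ring :: "('k, 'x) ring_scheme \<Rightarrow> ('k, 'r, 'm) module_scheme \<Rightarrow>
    ('k, 'r, 'l, 'n) times_bialg_scheme \<Rightarrow> bool" where
  "Re_ring K R L \<longleftrightarrow>
     k_algebra K L \<and> bilinear_map K R R L (emb L) \<and>
     emb L \<one>\<^bsub>R\<^esub> \<one>\<^bsub>R\<^esub> = \<one>\<^bsub>L\<^esub> \<and>
     (\<forall>r\<in>carrier R. \<forall>s\<in>carrier R. \<forall>r'\<in>carrier R. \<forall>s'\<in>carrier R.
        emb L r s \<otimes>\<^bsub>L\<^esub> emb L r' s' = emb L (r \<otimes>\<^bsub>R\<^esub> r') (s' \<otimes>\<^bsub>R\<^esub> s))"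

inductive_set diamond_rels :: "('k, 'x) ring_scheme \<Rightarrow> ('k, 'r, 'm) module_scheme \<Rightarrow>
    ('k, 'r, 'l, 'n) times_bialg_scheme \<Rightarrow> (('l \<times> 'l) list \<times> ('l \<times> 'l) list) set"
  for K :: "('k, 'x) ring_scheme" and R :: "('k, 'r, 'm) module_scheme"
    and L :: "('k, 'r, 'l, 'n) times_bialg_scheme" where
  tensor: "p \<in> tensor_rels K L L \<Longrightarrow> p \<in> diamond_rels K R L"
| balanced: "r \<in> carrier R \<Longrightarrow> m \<in> carrier L \<Longrightarrow> n \<in> carrier L \<Longrightarrow>
    ([(tgt R L r \<otimes>\<^bsub>L\<^esub> m, n)], [(m, src R L r \<otimes>\<^bsub>L\<^esub> n)]) \<in> diamond_rels K R L"

definition diamond :: "('k, 'x) ring_scheme \<Rightarrow> ('k, 'r, 'm) module_scheme \<Rightarrow>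
    ('k, 'r, 'l, 'n) times_bialg_scheme \<Rightarrow> ('l \<times> 'l) list set set" where
  "diamond K R L = fsum_quot (carrier L \<times> carrier L) (diamond_rels K R L)"

definition diamond_class :: "('k, 'x) ring_scheme \<Rightarrow> ('k, 'r, 'm) module_scheme \<Rightarrow>
    ('k, 'r, 'l, 'n) times_bialg_scheme \<Rightarrow> ('l \<times> 'l) list \<Rightarrow> ('l \<times> 'l) list set" where
  "diamond_class K R L = fsum_class (carrier L \<times> carrier L) (diamond_rels K R L)"

definition times_R :: "('k, 'x) ring_scheme \<Rightarrow> ('k, 'r, 'm) module_scheme \<Rightarrow>
    ('k, 'r, 'l, 'n) times_bialg_scheme \<Rightarrow> ('l \<times> 'l) list set set" where
  "times_R K R L = {t \<in> diamond K R L. \<forall>s\<in>carrier R.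
     diamond_class K R L [(m \<otimes>\<^bsub>L\<^esub> tgt R L s, n). (m, n) \<leftarrow> rep t] =
     diamond_class K R L [(m, n \<otimes>\<^bsub>L\<^esub> src R L s). (m, n) \<leftarrow> rep t]}"

definition times_bialgebra :: "('k, 'x) ring_scheme \<Rightarrow> ('k, 'r, 'm) module_scheme \<Rightarrow>
    ('k, 'r, 'l, 'n) times_bialg_scheme \<Rightarrow> bool" where
  "times_bialgebra K R L \<longleftrightarrow>
     Re_ring K R L \<and>
     \<comment> \<open>\<open>Gam L\<close> is a homomorphism of \<open>R\<^sup>e\<close>-rings to \<open>times_R K R L\<close>; it preserves 1 since \<open>emb L 1 1 = 1\<close>\<close>
     linear_into K L (diamond_rels K R L) (Gam L) \<and>
     (\<forall>l\<in>carrier L. Gam L l \<in> times_R K R L) \<and>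
     (\<forall>g\<in>carrier L. \<forall>h\<in>carrier L.
        Gam L (g \<otimes>\<^bsub>L\<^esub> h) = diamond_class K R L
          [(m \<otimes>\<^bsub>L\<^esub> p, n \<otimes>\<^bsub>L\<^esub> q). (m, n) \<leftarrow> rep (Gam L g), (p, q) \<leftarrow> rep (Gam L h)]) \<and>
     (\<forall>r\<in>carrier R. \<forall>s\<in>carrier R.
        Gam L (emb L r s) = diamond_class K R L [(src R L r, tgt R L s)]) \<and>
     \<comment> \<open>\<open>Cou L\<close> is a homomorphism of \<open>R\<^sup>e\<close>-rings to the linear endomorphisms of \<open>R\<close>\<close>
     (\<forall>l\<in>carrier L. Cou L l \<in> module_hom K R R) \<and>
     (\<forall>t\<in>carrier R. (\<lambda>l. Cou L l t) \<in> module_hom K L R) \<and>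
     (\<forall>g\<in>carrier L. \<forall>h\<in>carrier L. \<forall>t\<in>carrier R. Cou L (g \<otimes>\<^bsub>L\<^esub> h) t = Cou L g (Cou L h t)) \<and>
     (\<forall>r\<in>carrier R. \<forall>s\<in>carrier R. \<forall>t\<in>carrier R.
        Cou L (emb L r s) t = r \<otimes>\<^bsub>R\<^esub> t \<otimes>\<^bsub>R\<^esub> s) \<and>
     coassociative L (diamond_rels K R L) (Gam L) \<and>
     (\<forall>l\<in>carrier L.
        lsum L [tgt R L (Cou L n \<one>\<^bsub>R\<^esub>) \<otimes>\<^bsub>L\<^esub> m. (m, n) \<leftarrow> rep (Gam L l)] = l \<and>
        lsum L [src R L (Cou L m \<one>\<^bsub>R\<^esub>) \<otimes>\<^bsub>L\<^esub> n. (m, n) \<leftarrow> rep (Gam L l)] = l)"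

definition corresponding_wb :: "('k, 'x) ring_scheme \<Rightarrow> ('k, 'r, 'm) module_scheme \<Rightarrow>
    ('r \<Rightarrow> 'k) \<Rightarrow> ('r \<times> 'r) list set \<Rightarrow> ('k, 'r, 'l, 'n) times_bialg_scheme \<Rightarrow> ('k, 'l) bialg" where
  "corresponding_wb K R \<phi> e L = module.extend (module.truncate L) \<lparr>
     comul = (\<lambda>l. tensor_class K L L
        [(tgt R L a \<otimes>\<^bsub>L\<^esub> m, src R L b \<otimes>\<^bsub>L\<^esub> n). (a, b) \<leftarrow> rep e, (m, n) \<leftarrow> rep (Gam L l)]),
     counit = (\<lambda>l. \<phi> (Cou L l \<one>\<^bsub>R\<^esub>))\<rparr>"


section \<open>Skew pairings and the dual over the base\<close>

definition skew_pairing :: "('k, 'x) ring_scheme \<Rightarrow> ('k, 'r, 'm) module_scheme \<Rightarrow>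
    ('k, 'r, 'l, 'n) times_bialg_scheme \<Rightarrow> ('k, 'r, 'h, 'p) times_bialg_scheme \<Rightarrow>
    ('l \<Rightarrow> 'h \<Rightarrow> 'r) \<Rightarrow> bool" where
  "skew_pairing K R \<Lambda> H \<tau> \<longleftrightarrow>
     bilinear_map K \<Lambda> H R \<tau> \<and>
     (\<forall>r\<in>carrier R. \<forall>s\<in>carrier R. \<forall>t\<in>carrier R. \<forall>u\<in>carrier R. \<forall>v\<in>carrier R.
        \<forall>\<xi>\<in>carrier \<Lambda>. \<forall>h\<in>carrier H.
        \<tau> (emb \<Lambda> r s \<otimes>\<^bsub>\<Lambda>\<^esub> \<xi> \<otimes>\<^bsub>\<Lambda>\<^esub> emb \<Lambda> t u) h \<otimes>\<^bsub>R\<^esub> v =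
        r \<otimes>\<^bsub>R\<^esub> \<tau> \<xi> (emb H t v \<otimes>\<^bsub>H\<^esub> h \<otimes>\<^bsub>H\<^esub> emb H u s)) \<and>
     (\<forall>\<xi>\<in>carrier \<Lambda>. \<forall>g\<in>carrier H. \<forall>h\<in>carrier H.
        \<tau> \<xi> (g \<otimes>\<^bsub>H\<^esub> h) =
        \<tau> (lsum \<Lambda> [tgt R \<Lambda> (\<tau> \<xi>2 h) \<otimes>\<^bsub>\<Lambda>\<^esub> \<xi>1. (\<xi>1, \<xi>2) \<leftarrow> rep (Gam \<Lambda> \<xi>)]) g) \<and>
     (\<forall>\<xi>\<in>carrier \<Lambda>. \<tau> \<xi> \<one>\<^bsub>H\<^esub> = Cou \<Lambda> \<xi> \<one>\<^bsub>R\<^esub>) \<and>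
     (\<forall>\<xi>\<in>carrier \<Lambda>. \<forall>\<zeta>\<in>carrier \<Lambda>. \<forall>g\<in>carrier H.
        \<tau> (\<xi> \<otimes>\<^bsub>\<Lambda>\<^esub> \<zeta>) g =
        \<tau> \<xi> (lsum H [src R H (\<tau> \<zeta> g1) \<otimes>\<^bsub>H\<^esub> g2. (g1, g2) \<leftarrow> rep (Gam H g)])) \<and>
     (\<forall>h\<in>carrier H. \<tau> \<one>\<^bsub>\<Lambda>\<^esub> h = Cou H h \<one>\<^bsub>R\<^esub>)"

text \<open>Again the maps are made extensional.\<close>

definition hom_Rbar :: "('k, 'x) ring_scheme \<Rightarrow> ('k, 'r, 'm) module_scheme \<Rightarrow>
    ('k, 'r, 'h, 'n) times_bialg_scheme \<Rightarrow> ('h \<Rightarrow> 'r) set" where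
  "hom_Rbar K R H = {\<xi> \<in> module_hom K H R \<inter> extensional (carrier H).
     \<forall>v\<in>carrier R. \<forall>h\<in>carrier H. \<xi> (tgt R H v \<otimes>\<^bsub>H\<^esub> h) = \<xi> h \<otimes>\<^bsub>R\<^esub> v}"

text \<open>\<open>\<Lambda>\<close> is \<open>H\<^sup>\<or>\<close>: the space \<open>hom_Rbar K R H\<close> with the bialgebra structure that makes evaluation a
  skew pairing. The pointwise vector space structure is part of the condition, by the bilinearity
  of evaluation.\<close>

definition is_vee :: "('k, 'x) ring_scheme \<Rightarrow> ('k, 'r, 'm) module_scheme \<Rightarrow>
    ('k, 'r, 'h, 'n) times_bialg_scheme \<Rightarrow> ('k, 'r, 'h \<Rightarrow> 'r, 'p) times_bialg_scheme \<Rightarrow> bool" where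
  "is_vee K R H \<Lambda> \<longleftrightarrow>
     times_bialgebra K R \<Lambda> \<and> carrier \<Lambda> = hom_Rbar K R H \<and>
     skew_pairing K R \<Lambda> H (\<lambda>\<xi> h. \<xi> h)"

end

theory Submission
  imports Defs
begin

text \<open>The isomorphism sends \<open>\<xi>\<close> to \<open>\<phi> \<circ> \<xi>\<close>; its inverse sends a linear form \<open>f\<close> to \<open>h \<mapsto> f (e\<^sub>1 h) e\<^sub>2\<close>, with
  \<open>e\<^sub>1\<close> acting through the opposite algebra. That it respects the bialgebra structures is read off
  the axioms of a skew pairing, the Frobenius system contracting by \<open>\<phi> (x e\<^sub>1) e\<^sub>2 = x = e\<^sub>1 \<phi> (e\<^sub>2 x)\<close>;
  for the comultiplication, an element of the tensor square of the dual is recognized by its values.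
  The weak bialgebra axioms need a proof only for the bialgebra corresponding to \<open>H\<^sup>\<or>\<close>, because they
  can be transported to the dual. There the Casimir property \<open>r e\<^sub>1 \<otimes> e\<^sub>2 = e\<^sub>1 \<otimes> e\<^sub>2 r\<close> turns
  identities in \<open>L \<diamondop> L\<close> into identities in \<open>L \<otimes> L\<close>, and \<open>e\<^sub>1 e\<^sub>2 = 1\<close>, together with the condition
  defining \<open>times_R\<close>, gives multiplicativity.\<close>


section \<open>Formal sums\<close>

text \<open>Sweedler sums run over an arbitrary representative picked by \<open>rep\<close>.
  Identities in tensor products are therefore proved as congruences \<open>fsum_eq\<close> between
  lists, and every change of representative needs a proof that the surrounding expression respects
  the defining relations. Factorwise multiplication on \<open>L \<diamondop> L\<close> is the
  delicate case: it respects a change in the left factor, since the balancing acts from the left,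
  but for the right factor this depends on \<open>times_R\<close>. The proof never changes the
  representative of a right factor in \<open>L \<diamondop> L\<close>; it passes to
  \<open>L \<otimes> L\<close> first, where multiplication respects both. Finite dimension enters
  through a basis of \<open>H\<close> with its coordinate functionals, which is what makes an
  element of the tensor square of the dual recoverable from its values.\<close>

declare fsum_eq.trans [trans]

lemma fsum_eq_trans_eq [trans]:
  "xs = ys \<Longrightarrow> fsum_eq X G ys zs \<Longrightarrow> fsum_eq X G xs zs"
  "fsum_eq X G xs ys \<Longrightarrow> ys = zs \<Longrightarrow> fsum_eq X G xs zs"
  by simp_all

lemma fsum_eq_lists: "fsum_eq X G xs ys \<Longrightarrow> xs \<in> lists X \<and> ys \<in> lists X"
  by (induction rule: fsum_eq.induct) auto

lemma fsum_class_eq_iff: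
  assumes "ys \<in> lists X"
  shows "fsum_class X G xs = fsum_class X G ys \<longleftrightarrow> fsum_eq X G xs ys"
proof
  assume "fsum_class X G xs = fsum_class X G ys"
  moreover have "ys \<in> fsum_class X G ys"
    using assms by (simp add: fsum_class_def fsum_eq.refl)
  ultimately show "fsum_eq X G xs ys"
    by (auto simp: fsum_class_def)
next
  assume "fsum_eq X G xs ys"
  then have "fsum_eq X G xs zs = fsum_eq X G ys zs" for zs
    using fsum_eq.trans[of X G xs ys zs] fsum_eq.trans[of X G ys xs zs] fsum_eq.sym[of X G xs ys]
    by iprover
  then show "fsum_class X G xs = fsum_class X G ys"
    by (simp add: fsum_class_def)
qed

lemma fsum_eq_rep_class:
  assumes "xs \<in> lists X"
  shows "fsum_eq X G xs (rep (fsum_class X G xs))"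
proof -
  have "xs \<in> fsum_class X G xs"
    using assms by (simp add: fsum_class_def fsum_eq.refl)
  then have "rep (fsum_class X G xs) \<in> fsum_class X G xs"
    unfolding rep_def by (rule someI)
  then show ?thesis
    by (simp add: fsum_class_def)
qed

text \<open>The bialgebra axioms state equations between classes. This turns such an equation into a
  congruence for the chosen representative, the form in which the later computations run.\<close>

lemma fsum_eq_rep_classD:
  assumes "t = fsum_class X G xs" "xs \<in> lists X"
  shows "fsum_eq X G (rep t) xs"
  unfolding assms(1) by (rule fsum_eq.sym[OF fsum_eq_rep_class[OF assms(2)]])

lemma fsum_class_in_quot: "xs \<in> lists X \<Longrightarrow> fsum_class X G xs \<in> fsum_quot X G"
  by (simp add: fsum_quot_def)

lemma rep_in_lists: "t \<in> fsum_quot X G \<Longrightarrow> rep t \<in> lists X"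
proof -
  assume "t \<in> fsum_quot X G"
  then obtain xs where xs: "xs \<in> lists X" "t = fsum_class X G xs"
    by (auto simp: fsum_quot_def)
  show ?thesis
    unfolding xs(2) using fsum_eq_lists[OF fsum_eq_rep_class[OF xs(1)]] by (rule conjunct2)
qed

lemma fsum_class_rep:
  assumes "t \<in> fsum_quot X G"
  shows "fsum_class X G (rep t) = t"
proof -
  obtain xs where xs: "xs \<in> lists X" "t = fsum_class X G xs"
    using assms by (auto simp: fsum_quot_def)
  then have "fsum_eq X G (rep t) xs"
    by (simp add: fsum_eq_rep_classD)
  then show ?thesis
    unfolding xs(2)[symmetric] using fsum_class_eq_iff[OF xs(1)] xs(2) by simp
qed

text \<open>Block commutativity together with \<open>append\<close> generates all permutations.
  Hence reorderings of nested formal sums can be checked on multisets, where sums commute.\<close>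

lemma fsum_eq_mset:
  "mset xs = mset ys \<Longrightarrow> xs \<in> lists X \<Longrightarrow> fsum_eq X G xs ys"
proof (induction xs arbitrary: ys)
  case Nil
  then show ?case by (simp add: fsum_eq.refl)
next
  case (Cons x xs)
  then have "x \<in> set ys"
    by (metis list.set_intros(1) mset_eq_setD)
  then obtain us vs where ys: "ys = us @ x # vs"
    by (meson split_list)
  have mem: "[x] \<in> lists X" "us \<in> lists X" "vs \<in> lists X"
    using Cons.prems mset_eq_setD[OF Cons.prems(1)] by (auto simp: ys)
  have "fsum_eq X G xs (us @ vs)"
    using Cons by (simp add: ys)
  then have "fsum_eq X G ([x] @ xs) ([x] @ us @ vs)"
    using mem(1) by (intro fsum_eq.append fsum_eq.refl)
  also have "[x] @ us @ vs = ([x] @ us) @ vs" by simp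
  also have "fsum_eq X G \<dots> ((us @ [x]) @ vs)"
    using mem by (intro fsum_eq.append fsum_eq.refl fsum_eq.comm)
  finally show ?case
    by (simp add: ys)
qed

lemma fsum_eq_concat_cong:
  "(\<And>x. x \<in> set xs \<Longrightarrow> fsum_eq Y G (f x) (g x)) \<Longrightarrow>
   fsum_eq Y G (concat (map f xs)) (concat (map g xs))"
  by (induction xs) (auto intro: fsum_eq.append fsum_eq.refl)

lemma mset_concat_map: "mset (concat (map f xs)) = (\<Sum>x\<in>#mset xs. mset (f x))"
  by (induction xs) auto

lemma mset_map_sum: "mset (map f xs) = (\<Sum>x\<in>#mset xs. {#f x#})"
  by (induction xs) auto

lemma mset_concat_swap:
  "mset (concat (map (\<lambda>x. concat (map (f x) ys)) xs)) =
   mset (concat (map (\<lambda>y. concat (map (\<lambda>x. f x y) xs)) ys))"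
  unfolding mset_concat_map by (rule sum_mset.swap)

text \<open>The regrouping of a fourfold sum that multiplicativity of the coproduct calls for, see
  \<open>comul_mult\<close>.\<close>

lemma sum_mset_rotate:
  "(\<Sum>x\<in>#A. \<Sum>y\<in>#B. \<Sum>z\<in>#C. \<Sum>w\<in>#D. F x y z w) =
   (\<Sum>y\<in>#B. \<Sum>w\<in>#D. \<Sum>z\<in>#C. \<Sum>x\<in>#A. (F x y z w :: 'a :: comm_monoid_add))"
proof -
  have "(\<Sum>x\<in>#A. \<Sum>z\<in>#C. \<Sum>w\<in>#D. F x y z w) = (\<Sum>w\<in>#D. \<Sum>z\<in>#C. \<Sum>x\<in>#A. F x y z w)" for y
  proof -
    have "(\<Sum>x\<in>#A. \<Sum>z\<in>#C. \<Sum>w\<in>#D. F x y z w) = (\<Sum>z\<in>#C. \<Sum>x\<in>#A. \<Sum>w\<in>#D. F x y z w)"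
      by (rule sum_mset.swap)
    also have "\<dots> = (\<Sum>z\<in>#C. \<Sum>w\<in>#D. \<Sum>x\<in>#A. F x y z w)"
      by (intro arg_cong[where f = sum_mset] image_mset_cong sum_mset.swap)
    also have "\<dots> = (\<Sum>w\<in>#D. \<Sum>z\<in>#C. \<Sum>x\<in>#A. F x y z w)"
      by (rule sum_mset.swap)
    finally show ?thesis .
  qed
  moreover have "(\<Sum>x\<in>#A. \<Sum>y\<in>#B. \<Sum>z\<in>#C. \<Sum>w\<in>#D. F x y z w) =
      (\<Sum>y\<in>#B. \<Sum>x\<in>#A. \<Sum>z\<in>#C. \<Sum>w\<in>#D. F x y z w)"
    by (rule sum_mset.swap)
  ultimately show ?thesis by simp
qed

lemma fsum_eq_concat_swap:
  assumes "\<And>x y. x \<in> set xs \<Longrightarrow> y \<in> set ys \<Longrightarrow> f x y \<in> lists Y"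
  shows "fsum_eq Y G (concat (map (\<lambda>x. concat (map (f x) ys)) xs))
           (concat (map (\<lambda>y. concat (map (\<lambda>x. f x y) xs)) ys))"
  using assms by (intro fsum_eq_mset mset_concat_swap) (auto simp: lists_eq_set)

text \<open>The test for a map out of a tensor product that is given on pure tensors. Values are
  formal sums rather than classes, so a map may itself contain a Sweedler sum, and such maps compose
  without a choice of representatives.\<close>

definition fsum_hom :: "'x set \<Rightarrow> ('x list \<times> 'x list) set \<Rightarrow> 'y set \<Rightarrow> ('y list \<times> 'y list) set
    \<Rightarrow> ('x \<Rightarrow> 'y list) \<Rightarrow> bool" where
  "fsum_hom X G Y G' f \<longleftrightarrow> (\<forall>x\<in>X. f x \<in> lists Y) \<and>
     (\<forall>xs ys. (xs, ys) \<in> G \<longrightarrow> xs \<in> lists X \<longrightarrow> ys \<in> lists X \<longrightarrow>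
        fsum_eq Y G' (concat (map f xs)) (concat (map f ys)))"

lemma fsum_homI:
  assumes "\<And>x. x \<in> X \<Longrightarrow> f x \<in> lists Y"
    and "\<And>xs ys. (xs, ys) \<in> G \<Longrightarrow> xs \<in> lists X \<Longrightarrow> ys \<in> lists X \<Longrightarrow>
        fsum_eq Y G' (concat (map f xs)) (concat (map f ys))"
  shows "fsum_hom X G Y G' f"
  using assms unfolding fsum_hom_def by blast

lemma concat_map_in_lists:
  "(\<And>x. x \<in> set xs \<Longrightarrow> f x \<in> lists Y) \<Longrightarrow> concat (map f xs) \<in> lists Y"
  by (induction xs) auto

lemma fsum_hom_eq:
  assumes "fsum_hom X G Y G' f" "fsum_eq X G xs ys"
  shows "fsum_eq Y G' (concat (map f xs)) (concat (map f ys))"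
  using assms(2)
proof (induction rule: fsum_eq.induct)
  case (gen xs ys)
  then show ?case using assms(1) by (auto simp: fsum_hom_def)
next
  case (refl xs)
  then show ?case using assms(1)
    by (intro fsum_eq.refl concat_map_in_lists) (auto simp: fsum_hom_def)
next
  case (comm xs ys)
  then show ?case using assms(1)
    by (auto intro!: fsum_eq.comm concat_map_in_lists simp: fsum_hom_def)
next
  case (sym xs ys)
  show ?case using sym.IH by (rule fsum_eq.sym)
next
  case (trans xs ys zs)
  show ?case using trans.IH by (rule fsum_eq.trans)
next
  case (append xs ys us vs)
  then show ?case by (simp add: fsum_eq.append)
qed

lemma concat_map_singleton: "concat (map (\<lambda>x. [f x]) xs) = map f xs"
  by (induction xs) auto

lemma fsum_hom_map:
  assumes "fsum_hom X G Y G' (\<lambda>x. [f x])" "fsum_eq X G xs ys"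
  shows "fsum_eq Y G' (map f xs) (map f ys)"
  using fsum_hom_eq[OF assms] by (simp add: concat_map_singleton)

lemma concat_map_concat_map:
  "concat (map f (concat (map g xs))) = concat (map (\<lambda>x. concat (map f (g x))) xs)"
  by (induction xs) auto

lemma fsum_hom_comp:
  assumes "fsum_hom X G Y G' f" "fsum_hom Y G' Z G'' g"
  shows "fsum_hom X G Z G'' (\<lambda>x. concat (map g (f x)))"
proof (rule fsum_homI)
  fix x assume "x \<in> X"
  then have "f x \<in> lists Y" using assms(1) by (simp add: fsum_hom_def)
  then show "concat (map g (f x)) \<in> lists Z"
    using assms(2) by (intro concat_map_in_lists) (auto simp: fsum_hom_def)
next
  fix xs ys assume "(xs, ys) \<in> G" "xs \<in> lists X" "ys \<in> lists X"
  then show "fsum_eq Z G'' (concat (map (\<lambda>x. concat (map g (f x))) xs))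
      (concat (map (\<lambda>x. concat (map g (f x))) ys))"
    unfolding concat_map_concat_map[symmetric] using assms(1)
    by (intro fsum_hom_eq[OF assms(2)]) (simp add: fsum_hom_def)
qed

lemma fsum_hom_cong:
  assumes "fsum_hom X G Y G' f" "\<And>x. x \<in> X \<Longrightarrow> f x = g x"
  shows "fsum_hom X G Y G' g"
proof -
  have "concat (map f xs) = concat (map g xs)" if "xs \<in> lists X" for xs
    using that assms(2) by (auto intro!: arg_cong[where f = concat])
  then show ?thesis using assms unfolding fsum_hom_def by auto
qed

text \<open>For maps whose values agree only after a reordering of sums, as happens in
  \<open>psi3_right_hom\<close>.\<close>

lemma fsum_hom_cong_eq:
  assumes "fsum_hom X G Y G' f" "\<And>x. x \<in> X \<Longrightarrow> fsum_eq Y G' (f x) (g x)"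
  shows "fsum_hom X G Y G' g"
proof (rule fsum_homI)
  show "g x \<in> lists Y" if "x \<in> X" for x
    using fsum_eq_lists[OF assms(2)[OF that]] by simp
  fix xs ys assume *: "(xs, ys) \<in> G" "xs \<in> lists X" "ys \<in> lists X"
  have fg: "fsum_eq Y G' (concat (map f zs)) (concat (map g zs))" if "zs \<in> lists X" for zs
    using that assms(2) by (intro fsum_eq_concat_cong) auto
  have "fsum_eq Y G' (concat (map g xs)) (concat (map f xs))"
    by (rule fsum_eq.sym[OF fg[OF *(2)]])
  also have "fsum_eq Y G' \<dots> (concat (map f ys))"
    using assms(1) * unfolding fsum_hom_def by blast
  also note fg[OF *(3)]
  finally show "fsum_eq Y G' (concat (map g xs)) (concat (map g ys))" .
qed

text \<open>Exchanging the two sums reduces the claim to a single summand. The index list will be a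
  representative of \<open>e\<close> or of \<open>Gam L x\<close>.\<close>

lemma fsum_hom_sum:
  assumes "\<And>i. i \<in> set is \<Longrightarrow> fsum_hom X G Y G' (f i)"
  shows "fsum_hom X G Y G' (\<lambda>x. concat (map (\<lambda>i. f i x) is))"
proof (rule fsum_homI)
  fix x assume "x \<in> X"
  then show "concat (map (\<lambda>i. f i x) is) \<in> lists Y"
    using assms by (auto intro!: concat_map_in_lists simp: fsum_hom_def)
next
  fix xs ys assume xy: "(xs, ys) \<in> G" "xs \<in> lists X" "ys \<in> lists X"
  have mem: "f i x \<in> lists Y" if "i \<in> set is" "x \<in> X" for i x
    using assms that by (auto simp: fsum_hom_def)
  have swap: "fsum_eq Y G' (concat (map (\<lambda>x. concat (map (\<lambda>i. f i x) is)) us))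
          (concat (map (\<lambda>i. concat (map (\<lambda>x. f i x) us)) is))" if "us \<in> lists X" for us
    using mem that by (intro fsum_eq_concat_swap) auto
  have "fsum_eq Y G' (concat (map (\<lambda>i. concat (map (\<lambda>x. f i x) xs)) is))
      (concat (map (\<lambda>i. concat (map (\<lambda>x. f i x) ys)) is))"
    using assms xy by (intro fsum_eq_concat_cong) (auto simp: fsum_hom_def)
  then show "fsum_eq Y G' (concat (map (\<lambda>x. concat (map (\<lambda>i. f i x) is)) xs))
          (concat (map (\<lambda>x. concat (map (\<lambda>i. f i x) is)) ys))"
    by (rule fsum_eq.trans[OF swap[OF xy(2)] fsum_eq.trans[OF _ fsum_eq.sym[OF swap[OF xy(3)]]]])
qed

text \<open>The second argument is changed first, term by term; then the first, with the second
  fixed. This is what makes products of classes in a tensor square well defined.\<close>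

lemma fsum_eq_biadditive:
  assumes l: "\<And>y. y \<in> X' \<Longrightarrow> fsum_hom X G Y G'' (\<lambda>x. f x y)"
    and r: "\<And>x. x \<in> X \<Longrightarrow> fsum_hom X' G' Y G'' (f x)"
    and eq: "fsum_eq X G xs us" "fsum_eq X' G' ys vs"
  shows "fsum_eq Y G'' (concat (map (\<lambda>x. concat (map (f x) ys)) xs))
           (concat (map (\<lambda>x. concat (map (f x) vs)) us))"
proof -
  have mem: "xs \<in> lists X" "us \<in> lists X" "ys \<in> lists X'" "vs \<in> lists X'"
    using fsum_eq_lists[OF eq(1)] fsum_eq_lists[OF eq(2)] by auto
  have "fsum_hom X G Y G'' (\<lambda>x. concat (map (f x) vs))"
    using mem l by (intro fsum_hom_sum) auto
  then have "fsum_eq Y G'' (concat (map (\<lambda>x. concat (map (f x) vs)) xs))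
           (concat (map (\<lambda>x. concat (map (f x) vs)) us))"
    using eq(1) by (rule fsum_hom_eq)
  moreover have "fsum_eq Y G'' (concat (map (\<lambda>x. concat (map (f x) ys)) xs))
      (concat (map (\<lambda>x. concat (map (f x) vs)) xs))"
    using mem r eq(2) by (intro fsum_eq_concat_cong fsum_hom_eq) auto
  ultimately show ?thesis
    by (rule fsum_eq.trans[rotated])
qed

lemma map_pair_cong:
  "(\<And>a b. (a, b) \<in> set xs \<Longrightarrow> f a b = g a b) \<Longrightarrow> map (\<lambda>(a, b). f a b) xs = map (\<lambda>(a, b). g a b) xs"
  by auto

lemma fsum_eq_concat_pair_cong:
  "(\<And>a b. (a, b) \<in> set xs \<Longrightarrow> fsum_eq Y G (f a b) (g a b)) \<Longrightarrow>
   fsum_eq Y G (concat (map (\<lambda>(a, b). f a b) xs)) (concat (map (\<lambda>(a, b). g a b) xs))"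
  by (rule fsum_eq_concat_cong) auto

lemma fsum_hom_map_pair:
  assumes "fsum_hom X G Y G' (\<lambda>(a, b). [f a b])" "fsum_eq X G xs ys"
  shows "fsum_eq Y G' (map (\<lambda>(a, b). f a b) xs) (map (\<lambda>(a, b). f a b) ys)"
  by (rule fsum_hom_map[OF _ assms(2)]) (use assms(1) in \<open>simp add: case_prod_unfold\<close>)

lemma concat_map_pair_singleton: "concat (map (\<lambda>(a, b). [f a b]) xs) = map (\<lambda>(a, b). f a b) xs"
  by (induction xs) auto

lemma fsum_eq_mono:
  assumes "fsum_eq X G xs ys" "G \<subseteq> G'"
  shows "fsum_eq X G' xs ys"
  using assms(1)
proof (induction rule: fsum_eq.induct)
  case (gen xs ys)
  then show ?case using assms(2) by (intro fsum_eq.gen) auto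
next
  case (trans xs ys zs)
  show ?case using trans.IH by (rule fsum_eq.trans)
next
  case (sym xs ys)
  show ?case using sym.IH by (rule fsum_eq.sym)
next
  case (append xs ys us vs)
  show ?case using append.IH by (rule fsum_eq.append)
qed (simp_all only: fsum_eq.refl fsum_eq.comm)

lemma fsum_eq_commute: "fsum_eq X G xs ys \<longleftrightarrow> fsum_eq X G ys xs"
  by (rule iffI; rule fsum_eq.sym)

lemma fsum_hom_mono: "fsum_hom X G Y G' f \<Longrightarrow> G' \<subseteq> G'' \<Longrightarrow> fsum_hom X G Y G'' f"
  unfolding fsum_hom_def using fsum_eq_mono[of Y G' _ _ G''] by simp

lemma fsum_eq_swap_pair:
  assumes "\<And>a b c d. (a, b) \<in> set xs \<Longrightarrow> (c, d) \<in> set ys \<Longrightarrow> f a b c d \<in> Y"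
  shows "fsum_eq Y G (concat (map (\<lambda>(a, b). map (\<lambda>(c, d). f a b c d) ys) xs))
    (concat (map (\<lambda>(c, d). map (\<lambda>(a, b). f a b c d) xs) ys))"
  using fsum_eq_concat_swap[of xs ys "\<lambda>x y. [f (fst x) (snd x) (fst y) (snd y)]" Y G] assms
  by (auto simp: case_prod_unfold concat_map_singleton)

lemma lists_pair_mem: "xs \<in> lists (A \<times> B) \<Longrightarrow> (a, b) \<in> set xs \<Longrightarrow> a \<in> A \<and> b \<in> B"
  by auto

lemma fsum_eq_map_pair_concat:
  assumes "\<And>a b. (a, b) \<in> set xs \<Longrightarrow> fsum_eq Y G [f a b] (g a b)"
  shows "fsum_eq Y G (map (\<lambda>(a, b). f a b) xs) (concat (map (\<lambda>(a, b). g a b) xs))"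
  using fsum_eq_concat_pair_cong[of xs Y G "\<lambda>a b. [f a b]" g, OF assms]
  by (simp only: concat_map_pair_singleton)

lemma fsum_eq_map_pair:
  assumes "\<And>a b. (a, b) \<in> set xs \<Longrightarrow> fsum_eq Y G [f a b] [g a b]"
  shows "fsum_eq Y G (map (\<lambda>(a, b). f a b) xs) (map (\<lambda>(a, b). g a b) xs)"
  using fsum_eq_concat_pair_cong[of xs Y G "\<lambda>a b. [f a b]" "\<lambda>a b. [g a b]", OF assms]
  by (simp only: concat_map_pair_singleton)

lemma fsum_eq_map_pair_Nil:
  assumes "\<And>a b. (a, b) \<in> set xs \<Longrightarrow> fsum_eq Y G [f a b] []"
  shows "fsum_eq Y G (map (\<lambda>(a, b). f a b) xs) []"
  using assms
proof (induction xs)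
  case (Cons x xs)
  have "fsum_eq Y G [case x of (a, b) \<Rightarrow> f a b] []"
    by (cases x) (simp add: Cons.prems)
  moreover have "fsum_eq Y G (map (\<lambda>(a, b). f a b) xs) []"
    by (rule Cons.IH) (simp add: Cons.prems)
  ultimately have "fsum_eq Y G ([case x of (a, b) \<Rightarrow> f a b] @ map (\<lambda>(a, b). f a b) xs) ([] @ [])"
    by (rule fsum_eq.append)
  then show ?case by simp
qed (simp add: fsum_eq.refl)

lemma fsum_eq_map_pair_append:
  assumes "\<And>a b. (a, b) \<in> set xs \<Longrightarrow> fsum_eq Y G [f a b] [g a b, h a b]"
  shows "fsum_eq Y G (map (\<lambda>(a, b). f a b) xs) (map (\<lambda>(a, b). g a b) xs @ map (\<lambda>(a, b). h a b) xs)"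
proof -
  have "fsum_eq Y G (map (\<lambda>(a, b). f a b) xs) (concat (map (\<lambda>(a, b). [g a b, h a b]) xs))"
    using assms by (rule fsum_eq_map_pair_concat)
  also have "fsum_eq Y G \<dots> (map (\<lambda>(a, b). g a b) xs @ map (\<lambda>(a, b). h a b) xs)"
  proof (rule fsum_eq_mset)
    show "mset (concat (map (\<lambda>(a, b). [g a b, h a b]) xs)) =
        mset (map (\<lambda>(a, b). g a b) xs @ map (\<lambda>(a, b). h a b) xs)"
      by (induction xs) auto
    show "concat (map (\<lambda>(a, b). [g a b, h a b]) xs) \<in> lists Y"
      using fsum_eq_lists[OF assms] by (intro concat_map_in_lists) auto
  qed
  finally show ?thesis .
qed


section \<open>Sums over lists and linear maps\<close>

lemma lsum_cong_ring: "add A = add B \<Longrightarrow> zero A = zero B \<Longrightarrow> lsum A xs = lsum B xs"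
  by (simp add: lsum_def)

lemma lsum_simps [simp]:
  "lsum A [] = \<zero>\<^bsub>A\<^esub>" "lsum A (x # xs) = x \<oplus>\<^bsub>A\<^esub> lsum A xs"
  by (simp_all add: lsum_def)

context abelian_monoid
begin

lemma lsum_closed [simp]: "set xs \<subseteq> carrier G \<Longrightarrow> lsum G xs \<in> carrier G"
  by (induction xs) auto

lemma lsum_append:
  "set xs \<subseteq> carrier G \<Longrightarrow> set ys \<subseteq> carrier G \<Longrightarrow> lsum G (xs @ ys) = lsum G xs \<oplus> lsum G ys"
  by (induction xs) (auto simp: a_assoc)

lemma lsum_concat:
  "(\<And>x. x \<in> set xs \<Longrightarrow> set (f x) \<subseteq> carrier G) \<Longrightarrow>
   lsum G (concat (map f xs)) = lsum G (map (\<lambda>x. lsum G (f x)) xs)"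
proof (induction xs)
  case (Cons x xs)
  then have "set (concat (map f xs)) \<subseteq> carrier G"
    by auto
  then show ?case using Cons by (simp add: lsum_append)
qed auto

lemma lsum_finsum:
  "f \<in> set xs \<rightarrow> carrier G \<Longrightarrow> distinct xs \<Longrightarrow> lsum G (map f xs) = finsum G f (set xs)"
  by (induction xs) auto

text \<open>Rearranging and concatenating are harmless in an abelian monoid, so only the generating
  relations have to be checked when a formal sum is evaluated there.\<close>

lemma lsum_fsum_eq:
  assumes "fsum_eq X R xs ys" "\<And>x. x \<in> X \<Longrightarrow> f x \<in> carrier G"
    and "\<And>us vs. (us, vs) \<in> R \<Longrightarrow> us \<in> lists X \<Longrightarrow> vs \<in> lists X \<Longrightarrow>
      lsum G (map f us) = lsum G (map f vs)"
  shows "lsum G (map f xs) = lsum G (map f ys)"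
  using assms(1)
proof (induction rule: fsum_eq.induct)
  case (append xs ys us vs)
  have "xs \<in> lists X" "ys \<in> lists X" "us \<in> lists X" "vs \<in> lists X"
    using fsum_eq_lists[OF append(1)] fsum_eq_lists[OF append(2)] by auto
  then have "set (map f xs) \<subseteq> carrier G" "set (map f ys) \<subseteq> carrier G"
    "set (map f us) \<subseteq> carrier G" "set (map f vs) \<subseteq> carrier G"
    using assms(2) by auto
  then show ?case by (simp only: map_append lsum_append append.IH)
next
  case (comm xs ys)
  then have "set (map f xs) \<subseteq> carrier G" "set (map f ys) \<subseteq> carrier G"
    using assms(2) by auto
  then show ?case by (simp only: map_append lsum_append lsum_closed a_comm)
qed (use assms(3) in auto)

end

lemma module_hom_zero:
  assumes "module K M" "module K N" "f \<in> module_hom K M N"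
  shows "f \<zero>\<^bsub>M\<^esub> = \<zero>\<^bsub>N\<^esub>"
  using assms by (intro mod_hom.f0_is_0) (auto simp: mod_hom_def mod_hom_axioms_def)

lemma module_hom_lsum:
  assumes "module K M" "module K N" "f \<in> module_hom K M N" "set xs \<subseteq> carrier M"
  shows "f (lsum M xs) = lsum N (map f xs)"
proof -
  interpret M: module K M by fact
  show ?thesis using assms(4)
    by (induction xs) (auto simp: module_hom_zero[OF assms(1-3)] module_hom_add[OF assms(3)])
qed

lemma module_homI:
  assumes "\<And>x. x \<in> carrier M \<Longrightarrow> f x \<in> carrier N"
    and "\<And>x y. x \<in> carrier M \<Longrightarrow> y \<in> carrier M \<Longrightarrow> f (x \<oplus>\<^bsub>M\<^esub> y) = f x \<oplus>\<^bsub>N\<^esub> f y"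
    and "\<And>c x. c \<in> carrier K \<Longrightarrow> x \<in> carrier M \<Longrightarrow> f (c \<odot>\<^bsub>M\<^esub> x) = c \<odot>\<^bsub>N\<^esub> f x"
  shows "f \<in> module_hom K M N"
  using assms by (auto simp: module_hom_def)

lemma module_hom_carrier: "f \<in> module_hom K M N \<Longrightarrow> x \<in> carrier M \<Longrightarrow> f x \<in> carrier N"
  using module_hom_closed by blast

lemma module_hom_comp:
  "f \<in> module_hom K M N \<Longrightarrow> g \<in> module_hom K N P \<Longrightarrow> (\<lambda>x. g (f x)) \<in> module_hom K M P"
  by (auto simp: module_hom_def Pi_def)

lemma module_hom_id: "(\<lambda>x. x) \<in> module_hom K M M"
  by (auto simp: module_hom_def)

lemma module_hom_lsum_map:
  assumes "module K M" "module K N" "\<And>i. i \<in> set is \<Longrightarrow> g i \<in> module_hom K M N"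
  shows "(\<lambda>m. lsum N (map (\<lambda>i. g i m) is)) \<in> module_hom K M N"
proof -
  interpret N: module K N by fact
  interpret M: module K M by fact
  show ?thesis using assms(3)
  proof (induction "is")
    case Nil
    then show ?case by (intro module_homI) auto
  next
    case (Cons i "is")
    then have g: "g i \<in> module_hom K M N" and h: "(\<lambda>m. lsum N (map (\<lambda>i. g i m) is)) \<in> module_hom K M N"
      by auto
    note mem = module_hom_carrier[OF g] module_hom_carrier[OF h]
    show ?case
      by (rule module_homI) (auto simp: mem module_hom_add[OF g] module_hom_add[OF h]
          module_hom_smult[OF g] module_hom_smult[OF h] N.a_ac N.smult_r_distr)
  qed
qed

lemma base_module_simps [simp]:
  "carrier (base_module K) = carrier K" "zero (base_module K) = zero K"
  "one (base_module K) = one K" "add (base_module K) = add K" "mult (base_module K) = mult K"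
  "smult (base_module K) = mult K"
  by (simp_all add: base_module_def)

lemma lsum_base_module [simp]: "lsum (base_module K) xs = lsum K xs"
  by (intro lsum_cong_ring) simp_all

lemma module_base_module:
  assumes "field K"
  shows "module K (base_module K)"
proof -
  interpret field K by fact
  have "abelian_group (base_module K)"
    by (rule abelian_groupI) (auto simp: a_ac intro: bexI[of _ "\<ominus>\<^bsub>K\<^esub> _"] l_neg)
  then show ?thesis
    by (intro moduleI) (auto simp: m_assoc l_distr r_distr intro: is_cring)
qed


section \<open>Tensor products\<close>

lemma tensor_rels_mono:
  assumes "carrier M = carrier M'" "add M = add M'" "zero M = zero M'" "smult M = smult M'"
    and "carrier N = carrier N'" "add N = add N'" "zero N = zero N'" "smult N = smult N'"
  shows "tensor_rels K M N \<subseteq> tensor_rels K M' N'"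
proof safe
  fix xs ys assume "(xs, ys) \<in> tensor_rels K M N"
  then show "(xs, ys) \<in> tensor_rels K M' N'"
    by induction (unfold assms, (rule tensor_rels.intros; assumption)+)
qed

text \<open>Tensor products see only the linear structure. Hence the relations are literally the
  same for a bialgebra over the base and its weak bialgebra, and for the dual and its
  opposite.\<close>

lemma tensor_rels_cong:
  assumes "carrier M = carrier M'" "add M = add M'" "zero M = zero M'" "smult M = smult M'"
    and "carrier N = carrier N'" "add N = add N'" "zero N = zero N'" "smult N = smult N'"
  shows "tensor_rels K M N = tensor_rels K M' N'"
  by (intro equalityI tensor_rels_mono) (simp_all add: assms)

lemma tensor_hom:
  assumes "module K M" "module K N" "module K M'" "module K N'"
    and u: "u \<in> module_hom K M M'" and v: "v \<in> module_hom K N N'"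
  shows "fsum_hom (carrier M \<times> carrier N) (tensor_rels K M N)
    (carrier M' \<times> carrier N') (tensor_rels K M' N') (\<lambda>(m, n). [(u m, v n)])"
proof (rule fsum_homI)
  fix x assume "x \<in> carrier M \<times> carrier N"
  then show "(\<lambda>(m, n). [(u m, v n)]) x \<in> lists (carrier M' \<times> carrier N')"
    using module_hom_carrier[OF u] module_hom_carrier[OF v] by auto
next
  note mem = module_hom_carrier[OF u] module_hom_carrier[OF v]
  note hom = module_hom_zero[OF assms(1,3) u] module_hom_zero[OF assms(2,4) v]
    module_hom_add[OF u] module_hom_add[OF v] module_hom_smult[OF u] module_hom_smult[OF v]
  fix xs ys assume *: "(xs, ys) \<in> tensor_rels K M N" "xs \<in> lists (carrier M \<times> carrier N)" "ys \<in> lists (carrier M \<times> carrier N)"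
  have "(concat (map (\<lambda>(m, n). [(u m, v n)]) xs), concat (map (\<lambda>(m, n). [(u m, v n)]) ys))
    \<in> tensor_rels K M' N'"
    using *(1) by cases (auto simp: hom mem intro: tensor_rels.intros)
  moreover have "concat (map (\<lambda>(m, n). [(u m, v n)]) zs) \<in> lists (carrier M' \<times> carrier N')"
    if "zs \<in> lists (carrier M \<times> carrier N)" for zs
    using that by (intro concat_map_in_lists) (auto simp: mem)
  ultimately show "fsum_eq (carrier M' \<times> carrier N') (tensor_rels K M' N')
     (concat (map (\<lambda>(m, n). [(u m, v n)]) xs)) (concat (map (\<lambda>(m, n). [(u m, v n)]) ys))"
    using * by (intro fsum_eq.gen) auto
qed

lemma bilinear_mapD:
  assumes "bilinear_map K M N P f"
  shows "m \<in> carrier M \<Longrightarrow> f m \<in> module_hom K N P" "n \<in> carrier N \<Longrightarrow> (\<lambda>m. f m n) \<in> module_hom K M P"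
    "m \<in> carrier M \<Longrightarrow> n \<in> carrier N \<Longrightarrow> f m n \<in> carrier P"
proof -
  show *: "m \<in> carrier M \<Longrightarrow> f m \<in> module_hom K N P"
    "n \<in> carrier N \<Longrightarrow> (\<lambda>m. f m n) \<in> module_hom K M P"
    using assms by (simp_all add: bilinear_map_def)
  show "m \<in> carrier M \<Longrightarrow> n \<in> carrier N \<Longrightarrow> f m n \<in> carrier P"
    using *(1) by (rule module_hom_carrier)
qed

text \<open>The universal property of the tensor product; it is why Sweedler sums with a bilinear
  summand do not depend on the chosen representative.\<close>

lemma tensor_lsum:
  assumes "module K M" "module K N" "module K P" and f: "bilinear_map K M N P f"
    and eq: "fsum_eq (carrier M \<times> carrier N) (tensor_rels K M N) xs ys"
  shows "lsum P (map (\<lambda>(m, n). f m n) xs) = lsum P (map (\<lambda>(m, n). f m n) ys)"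
proof -
  interpret P: module K P by fact
  note f1 = bilinear_mapD(1)[OF f] and f2 = bilinear_mapD(2)[OF f] and f3 = bilinear_mapD(3)[OF f]
  show ?thesis
  proof (rule P.lsum_fsum_eq[OF eq])
    fix x assume "x \<in> carrier M \<times> carrier N"
    then show "(\<lambda>(m, n). f m n) x \<in> carrier P" by (auto simp: f3)
  next
    fix us vs assume "(us, vs) \<in> tensor_rels K M N"
    then show "lsum P (map (\<lambda>(m, n). f m n) us) = lsum P (map (\<lambda>(m, n). f m n) vs)"
      by cases (auto simp: f3 module_hom_zero[OF assms(1,3) f2] module_hom_zero[OF assms(2,3) f1]
        module_hom_add[OF f1] module_hom_add[OF f2] module_hom_smult[OF f1] module_hom_smult[OF f2])
  qed
qed

lemma tensor_lsum_left:
  assumes "module K M" "module K N" "n \<in> carrier N" "\<And>x. x \<in> set xs \<Longrightarrow> f x \<in> carrier M"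
  shows "fsum_eq (carrier M \<times> carrier N) (tensor_rels K M N) [(lsum M (map f xs), n)] (map (\<lambda>x. (f x, n)) xs)"
proof -
  interpret M: module K M by fact
  show ?thesis using assms(4)
  proof (induction xs)
    case Nil
    then show ?case using assms(3) by (auto intro!: fsum_eq.gen tensor_rels.zero_left)
  next
    case (Cons x xs)
    let ?E = "fsum_eq (carrier M \<times> carrier N) (tensor_rels K M N)"
    have s: "lsum M (map f xs) \<in> carrier M"
      using Cons.prems by (intro M.lsum_closed) auto
    have "?E [(f x \<oplus>\<^bsub>M\<^esub> lsum M (map f xs), n)] [(f x, n), (lsum M (map f xs), n)]"
      using Cons.prems assms(3) s by (intro fsum_eq.gen tensor_rels.add_left) auto
    moreover have "?E ([(f x, n)] @ [(lsum M (map f xs), n)]) ([(f x, n)] @ map (\<lambda>x. (f x, n)) xs)"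
      using Cons assms(3) by (intro fsum_eq.append fsum_eq.refl) auto
    ultimately show ?case
      unfolding lsum_simps list.map append.simps by (rule fsum_eq.trans)
  qed
qed

lemma tensor_lsum_right:
  assumes "module K M" "module K N" "m \<in> carrier M" "\<And>x. x \<in> set xs \<Longrightarrow> f x \<in> carrier N"
  shows "fsum_eq (carrier M \<times> carrier N) (tensor_rels K M N) [(m, lsum N (map f xs))] (map (\<lambda>x. (m, f x)) xs)"
proof -
  interpret N: module K N by fact
  show ?thesis using assms(4)
  proof (induction xs)
    case Nil
    then show ?case using assms(3) by (auto intro!: fsum_eq.gen tensor_rels.zero_right)
  next
    case (Cons x xs)
    let ?E = "fsum_eq (carrier M \<times> carrier N) (tensor_rels K M N)"
    have s: "lsum N (map f xs) \<in> carrier N"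
      using Cons.prems by (intro N.lsum_closed) auto
    have "?E [(m, f x \<oplus>\<^bsub>N\<^esub> lsum N (map f xs))] [(m, f x), (m, lsum N (map f xs))]"
      using Cons.prems assms(3) s by (intro fsum_eq.gen tensor_rels.add_right) auto
    moreover have "?E ([(m, f x)] @ [(m, lsum N (map f xs))]) ([(m, f x)] @ map (\<lambda>x. (m, f x)) xs)"
      using Cons assms(3) by (intro fsum_eq.append fsum_eq.refl) auto
    ultimately show ?case
      unfolding lsum_simps list.map append.simps by (rule fsum_eq.trans)
  qed
qed


section \<open>Algebras and Frobenius systems\<close>

lemma k_algebraD:
  assumes "k_algebra K A"
  shows "module K A" "ring A" "field K"
  using assms by (auto simp: k_algebra_def vectorspace_def)

lemma module_cong:
  assumes "module K M" "carrier M = carrier M'" "add M = add M'" "zero M = zero M'" "smult M = smult M'"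
  shows "module K M'"
proof -
  interpret module K M by fact
  show ?thesis
  proof (rule moduleI)
    show "abelian_group M'"
      by (rule abelian_groupI)
        (auto simp: a_ac simp flip: assms(2-) intro: bexI[of _ "\<ominus>\<^bsub>M\<^esub> _"] M.l_neg)
  qed (auto simp: smult_l_distr smult_r_distr smult_assoc1 is_cring simp flip: assms(2-))
qed

lemma ring_cong:
  assumes "ring M" "carrier M = carrier M'" "add M = add M'" "zero M = zero M'"
    "mult M = mult M'" "one M = one M'"
  shows "ring M'"
proof -
  interpret ring M by fact
  show ?thesis
  proof (rule ringI)
    show "abelian_group M'"
      by (rule abelian_groupI)
        (auto simp: a_ac simp flip: assms(2-) intro: bexI[of _ "\<ominus>\<^bsub>M\<^esub> _"] l_neg)
    show "monoid M'"
      by (rule monoidI) (auto simp: m_assoc simp flip: assms(2-))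
  qed (auto simp: l_distr r_distr simp flip: assms(2-))
qed

lemma k_algebra_mult_right:
  assumes "k_algebra K A" "y \<in> carrier A"
  shows "(\<lambda>x. x \<otimes>\<^bsub>A\<^esub> y) \<in> module_hom K A A"
proof -
  interpret ring A using assms(1) by (rule k_algebraD)
  show ?thesis
    using assms by (intro module_homI) (auto simp: l_distr k_algebra_def)
qed

lemma k_algebra_mult_left:
  assumes "k_algebra K A" "y \<in> carrier A"
  shows "(\<lambda>x. y \<otimes>\<^bsub>A\<^esub> x) \<in> module_hom K A A"
proof -
  interpret ring A using assms(1) by (rule k_algebraD)
  show ?thesis
    using assms by (intro module_homI) (auto simp: r_distr k_algebra_def)
qed

lemma smult_hom:
  assumes "module K M" "c \<in> carrier K"
  shows "(\<lambda>x. c \<odot>\<^bsub>M\<^esub> x) \<in> module_hom K M M"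
proof -
  interpret module K M by fact
  show ?thesis
    using assms(2) by (intro module_homI) (auto simp: smult_r_distr smult_assoc1[symmetric] m_comm)
qed

lemma smult_left_hom:
  assumes "field K" "module K M" "x \<in> carrier M"
  shows "(\<lambda>c. c \<odot>\<^bsub>M\<^esub> x) \<in> module_hom K (base_module K) M"
proof -
  interpret module K M by fact
  show ?thesis
    using assms(3) by (intro module_homI) (auto simp: smult_l_distr smult_assoc1)
qed

text \<open>The scalar Sweedler expressions below have this shape, including products of two linear
  forms, for which \<open>P\<close> is \<open>base_module K\<close>.\<close>

lemma bilinear_smult:
  assumes "field K" "module K N" "module K P" "f \<in> module_hom K M (base_module K)" "g \<in> module_hom K N P"
  shows "bilinear_map K M N P (\<lambda>x y. f x \<odot>\<^bsub>P\<^esub> g y)"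
  unfolding bilinear_map_def
proof safe
  fix m assume "m \<in> carrier M"
  then have "f m \<in> carrier K" using module_hom_carrier[OF assms(4)] by simp
  from module_hom_comp[OF assms(5) smult_hom[OF assms(3) this]]
  show "(\<lambda>y. f m \<odot>\<^bsub>P\<^esub> g y) \<in> module_hom K N P" .
next
  fix n assume "n \<in> carrier N"
  then have "g n \<in> carrier P" using module_hom_carrier[OF assms(5)] by simp
  from module_hom_comp[OF assms(4) smult_left_hom[OF assms(1,3) this]]
  show "(\<lambda>x. f x \<odot>\<^bsub>P\<^esub> g n) \<in> module_hom K M P" .
qed

lemma bilinear_map_flip: "bilinear_map K M N P f \<Longrightarrow> bilinear_map K N M P (\<lambda>x y. f y x)"
  by (auto simp: bilinear_map_def)

locale frobenius_base =
  fixes K :: "('k, 'x) ring_scheme" and R :: "('k, 'r, 'm) module_scheme"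
    and \<phi> :: "'r \<Rightarrow> 'k" and e :: "('r \<times> 'r) list set"
  assumes field: "field K" and alg: "k_algebra K R"
    and frob: "idempotent_frobenius_system K R \<phi> e"
begin

abbreviation mulR (infixl "\<star>" 70) where "x \<star> y \<equiv> x \<otimes>\<^bsub>R\<^esub> y"

interpretation R: ring R using alg by (rule k_algebraD)
interpretation RM: module K R using alg by (rule k_algebraD)

lemma phi_hom: "\<phi> \<in> module_hom K R (base_module K)"
  using frob by (simp add: idempotent_frobenius_system_def frobenius_system_def)

lemma phi_carrier [simp]: "r \<in> carrier R \<Longrightarrow> \<phi> r \<in> carrier K"
  using module_hom_carrier[OF phi_hom] by simp

lemma E_lists: "rep e \<in> lists (carrier R \<times> carrier R)"
  using frob by (auto simp: idempotent_frobenius_system_def frobenius_system_def tensor_def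
      dest: rep_in_lists)

lemma E_mem: "(a, b) \<in> set (rep e) \<Longrightarrow> a \<in> carrier R \<and> b \<in> carrier R"
  using E_lists by auto

lemma E_idem: "lsum R (map (\<lambda>(a, b). a \<star> b) (rep e)) = \<one>\<^bsub>R\<^esub>"
  using frob by (simp add: idempotent_frobenius_system_def)

text \<open>The Frobenius identity with a linear map applied to it. Whenever \<open>\<phi>\<close>
  contains some \<open>x\<close> times the first leg of \<open>e\<close>, and the second leg occurs
  linearly elsewhere, the sum over \<open>e\<close> collapses; the next lemma is the mirror
  image.\<close>

lemma frob_lsum_left:
  assumes "module K P" "g \<in> module_hom K R P" "x \<in> carrier R"
  shows "lsum P (map (\<lambda>(a, b). \<phi> (x \<star> a) \<odot>\<^bsub>P\<^esub> g b) (rep e)) = g x"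
proof -
  have "x = lsum R (map (\<lambda>(a, b). \<phi> (x \<star> a) \<odot>\<^bsub>R\<^esub> b) (rep e))" (is "_ = lsum R ?l")
    using frob assms(3) by (simp add: idempotent_frobenius_system_def frobenius_system_def)
  then have "g x = g (lsum R ?l)" by (rule arg_cong)
  also have "\<dots> = lsum P (map g ?l)"
    using assms E_mem by (intro module_hom_lsum[OF RM.module_axioms]) auto
  also have "map g ?l = map (\<lambda>(a, b). \<phi> (x \<star> a) \<odot>\<^bsub>P\<^esub> g b) (rep e)"
    using assms(3) by (auto simp: module_hom_smult[OF assms(2)] dest: E_mem)
  finally show ?thesis ..
qed

lemma frob_lsum_right:
  assumes "module K P" "g \<in> module_hom K R P" "x \<in> carrier R"
  shows "lsum P (map (\<lambda>(a, b). \<phi> (b \<star> x) \<odot>\<^bsub>P\<^esub> g a) (rep e)) = g x"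
proof -
  have "x = lsum R (map (\<lambda>(a, b). \<phi> (b \<star> x) \<odot>\<^bsub>R\<^esub> a) (rep e))" (is "_ = lsum R ?l")
    using frob assms(3) by (simp add: idempotent_frobenius_system_def frobenius_system_def)
  then have "g x = g (lsum R ?l)" by (rule arg_cong)
  also have "\<dots> = lsum P (map g ?l)"
    using assms E_mem by (intro module_hom_lsum[OF RM.module_axioms]) auto
  also have "map g ?l = map (\<lambda>(a, b). \<phi> (b \<star> x) \<odot>\<^bsub>P\<^esub> g a) (rep e)"
    using assms(3) by (auto simp: module_hom_smult[OF assms(2)] dest: E_mem)
  finally show ?thesis ..
qed

text \<open>Write \<open>r \<star> a'\<close> as the sum of
  \<open>\<phi> (b \<star> (r \<star> a'))\<close> times \<open>a\<close> over a second copy of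
  \<open>e\<close>, let the scalar cross the tensor sign, and sum over the first copy: the right
  factor becomes \<open>b \<star> r\<close>. Each of the two Frobenius identities is used
  once.\<close>

lemma casimir:
  assumes r: "r \<in> carrier R"
  shows "fsum_eq (carrier R \<times> carrier R) (tensor_rels K R R)
    (map (\<lambda>(a, b). (r \<star> a, b)) (rep e)) (map (\<lambda>(a, b). (a, b \<star> r)) (rep e))"
proof -
  let ?E = "fsum_eq (carrier R \<times> carrier R) (tensor_rels K R R)"
  let ?c = "\<lambda>b a'. \<phi> (b \<star> (r \<star> a'))"
  have "?E (concat (map (\<lambda>(a', b'). [(r \<star> a', b')]) (rep e)))
      (concat (map (\<lambda>(a', b'). map (\<lambda>(a, b). (a, ?c b a' \<odot>\<^bsub>R\<^esub> b')) (rep e)) (rep e)))"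
  proof (rule fsum_eq_concat_pair_cong)
    fix a' b' assume "(a', b') \<in> set (rep e)"
    then have ab: "a' \<in> carrier R" "b' \<in> carrier R" by (auto dest: E_mem)
    have *: "lsum R (map (\<lambda>(a, b). ?c b a' \<odot>\<^bsub>R\<^esub> a) (rep e)) = r \<star> a'"
      by (rule frob_lsum_right[OF RM.module_axioms module_hom_id R.m_closed[OF r ab(1)]])
    have "?E [(lsum R (map (\<lambda>(a, b). ?c b a' \<odot>\<^bsub>R\<^esub> a) (rep e)), b')]
        (map (\<lambda>x. ((\<lambda>(a, b). ?c b a' \<odot>\<^bsub>R\<^esub> a) x, b')) (rep e))"
      using r ab(1) by (intro tensor_lsum_left RM.module_axioms ab(2)) (auto dest!: E_mem)
    also have "\<dots> = concat (map (\<lambda>(a, b). [(?c b a' \<odot>\<^bsub>R\<^esub> a, b')]) (rep e))"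
      by (simp add: concat_map_pair_singleton case_prod_unfold)
    also have "?E \<dots> (concat (map (\<lambda>(a, b). [(a, ?c b a' \<odot>\<^bsub>R\<^esub> b')]) (rep e)))"
      using r ab by (intro fsum_eq_concat_pair_cong fsum_eq.gen tensor_rels.scalar) (auto dest!: E_mem)
    finally show "?E [(r \<star> a', b')] (map (\<lambda>(a, b). (a, ?c b a' \<odot>\<^bsub>R\<^esub> b')) (rep e))"
      unfolding * concat_map_pair_singleton .
  qed
  \<comment> \<open>The roles of the two copies of \<open>e\<close> are exchanged: the primed one,
    with which the computation started, is now summed away.\<close>
  also have "?E \<dots> (concat (map (\<lambda>(a, b). map (\<lambda>(a', b'). (a, ?c b a' \<odot>\<^bsub>R\<^esub> b')) (rep e)) (rep e)))"
    using r by (intro fsum_eq_swap_pair) (auto dest!: E_mem)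
  also have "?E \<dots> (concat (map (\<lambda>(a, b). [(a, b \<star> r)]) (rep e)))"
  proof (rule fsum_eq_concat_pair_cong)
    fix a b assume "(a, b) \<in> set (rep e)"
    then have ab: "a \<in> carrier R" "b \<in> carrier R" by (auto dest: E_mem)
    have "lsum R (map (\<lambda>(a', b'). ?c b a' \<odot>\<^bsub>R\<^esub> b') (rep e)) =
        lsum R (map (\<lambda>(a', b'). \<phi> (b \<star> r \<star> a') \<odot>\<^bsub>R\<^esub> b') (rep e))"
      using r ab by (intro arg_cong[where f = "lsum R"] map_pair_cong) (auto simp: R.m_assoc dest!: E_mem)
    also have "\<dots> = b \<star> r"
      by (rule frob_lsum_left[OF RM.module_axioms module_hom_id R.m_closed[OF ab(2) r]])
    finally have *: "lsum R (map (\<lambda>(a', b'). ?c b a' \<odot>\<^bsub>R\<^esub> b') (rep e)) = b \<star> r" .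
    have "?E [(a, lsum R (map (\<lambda>(a', b'). ?c b a' \<odot>\<^bsub>R\<^esub> b') (rep e)))]
        (map (\<lambda>x. (a, (\<lambda>(a', b'). ?c b a' \<odot>\<^bsub>R\<^esub> b') x)) (rep e))"
      using r ab(2) by (intro tensor_lsum_right RM.module_axioms ab(1)) (auto dest!: E_mem)
    then show "?E (map (\<lambda>(a', b'). (a, ?c b a' \<odot>\<^bsub>R\<^esub> b')) (rep e)) [(a, b \<star> r)]"
      unfolding * by (subst fsum_eq_commute) (simp add: case_prod_unfold)
  qed
  finally show ?thesis by (simp add: concat_map_pair_singleton)
qed

end


section \<open>Threefold products\<close>

lemma triple_left_hom:
  assumes "c \<in> X"
  shows "fsum_hom (X \<times> X) G (X \<times> X \<times> X) (triple_rels X G) (\<lambda>(a, b). [(a, b, c)])"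
proof (rule fsum_homI)
  fix xs ys assume *: "(xs, ys) \<in> G" "xs \<in> lists (X \<times> X)" "ys \<in> lists (X \<times> X)"
  have "(map (\<lambda>(a, b). (a, b, c)) xs, map (\<lambda>(a, b). (a, b, c)) ys) \<in> triple_rels X G"
    unfolding triple_rels_def using *(1) assms by blast
  then show "fsum_eq (X \<times> X \<times> X) (triple_rels X G)
    (concat (map (\<lambda>(a, b). [(a, b, c)]) xs)) (concat (map (\<lambda>(a, b). [(a, b, c)]) ys))"
    unfolding concat_map_pair_singleton by (rule fsum_eq.gen) (use * assms in auto)
qed (use assms in auto)

lemma triple_right_hom:
  assumes "c \<in> X"
  shows "fsum_hom (X \<times> X) G (X \<times> X \<times> X) (triple_rels X G) (\<lambda>(a, b). [(c, a, b)])"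
proof (rule fsum_homI)
  fix xs ys assume *: "(xs, ys) \<in> G" "xs \<in> lists (X \<times> X)" "ys \<in> lists (X \<times> X)"
  have "(map (\<lambda>(a, b). (c, a, b)) xs, map (\<lambda>(a, b). (c, a, b)) ys) \<in> triple_rels X G"
    unfolding triple_rels_def using *(1) assms by blast
  then show "fsum_eq (X \<times> X \<times> X) (triple_rels X G)
    (concat (map (\<lambda>(a, b). [(c, a, b)]) xs)) (concat (map (\<lambda>(a, b). [(c, a, b)]) ys))"
    unfolding concat_map_pair_singleton by (rule fsum_eq.gen) (use * assms in auto)
qed (use assms in auto)

lemmas triple_left = fsum_hom_map_pair[OF triple_left_hom]
  and triple_right = fsum_hom_map_pair[OF triple_right_hom]

lemma triple_left_gen:
  assumes "(xs, ys) \<in> G" "xs \<in> lists (X \<times> X)" "ys \<in> lists (X \<times> X)" "c \<in> X"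
  shows "fsum_eq (X \<times> X \<times> X) (triple_rels X G) (map (\<lambda>(a, b). (a, b, c)) xs) (map (\<lambda>(a, b). (a, b, c)) ys)"
  by (rule triple_left[OF assms(4)]) (rule fsum_eq.gen[OF assms(1-3)])

lemma triple_right_gen:
  assumes "(xs, ys) \<in> G" "xs \<in> lists (X \<times> X)" "ys \<in> lists (X \<times> X)" "c \<in> X"
  shows "fsum_eq (X \<times> X \<times> X) (triple_rels X G) (map (\<lambda>(a, b). (c, a, b)) xs) (map (\<lambda>(a, b). (c, a, b)) ys)"
  by (rule triple_right[OF assms(4)]) (rule fsum_eq.gen[OF assms(1-3)])

lemma linear_intoD:
  assumes "linear_into K A G D"
  shows "x \<in> carrier A \<Longrightarrow> rep (D x) \<in> lists (carrier A \<times> carrier A)"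
    "x \<in> carrier A \<Longrightarrow> y \<in> carrier A \<Longrightarrow>
      fsum_eq (carrier A \<times> carrier A) G (rep (D (x \<oplus>\<^bsub>A\<^esub> y))) (rep (D x) @ rep (D y))"
    "module K A \<Longrightarrow> c \<in> carrier K \<Longrightarrow> x \<in> carrier A \<Longrightarrow>
      fsum_eq (carrier A \<times> carrier A) G (rep (D (c \<odot>\<^bsub>A\<^esub> x))) (map (\<lambda>(a, b). (c \<odot>\<^bsub>A\<^esub> a, b)) (rep (D x)))"
proof -
  show *: "x \<in> carrier A \<Longrightarrow> rep (D x) \<in> lists (carrier A \<times> carrier A)" for x
    using assms rep_in_lists unfolding linear_into_def by metis
  show "x \<in> carrier A \<Longrightarrow> y \<in> carrier A \<Longrightarrow>
      fsum_eq (carrier A \<times> carrier A) G (rep (D (x \<oplus>\<^bsub>A\<^esub> y))) (rep (D x) @ rep (D y))"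
    using assms * unfolding linear_into_def
    by (intro fsum_eq_rep_classD) (auto simp del: in_lists_conv_set)
  assume "module K A" "c \<in> carrier K" "x \<in> carrier A"
  then interpret module K A by simp
  show "fsum_eq (carrier A \<times> carrier A) G (rep (D (c \<odot>\<^bsub>A\<^esub> x))) (map (\<lambda>(a, b). (c \<odot>\<^bsub>A\<^esub> a, b)) (rep (D x)))"
  proof (rule fsum_eq_rep_classD)
    show "D (c \<odot>\<^bsub>A\<^esub> x) = fsum_class (carrier A \<times> carrier A) G (map (\<lambda>(a, b). (c \<odot>\<^bsub>A\<^esub> a, b)) (rep (D x)))"
      using assms \<open>c \<in> carrier K\<close> \<open>x \<in> carrier A\<close> by (simp add: linear_into_def)
    have "(a, b) \<in> set (rep (D x)) \<Longrightarrow> a \<in> carrier A \<and> b \<in> carrier A" for a b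
      using lists_pair_mem[OF *[OF \<open>x \<in> carrier A\<close>]] .
    then show "map (\<lambda>(a, b). (c \<odot>\<^bsub>A\<^esub> a, b)) (rep (D x)) \<in> lists (carrier A \<times> carrier A)"
      using \<open>c \<in> carrier K\<close> by auto
  qed
qed

text \<open>\<open>linear_into\<close> has clauses for sums and scalars only. So zero is written as
  zero times zero, which makes every left factor of its image zero.\<close>

lemma linear_into_zero:
  assumes "module K A" and G: "tensor_rels K A A \<subseteq> G" and D: "linear_into K A G D"
  shows "fsum_eq (carrier A \<times> carrier A) G (rep (D \<zero>\<^bsub>A\<^esub>)) []"
proof -
  interpret module K A by fact
  have "fsum_eq (carrier A \<times> carrier A) G (rep (D (\<zero>\<^bsub>K\<^esub> \<odot>\<^bsub>A\<^esub> \<zero>\<^bsub>A\<^esub>)))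
      (map (\<lambda>(a, b). (\<zero>\<^bsub>K\<^esub> \<odot>\<^bsub>A\<^esub> a, b)) (rep (D \<zero>\<^bsub>A\<^esub>)))"
    by (rule linear_intoD(3)[OF D]) (simp_all add: module_axioms)
  also have "fsum_eq (carrier A \<times> carrier A) G \<dots> []"
  proof (rule fsum_eq_map_pair_Nil)
    fix a b assume "(a, b) \<in> set (rep (D \<zero>\<^bsub>A\<^esub>))"
    then have "a \<in> carrier A" "b \<in> carrier A"
      using lists_pair_mem[OF linear_intoD(1)[OF D M.zero_closed]] by blast+
    then show "fsum_eq (carrier A \<times> carrier A) G [(\<zero>\<^bsub>K\<^esub> \<odot>\<^bsub>A\<^esub> a, b)] []"
      using G tensor_rels.zero_left[of b A A K] by (intro fsum_eq.gen) auto
  qed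
  finally show ?thesis by simp
qed

abbreviation comul_left :: "('a \<Rightarrow> ('a \<times> 'a) list set) \<Rightarrow> ('a \<times> 'a) list \<Rightarrow> ('a \<times> 'a \<times> 'a) list" where
  "comul_left D xs \<equiv> concat (map (\<lambda>(m, n). map (\<lambda>(a, b). (a, b, n)) (rep (D m))) xs)"

abbreviation comul_right :: "('a \<Rightarrow> ('a \<times> 'a) list set) \<Rightarrow> ('a \<times> 'a) list \<Rightarrow> ('a \<times> 'a \<times> 'a) list" where
  "comul_right D xs \<equiv> concat (map (\<lambda>(m, n). map (\<lambda>(a, b). (m, a, b)) (rep (D n))) xs)"

text \<open>This makes \<open>D \<otimes> id\<close> a map on the tensor square. A relation in the
  left factor is carried over by linearity of \<open>D\<close>; one in the right factor is applied
  to each term of the coproduct of the left factor.\<close>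

lemma comul_left_hom:
  assumes M: "module K A" and D: "linear_into K A (tensor_rels K A A) D"
  shows "fsum_hom (carrier A \<times> carrier A) (tensor_rels K A A)
    (carrier A \<times> carrier A \<times> carrier A) (triple_rels (carrier A) (tensor_rels K A A))
    (\<lambda>(m, n). map (\<lambda>(a, b). (a, b, n)) (rep (D m)))" (is "fsum_hom ?X ?T ?Y ?T3 ?f")
proof (rule fsum_homI)
  interpret module K A by fact
  have mem: "a \<in> carrier A \<and> b \<in> carrier A" if "(a, b) \<in> set (rep (D m))" "m \<in> carrier A" for m a b
    using lists_pair_mem[OF linear_intoD(1)[OF D that(2)] that(1)] .
  show "?f x \<in> lists ?Y" if "x \<in> ?X" for x
    using that by (auto dest!: mem)
  fix xs ys assume "(xs, ys) \<in> ?T"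
  then show "fsum_eq ?Y ?T3 (concat (map ?f xs)) (concat (map ?f ys))"
  proof cases
    case (add_left m m' n)
    from triple_left[OF add_left(5) linear_intoD(2)[OF D add_left(3,4)]]
    show ?thesis by (simp add: add_left(1,2))
  next
    case (add_right m n n')
    have "fsum_eq ?Y ?T3 (map (\<lambda>(a, b). (a, b, n \<oplus>\<^bsub>A\<^esub> n')) (rep (D m)))
       (map (\<lambda>(a, b). (a, b, n)) (rep (D m)) @ map (\<lambda>(a, b). (a, b, n')) (rep (D m)))"
    proof (rule fsum_eq_map_pair_append)
      fix a b assume "(a, b) \<in> set (rep (D m))"
      then show "fsum_eq ?Y ?T3 [(a, b, n \<oplus>\<^bsub>A\<^esub> n')] [(a, b, n), (a, b, n')]"
        using triple_right_gen[OF tensor_rels.add_right[of b A n A n' K], of "carrier A" a] add_right mem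
        by auto
    qed
    then show ?thesis by (simp add: add_right(1,2))
  next
    case (zero_left n)
    from triple_left[OF zero_left(3) linear_into_zero[OF M _ D]]
    show ?thesis by (simp add: zero_left(1,2))
  next
    case (zero_right m)
    have "fsum_eq ?Y ?T3 (map (\<lambda>(a, b). (a, b, \<zero>\<^bsub>A\<^esub>)) (rep (D m))) []"
    proof (rule fsum_eq_map_pair_Nil)
      fix a b assume "(a, b) \<in> set (rep (D m))"
      then show "fsum_eq ?Y ?T3 [(a, b, \<zero>\<^bsub>A\<^esub>)] []"
        using triple_right_gen[OF tensor_rels.zero_right[of b A A K], of "carrier A" a] zero_right mem
        by auto
    qed
    then show ?thesis by (simp add: zero_right(1,2))
  next
    case (scalar c m n)
    have "fsum_eq ?Y ?T3 (map (\<lambda>(a, b). (a, b, n)) (rep (D (c \<odot>\<^bsub>A\<^esub> m))))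
        (map (\<lambda>(a, b). (a, b, n)) (map (\<lambda>(a, b). (c \<odot>\<^bsub>A\<^esub> a, b)) (rep (D m))))"
      by (rule triple_left[OF scalar(5) linear_intoD(3)[OF D M scalar(3,4)]])
    also have "\<dots> = map (\<lambda>(a, b). (c \<odot>\<^bsub>A\<^esub> a, b, n)) (rep (D m))"
      by (simp add: case_prod_unfold)
    also have "fsum_eq ?Y ?T3 \<dots> (map (\<lambda>(a, b). (a, b, c \<odot>\<^bsub>A\<^esub> n)) (rep (D m)))"
    proof (rule fsum_eq_map_pair)
      fix a b assume "(a, b) \<in> set (rep (D m))"
      then have ab: "a \<in> carrier A" "b \<in> carrier A" using mem[OF _ scalar(4)] by auto
      \<comment> \<open>\<open>triple_rels\<close> relates neighbouring factors only, so the scalar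
        reaches the third factor by way of the second.\<close>
      have "fsum_eq ?Y ?T3 [(c \<odot>\<^bsub>A\<^esub> a, b, n)] [(a, c \<odot>\<^bsub>A\<^esub> b, n)]"
        using triple_left_gen[OF tensor_rels.scalar[of c K a A b A], of "carrier A" n] scalar(3-5) ab
        by auto
      also have "fsum_eq ?Y ?T3 \<dots> [(a, b, c \<odot>\<^bsub>A\<^esub> n)]"
        using triple_right_gen[OF tensor_rels.scalar[of c K b A n A], of "carrier A" a] scalar(3-5) ab
        by auto
      finally show "fsum_eq ?Y ?T3 [(c \<odot>\<^bsub>A\<^esub> a, b, n)] [(a, b, c \<odot>\<^bsub>A\<^esub> n)]" .
    qed
    finally show ?thesis by (simp add: scalar(1,2))
  qed
qed

lemma comul_right_hom:
  assumes M: "module K A" and D: "linear_into K A (tensor_rels K A A) D"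
  shows "fsum_hom (carrier A \<times> carrier A) (tensor_rels K A A)
    (carrier A \<times> carrier A \<times> carrier A) (triple_rels (carrier A) (tensor_rels K A A))
    (\<lambda>(m, n). map (\<lambda>(a, b). (m, a, b)) (rep (D n)))" (is "fsum_hom ?X ?T ?Y ?T3 ?f")
proof (rule fsum_homI)
  interpret module K A by fact
  have mem: "a \<in> carrier A \<and> b \<in> carrier A" if "(a, b) \<in> set (rep (D m))" "m \<in> carrier A" for m a b
    using lists_pair_mem[OF linear_intoD(1)[OF D that(2)] that(1)] .
  show "?f x \<in> lists ?Y" if "x \<in> ?X" for x
    using that by (auto dest!: mem)
  fix xs ys assume "(xs, ys) \<in> ?T"
  then show "fsum_eq ?Y ?T3 (concat (map ?f xs)) (concat (map ?f ys))"
  proof cases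
    case (add_right m n n')
    from triple_right[OF add_right(3) linear_intoD(2)[OF D add_right(4,5)]]
    show ?thesis by (simp add: add_right(1,2))
  next
    case (add_left m m' n)
    have "fsum_eq ?Y ?T3 (map (\<lambda>(a, b). (m \<oplus>\<^bsub>A\<^esub> m', a, b)) (rep (D n)))
       (map (\<lambda>(a, b). (m, a, b)) (rep (D n)) @ map (\<lambda>(a, b). (m', a, b)) (rep (D n)))"
    proof (rule fsum_eq_map_pair_append)
      fix a b assume "(a, b) \<in> set (rep (D n))"
      then show "fsum_eq ?Y ?T3 [(m \<oplus>\<^bsub>A\<^esub> m', a, b)] [(m, a, b), (m', a, b)]"
        using triple_left_gen[OF tensor_rels.add_left[of m A m' a A K], of "carrier A" b] add_left mem
        by auto
    qed
    then show ?thesis by (simp add: add_left(1,2))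
  next
    case (zero_right m)
    from triple_right[OF zero_right(3) linear_into_zero[OF M _ D]]
    show ?thesis by (simp add: zero_right(1,2))
  next
    case (zero_left n)
    have "fsum_eq ?Y ?T3 (map (\<lambda>(a, b). (\<zero>\<^bsub>A\<^esub>, a, b)) (rep (D n))) []"
    proof (rule fsum_eq_map_pair_Nil)
      fix a b assume "(a, b) \<in> set (rep (D n))"
      then show "fsum_eq ?Y ?T3 [(\<zero>\<^bsub>A\<^esub>, a, b)] []"
        using triple_left_gen[OF tensor_rels.zero_left[of a A A K], of "carrier A" b] zero_left mem
        by auto
    qed
    then show ?thesis by (simp add: zero_left(1,2))
  next
    case (scalar c m n)
    have "fsum_eq ?Y ?T3 (map (\<lambda>(a, b). (c \<odot>\<^bsub>A\<^esub> m, a, b)) (rep (D n)))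
        (map (\<lambda>(a, b). (m, c \<odot>\<^bsub>A\<^esub> a, b)) (rep (D n)))"
    proof (rule fsum_eq_map_pair)
      fix a b assume "(a, b) \<in> set (rep (D n))"
      then have ab: "a \<in> carrier A" "b \<in> carrier A" using mem[OF _ scalar(5)] by auto
      show "fsum_eq ?Y ?T3 [(c \<odot>\<^bsub>A\<^esub> m, a, b)] [(m, c \<odot>\<^bsub>A\<^esub> a, b)]"
        using triple_left_gen[OF tensor_rels.scalar[of c K m A a A], of "carrier A" b] scalar(3-5) ab
        by auto
    qed
    also have "\<dots> = map (\<lambda>(a, b). (m, a, b)) (map (\<lambda>(a, b). (c \<odot>\<^bsub>A\<^esub> a, b)) (rep (D n)))"
      by (simp add: case_prod_unfold)
    also have "fsum_eq ?Y ?T3 \<dots> (map (\<lambda>(a, b). (m, a, b)) (rep (D (c \<odot>\<^bsub>A\<^esub> n))))"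
      by (subst fsum_eq_commute)
        (rule triple_right[OF scalar(4) linear_intoD(3)[OF D M scalar(3,5)]])
    finally show ?thesis by (simp add: scalar(1,2))
  qed
qed

lemma tensor_mult_cong:
  assumes A: "k_algebra K A"
    and xs: "fsum_eq (carrier A \<times> carrier A) (tensor_rels K A A) xs us"
    and ys: "fsum_eq (carrier A \<times> carrier A) (tensor_rels K A A) ys vs"
  shows "fsum_eq (carrier A \<times> carrier A) (tensor_rels K A A)
    (concat (map (\<lambda>(a, b). map (\<lambda>(c, d). (a \<otimes>\<^bsub>A\<^esub> c, b \<otimes>\<^bsub>A\<^esub> d)) ys) xs))
    (concat (map (\<lambda>(a, b). map (\<lambda>(c, d). (a \<otimes>\<^bsub>A\<^esub> c, b \<otimes>\<^bsub>A\<^esub> d)) vs) us))"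
    (is "fsum_eq ?X ?T _ _")
proof -
  let ?f = "\<lambda>(a, b) (c, d). [(a \<otimes>\<^bsub>A\<^esub> c, b \<otimes>\<^bsub>A\<^esub> d)]"
  note mod = k_algebraD(1)[OF A]
  have "fsum_eq ?X ?T (concat (map (\<lambda>x. concat (map (?f x) ys)) xs)) (concat (map (\<lambda>x. concat (map (?f x) vs)) us))"
  proof (rule fsum_eq_biadditive[OF _ _ xs ys])
    fix y assume "y \<in> ?X"
    then obtain c d where y: "y = (c, d)" "c \<in> carrier A" "d \<in> carrier A" by auto
    have "fsum_hom ?X ?T ?X ?T (\<lambda>(a, b). [(a \<otimes>\<^bsub>A\<^esub> c, b \<otimes>\<^bsub>A\<^esub> d)])"
      by (intro tensor_hom mod k_algebra_mult_right A y)
    then show "fsum_hom ?X ?T ?X ?T (\<lambda>x. ?f x y)"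
      by (simp add: y(1) case_prod_unfold)
  next
    fix x assume "x \<in> ?X"
    then obtain a b where x: "x = (a, b)" "a \<in> carrier A" "b \<in> carrier A" by auto
    have "fsum_hom ?X ?T ?X ?T (\<lambda>(c, d). [(a \<otimes>\<^bsub>A\<^esub> c, b \<otimes>\<^bsub>A\<^esub> d)])"
      by (intro tensor_hom mod k_algebra_mult_left A x)
    then show "fsum_hom ?X ?T ?X ?T (?f x)"
      by (simp add: x(1))
  qed
  then show ?thesis
    by (simp add: case_prod_unfold concat_map_singleton)
qed

text \<open>For \<open>f = mult A\<close> the list is the product of \<open>xs \<otimes> 1\<close>
  and \<open>1 \<otimes> ys\<close> in the threefold tensor product, for the other choice the
  product in reverse order. The axiom on the coproduct of the unit needs both.\<close>

lemma triple_mult_cong: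
  assumes A: "k_algebra K A"
    and f: "f = mult A \<or> f = (\<lambda>b c. c \<otimes>\<^bsub>A\<^esub> b)"
    and xs: "fsum_eq (carrier A \<times> carrier A) (tensor_rels K A A) xs us"
    and ys: "fsum_eq (carrier A \<times> carrier A) (tensor_rels K A A) ys vs"
  shows "fsum_eq (carrier A \<times> carrier A \<times> carrier A) (triple_rels (carrier A) (tensor_rels K A A))
    (concat (map (\<lambda>(a, b). map (\<lambda>(c, d). (a, f b c, d)) ys) xs))
    (concat (map (\<lambda>(a, b). map (\<lambda>(c, d). (a, f b c, d)) vs) us))"
    (is "fsum_eq ?Y ?T3 _ _")
proof -
  let ?X = "carrier A \<times> carrier A" and ?T = "tensor_rels K A A"
  let ?f = "\<lambda>(a, b) (c, d). [(a, f b c, d)]"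
  note mod = k_algebraD(1)[OF A]
  have "fsum_eq ?Y ?T3 (concat (map (\<lambda>x. concat (map (?f x) ys)) xs)) (concat (map (\<lambda>x. concat (map (?f x) vs)) us))"
  proof (rule fsum_eq_biadditive[OF _ _ xs ys])
    fix y assume "y \<in> ?X"
    then obtain c d where y: "y = (c, d)" "c \<in> carrier A" "d \<in> carrier A" by auto
    have "(\<lambda>b. f b c) \<in> module_hom K A A"
      using f y k_algebra_mult_left[OF A, of c] k_algebra_mult_right[OF A, of c] by auto
    then have "fsum_hom ?X ?T ?X ?T (\<lambda>(a, b). [(a, f b c)])"
      by (intro tensor_hom mod module_hom_id)
    from fsum_hom_comp[OF this triple_left_hom[OF y(3)]]
    show "fsum_hom ?X ?T ?Y ?T3 (\<lambda>x. ?f x y)"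
      by (simp add: y(1) case_prod_unfold)
  next
    fix x assume "x \<in> ?X"
    then obtain a b where x: "x = (a, b)" "a \<in> carrier A" "b \<in> carrier A" by auto
    have "(\<lambda>c. f b c) \<in> module_hom K A A"
      using f x k_algebra_mult_left[OF A, of b] k_algebra_mult_right[OF A, of b] by auto
    then have "fsum_hom ?X ?T ?X ?T (\<lambda>(c, d). [(f b c, d)])"
      by (intro tensor_hom mod module_hom_id)
    from fsum_hom_comp[OF this triple_right_hom[OF x(2)]]
    show "fsum_hom ?X ?T ?Y ?T3 (?f x)"
      by (simp add: x(1) case_prod_unfold)
  qed
  then show ?thesis
    by (simp add: case_prod_unfold concat_map_singleton)
qed


section \<open>The weak bialgebra corresponding to a bialgebra over the base\<close>

lemma corresponding_wb_simps [simp]: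
  "carrier (corresponding_wb K R \<phi> e L) = carrier L"
  "mult (corresponding_wb K R \<phi> e L) = mult L"
  "one (corresponding_wb K R \<phi> e L) = one L"
  "zero (corresponding_wb K R \<phi> e L) = zero L"
  "add (corresponding_wb K R \<phi> e L) = add L"
  "smult (corresponding_wb K R \<phi> e L) = smult L"
  "counit (corresponding_wb K R \<phi> e L) = (\<lambda>l. \<phi> (Cou L l \<one>\<^bsub>R\<^esub>))"
  by (simp_all add: corresponding_wb_def module.extend_def module.truncate_def)

lemma lsum_corresponding_wb [simp]: "lsum (corresponding_wb K R \<phi> e L) = lsum L"
  by (intro ext lsum_cong_ring) simp_all

lemma tensor_rels_corresponding_wb [simp]:
  "tensor_rels K (corresponding_wb K R \<phi> e L) (corresponding_wb K R \<phi> e L) = tensor_rels K L L"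
  by (rule tensor_rels_cong) simp_all

lemma k_algebra_corresponding_wb:
  assumes "k_algebra K L"
  shows "k_algebra K (corresponding_wb K R \<phi> e L)" (is "k_algebra K ?W")
proof -
  have "module K ?W" "ring ?W"
    using module_cong[OF k_algebraD(1)[OF assms], of ?W] ring_cong[OF k_algebraD(2)[OF assms], of ?W]
    by simp_all
  then show ?thesis
    using assms by (simp add: k_algebra_def vectorspace_def)
qed

locale base_bialgebra = frobenius_base K R \<phi> e
  for K :: "('k, 'x) ring_scheme" and R :: "('k, 'r, 'm) module_scheme"
    and \<phi> :: "'r \<Rightarrow> 'k" and e :: "('r \<times> 'r) list set" +
  fixes L :: "('k, 'r, 'l, 'n) times_bialg_scheme"
  assumes times: "times_bialgebra K R L"
begin

interpretation R: ring R using alg by (rule k_algebraD)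
interpretation RM: module K R using alg by (rule k_algebraD)

abbreviation mulL (infixl "\<cdot>" 70) where "x \<cdot> y \<equiv> x \<otimes>\<^bsub>L\<^esub> y"
abbreviation "sL \<equiv> src R L"
abbreviation "tL \<equiv> tgt R L"
abbreviation "cL x \<equiv> Cou L x \<one>\<^bsub>R\<^esub>"
abbreviation "LL \<equiv> carrier L \<times> carrier L"
abbreviation "TL \<equiv> tensor_rels K L L"
abbreviation "DL \<equiv> diamond_rels K R L"
abbreviation "gam x \<equiv> rep (Gam L x)"
abbreviation "E \<equiv> rep e"

section \<open>The structure maps and the axioms of a bialgebra over \<open>R\<close>\<close>

lemma Re: "Re_ring K R L"
  using times by (simp add: times_bialgebra_def)

lemma algL: "k_algebra K L"
  using Re by (simp add: Re_ring_def)

interpretation L: ring L using algL by (rule k_algebraD)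
interpretation LM: module K L using algL by (rule k_algebraD)

lemmas modR = RM.module_axioms and modL = LM.module_axioms

lemma emb_bilinear: "bilinear_map K R R L (emb L)"
  using Re by (simp add: Re_ring_def)

lemma src_hom: "sL \<in> module_hom K R L"
  using bilinear_mapD(2)[OF emb_bilinear R.one_closed] unfolding src_def by simp

lemma tgt_hom: "tL \<in> module_hom K R L"
  using bilinear_mapD(1)[OF emb_bilinear R.one_closed] unfolding tgt_def by simp

lemma src_closed [simp]: "r \<in> carrier R \<Longrightarrow> sL r \<in> carrier L"
  using module_hom_carrier[OF src_hom] .

lemma tgt_closed [simp]: "r \<in> carrier R \<Longrightarrow> tL r \<in> carrier L"
  using module_hom_carrier[OF tgt_hom] .

lemma emb_mult: "r \<in> carrier R \<Longrightarrow> s \<in> carrier R \<Longrightarrow> r' \<in> carrier R \<Longrightarrow> s' \<in> carrier R \<Longrightarrow>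
    emb L r s \<cdot> emb L r' s' = emb L (r \<star> r') (s' \<star> s)"
  using Re by (simp add: Re_ring_def)

lemma src_one: "sL \<one>\<^bsub>R\<^esub> = \<one>\<^bsub>L\<^esub>" and tgt_one: "tL \<one>\<^bsub>R\<^esub> = \<one>\<^bsub>L\<^esub>"
  using Re by (simp_all add: Re_ring_def src_def tgt_def)

lemma src_mult: "r \<in> carrier R \<Longrightarrow> r' \<in> carrier R \<Longrightarrow> sL (r \<star> r') = sL r \<cdot> sL r'"
  by (simp add: src_def emb_mult)

lemma tgt_mult: "s \<in> carrier R \<Longrightarrow> s' \<in> carrier R \<Longrightarrow> tL (s \<star> s') = tL s' \<cdot> tL s"
  by (simp add: tgt_def emb_mult)

lemma src_tgt_commute: "r \<in> carrier R \<Longrightarrow> s \<in> carrier R \<Longrightarrow> sL r \<cdot> tL s = tL s \<cdot> sL r"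
  by (simp add: src_def tgt_def emb_mult)

lemma src_tgt_commute_left:
  assumes "r \<in> carrier R" "s \<in> carrier R" "x \<in> carrier L"
  shows "sL r \<cdot> (tL s \<cdot> x) = tL s \<cdot> (sL r \<cdot> x)"
  using assms src_tgt_commute[OF assms(1,2)] by (simp flip: L.m_assoc)

lemma emb_eq: "r \<in> carrier R \<Longrightarrow> s \<in> carrier R \<Longrightarrow> emb L r s = sL r \<cdot> tL s"
  by (simp add: src_def tgt_def emb_mult)

lemma linear_gam: "linear_into K L DL (Gam L)"
  using times by (simp add: times_bialgebra_def)

lemma gam_lists: "x \<in> carrier L \<Longrightarrow> gam x \<in> lists LL"
  by (rule linear_intoD(1)[OF linear_gam])

lemma gam_mem: "(a, b) \<in> set (gam x) \<Longrightarrow> x \<in> carrier L \<Longrightarrow> a \<in> carrier L \<and> b \<in> carrier L"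
  using lists_pair_mem[OF gam_lists] .

lemma times_R_gam:
  assumes "x \<in> carrier L" "r \<in> carrier R"
  shows "fsum_eq LL DL (map (\<lambda>(m, n). (m \<cdot> tL r, n)) (gam x)) (map (\<lambda>(m, n). (m, n \<cdot> sL r)) (gam x))"
proof -
  have "Gam L x \<in> times_R K R L"
    using times assms(1) by (simp add: times_bialgebra_def)
  then have "diamond_class K R L (map (\<lambda>(m, n). (m \<cdot> tL r, n)) (gam x)) =
     diamond_class K R L (map (\<lambda>(m, n). (m, n \<cdot> sL r)) (gam x))"
    using assms(2) by (simp add: times_R_def)
  then show ?thesis
    unfolding diamond_class_def using assms
    by (subst (asm) fsum_class_eq_iff) (auto dest!: gam_mem)
qed

lemma gam_mult:
  assumes "g \<in> carrier L" "h \<in> carrier L"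
  shows "fsum_eq LL DL (gam (g \<cdot> h))
    (concat (map (\<lambda>(m, n). map (\<lambda>(p, q). (m \<cdot> p, n \<cdot> q)) (gam h)) (gam g)))"
proof (rule fsum_eq_rep_classD)
  show "Gam L (g \<cdot> h) = fsum_class LL DL (concat (map (\<lambda>(m, n). map (\<lambda>(p, q). (m \<cdot> p, n \<cdot> q)) (gam h)) (gam g)))"
    using times assms by (simp add: times_bialgebra_def diamond_class_def)
  show "concat (map (\<lambda>(m, n). map (\<lambda>(p, q). (m \<cdot> p, n \<cdot> q)) (gam h)) (gam g)) \<in> lists LL"
    using assms by (auto dest!: gam_mem)
qed

lemma gam_emb:
  assumes "r \<in> carrier R" "s \<in> carrier R"
  shows "fsum_eq LL DL (gam (emb L r s)) [(sL r, tL s)]"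
proof (rule fsum_eq_rep_classD)
  show "Gam L (emb L r s) = fsum_class LL DL [(sL r, tL s)]"
    using times assms by (simp add: times_bialgebra_def diamond_class_def)
qed (use assms in simp)

lemma cou_left: "x \<in> carrier L \<Longrightarrow> lsum L (map (\<lambda>(m, n). tL (cL n) \<cdot> m) (gam x)) = x"
  and cou_right: "x \<in> carrier L \<Longrightarrow> lsum L (map (\<lambda>(m, n). sL (cL m) \<cdot> n) (gam x)) = x"
  using times by (simp_all add: times_bialgebra_def)

lemma Cou_hom: "t \<in> carrier R \<Longrightarrow> (\<lambda>l. Cou L l t) \<in> module_hom K L R"
  and Cou_hom': "l \<in> carrier L \<Longrightarrow> Cou L l \<in> module_hom K R R"
  using times by (simp_all add: times_bialgebra_def)

lemma Cou_closed [simp]: "l \<in> carrier L \<Longrightarrow> t \<in> carrier R \<Longrightarrow> Cou L l t \<in> carrier R"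
  using module_hom_carrier[OF Cou_hom'] .

lemma Cou_mult: "g \<in> carrier L \<Longrightarrow> h \<in> carrier L \<Longrightarrow> t \<in> carrier R \<Longrightarrow> Cou L (g \<cdot> h) t = Cou L g (Cou L h t)"
  using times by (simp add: times_bialgebra_def)

lemma Cou_emb: "r \<in> carrier R \<Longrightarrow> s \<in> carrier R \<Longrightarrow> t \<in> carrier R \<Longrightarrow> Cou L (emb L r s) t = r \<star> t \<star> s"
  using times by (simp add: times_bialgebra_def)

lemma Cou_src: "r \<in> carrier R \<Longrightarrow> t \<in> carrier R \<Longrightarrow> Cou L (sL r) t = r \<star> t"
  and Cou_tgt: "r \<in> carrier R \<Longrightarrow> t \<in> carrier R \<Longrightarrow> Cou L (tL r) t = t \<star> r"
  by (simp_all add: src_def tgt_def Cou_emb)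

section \<open>Maps out of \<open>L \<diamondop> L\<close> and the coproduct in
  \<open>L \<otimes> L\<close>\<close>

lemma tensor_subset: "TL \<subseteq> DL"
  by (auto intro: diamond_rels.tensor)

lemma diamond_homI:
  assumes T: "fsum_hom LL TL Y G f"
    and bal: "\<And>r m n. r \<in> carrier R \<Longrightarrow> m \<in> carrier L \<Longrightarrow> n \<in> carrier L \<Longrightarrow>
      fsum_eq Y G (f (tL r \<cdot> m, n)) (f (m, sL r \<cdot> n))"
  shows "fsum_hom LL DL Y G f"
proof (rule fsum_homI)
  show "f x \<in> lists Y" if "x \<in> LL" for x
    using T that unfolding fsum_hom_def by blast
  fix xs ys assume "(xs, ys) \<in> DL" and mem: "xs \<in> lists LL" "ys \<in> lists LL"
  then show "fsum_eq Y G (concat (map f xs)) (concat (map f ys))"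
  proof (cases rule: diamond_rels.cases)
    case tensor
    then show ?thesis using T mem unfolding fsum_hom_def by blast
  next
    case (balanced r m n)
    then show ?thesis using bal by simp
  qed
qed

text \<open>The balancing acts by left multiplication with target and source elements, so it is
  enough that \<open>u\<close> and \<open>v\<close> commute with these. Right multiplications always
  qualify, by associativity.\<close>

lemma diamond_hom:
  assumes u: "u \<in> module_hom K L L" and v: "v \<in> module_hom K L L"
    and "\<And>r m. r \<in> carrier R \<Longrightarrow> m \<in> carrier L \<Longrightarrow> u (tL r \<cdot> m) = tL r \<cdot> u m"
    and "\<And>r m. r \<in> carrier R \<Longrightarrow> m \<in> carrier L \<Longrightarrow> v (sL r \<cdot> m) = sL r \<cdot> v m"
  shows "fsum_hom LL DL LL DL (\<lambda>(m, n). [(u m, v n)])"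
proof (rule diamond_homI)
  show "fsum_hom LL TL LL DL (\<lambda>(m, n). [(u m, v n)])"
    by (rule fsum_hom_mono[OF tensor_hom[OF modL modL modL modL u v] tensor_subset])
  fix r m n assume *: "r \<in> carrier R" "m \<in> carrier L" "n \<in> carrier L"
  have "fsum_eq LL DL [(tL r \<cdot> u m, v n)] [(u m, sL r \<cdot> v n)]"
    using * module_hom_carrier[OF u] module_hom_carrier[OF v]
    by (intro fsum_eq.gen diamond_rels.balanced) auto
  then show "fsum_eq LL DL (case (tL r \<cdot> m, n) of (m, n) \<Rightarrow> [(u m, v n)])
      (case (m, sL r \<cdot> n) of (m, n) \<Rightarrow> [(u m, v n)])"
    using * assms(3,4) by simp
qed

text \<open>\<open>psi\<close> induces a section of the projection from \<open>L \<otimes> L\<close> to \<open>L \<diamondop> L\<close>.\<close>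

definition psi :: "'l \<times> 'l \<Rightarrow> ('l \<times> 'l) list" where
  "psi = (\<lambda>(m, n). map (\<lambda>(a, b). (tL a \<cdot> m, sL b \<cdot> n)) E)"

lemma psi_simp [simp]: "psi (m, n) = map (\<lambda>(a, b). (tL a \<cdot> m, sL b \<cdot> n)) E"
  by (simp add: psi_def)

lemma psi_tensor_hom: "fsum_hom LL TL LL TL psi"
proof -
  have "fsum_hom LL TL LL TL (\<lambda>x. concat (map (\<lambda>i. (\<lambda>(m, n). [(tL (fst i) \<cdot> m, sL (snd i) \<cdot> n)]) x) E))"
  proof (rule fsum_hom_sum)
    fix i assume "i \<in> set E"
    then have "fst i \<in> carrier R" "snd i \<in> carrier R" using E_mem[of "fst i" "snd i"] by auto
    then show "fsum_hom LL TL LL TL (\<lambda>x. (\<lambda>(m, n). [(tL (fst i) \<cdot> m, sL (snd i) \<cdot> n)]) x)"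
      by (intro tensor_hom modL k_algebra_mult_left algL) auto
  qed
  then show ?thesis
    by (rule fsum_hom_cong) (auto simp: concat_map_singleton case_prod_unfold)
qed

text \<open>\<open>tL\<close> reverses products, so \<open>tL a \<cdot> tL r\<close> is
  \<open>tL (r \<star> a)\<close>. The Casimir property moves \<open>r\<close> to the right end of
  the second leg, where \<open>sL\<close> splits it off as a factor \<open>sL r\<close> in front of
  \<open>n\<close>. The orders match because one of the two structure maps is
  anti-multiplicative.\<close>

lemma psi_hom: "fsum_hom LL DL LL TL psi"
proof (rule diamond_homI[OF psi_tensor_hom])
  fix r m n assume *: "r \<in> carrier R" "m \<in> carrier L" "n \<in> carrier L"
  have "fsum_hom (carrier R \<times> carrier R) (tensor_rels K R R) LL TL (\<lambda>(a, b). [(tL a \<cdot> m, sL b \<cdot> n)])"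
    by (rule tensor_hom[OF modR modR modL modL
          module_hom_comp[OF tgt_hom k_algebra_mult_right[OF algL *(2)]]
          module_hom_comp[OF src_hom k_algebra_mult_right[OF algL *(3)]]])
  from fsum_hom_map_pair[OF this casimir[OF *(1)]]
  have "fsum_eq LL TL (map (\<lambda>(a, b). (tL (r \<star> a) \<cdot> m, sL b \<cdot> n)) E)
      (map (\<lambda>(a, b). (tL a \<cdot> m, sL (b \<star> r) \<cdot> n)) E)"
    by (simp add: case_prod_unfold comp_def)
  also have "map (\<lambda>(a, b). (tL (r \<star> a) \<cdot> m, sL b \<cdot> n)) E = psi (tL r \<cdot> m, n)"
    unfolding psi_simp using * by (intro map_pair_cong) (auto simp: tgt_mult L.m_assoc dest!: E_mem)
  also have "map (\<lambda>(a, b). (tL a \<cdot> m, sL (b \<star> r) \<cdot> n)) E = psi (m, sL r \<cdot> n)"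
    unfolding psi_simp using * by (intro map_pair_cong) (auto simp: src_mult L.m_assoc dest!: E_mem)
  finally show "fsum_eq LL TL (psi (tL r \<cdot> m, n)) (psi (m, sL r \<cdot> n))" .
qed

lemmas psi_eq = fsum_hom_eq[OF psi_hom]

lemma psi_lists: "zs \<in> lists LL \<Longrightarrow> concat (map psi zs) \<in> lists LL"
  using fsum_eq_lists[OF psi_eq[OF fsum_eq.refl]] by blast

abbreviation "W \<equiv> corresponding_wb K R \<phi> e L"

abbreviation "cop x \<equiv> rep (comul W x)"

text \<open>In the definition the sum over \<open>e\<close> is the outer one; exchanging the sums
  exhibits the coproduct as \<open>psi\<close> applied to \<open>Gam L x\<close>.\<close>

lemma comul_eq:
  assumes "x \<in> carrier L"
  shows "comul W x = fsum_class LL TL (concat (map psi (gam x)))"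
proof -
  let ?l = "concat (map (\<lambda>(a, b). map (\<lambda>(m, n). (tL a \<cdot> m, sL b \<cdot> n)) (gam x)) E)"
  have "fsum_eq LL TL ?l (concat (map (\<lambda>(m, n). map (\<lambda>(a, b). (tL a \<cdot> m, sL b \<cdot> n)) E) (gam x)))"
    using assms by (intro fsum_eq_swap_pair) (auto dest!: gam_mem E_mem)
  then have "fsum_eq LL TL ?l (concat (map psi (gam x)))"
    by (simp only: psi_def)
  then have "fsum_class LL TL ?l = fsum_class LL TL (concat (map psi (gam x)))"
    using fsum_class_eq_iff[OF psi_lists[OF gam_lists[OF assms]]] by simp
  then show ?thesis
    by (simp add: corresponding_wb_def module.extend_def tensor_class_def)
qed

lemma comul_rep:
  assumes "x \<in> carrier L"
  shows "fsum_eq LL TL (cop x) (concat (map psi (gam x)))"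
  using assms by (intro fsum_eq_rep_classD comul_eq psi_lists gam_lists)

text \<open>Since \<open>psi\<close> respects the balancing, any representative of
  \<open>Gam L x\<close> found by computing in \<open>L \<diamondop> L\<close> yields the coproduct
  in \<open>L \<otimes> L\<close>. The formulas for particular coproducts below are obtained in this
  way.\<close>

lemma comul_rep_eq:
  assumes "x \<in> carrier L" "fsum_eq LL DL (gam x) zs"
  shows "fsum_eq LL TL (cop x) (concat (map psi zs))"
  using comul_rep[OF assms(1)] psi_eq[OF assms(2)] by (rule fsum_eq.trans)

lemma comul_lists: "x \<in> carrier L \<Longrightarrow> cop x \<in> lists LL"
  using fsum_eq_lists[OF comul_rep] by simp

lemma comul_class:
  assumes "x \<in> carrier L" "fsum_eq LL TL (cop x) zs"
  shows "comul W x = fsum_class LL TL zs"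
proof -
  have "fsum_eq LL TL (concat (map psi (gam x))) zs"
    by (rule fsum_eq.trans[OF fsum_eq.sym[OF comul_rep[OF assms(1)]] assms(2)])
  then show ?thesis
    unfolding comul_eq[OF assms(1)] using fsum_eq_lists[OF assms(2)] by (subst fsum_class_eq_iff) simp_all
qed

text \<open>Puts the sum over \<open>e\<close> inside the sum over \<open>Gam L x\<close>, where
  \<open>frob_lsum_left\<close> and \<open>frob_lsum_right\<close> can contract it term by
  term.\<close>

lemma comul_lsum:
  assumes P: "module K P" and f: "bilinear_map K L L P f" and x: "x \<in> carrier L"
  shows "lsum P (map (\<lambda>(a, b). f a b) (cop x)) =
    lsum P (map (\<lambda>(m, n). lsum P (map (\<lambda>(a, b). f (tL a \<cdot> m) (sL b \<cdot> n)) E)) (gam x))"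
proof -
  interpret P: module K P by fact
  have "lsum P (map (\<lambda>(a, b). f a b) (cop x)) = lsum P (map (\<lambda>(a, b). f a b) (concat (map psi (gam x))))"
    by (rule tensor_lsum[OF modL modL P f comul_rep[OF x]])
  also have "map (\<lambda>(a, b). f a b) (concat (map psi (gam x))) =
      concat (map (\<lambda>z. map (\<lambda>(a, b). f a b) (psi z)) (gam x))"
    by (simp add: map_concat comp_def)
  also have "lsum P \<dots> = lsum P (map (\<lambda>z. lsum P (map (\<lambda>(a, b). f a b) (psi z))) (gam x))"
  proof (rule P.lsum_concat)
    fix z assume "z \<in> set (gam x)"
    then have "fst z \<in> carrier L" "snd z \<in> carrier L"
      using gam_mem[of "fst z" "snd z"] x by auto
    then show "set (map (\<lambda>(a, b). f a b) (psi z)) \<subseteq> carrier P"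
      using bilinear_mapD(3)[OF f] by (auto simp: psi_def case_prod_unfold dest: E_mem)
  qed
  also have "map (\<lambda>z. lsum P (map (\<lambda>(a, b). f a b) (psi z))) (gam x) =
      map (\<lambda>(m, n). lsum P (map (\<lambda>(a, b). f (tL a \<cdot> m) (sL b \<cdot> n)) E)) (gam x)"
    by (simp add: psi_def case_prod_unfold comp_def)
  finally show ?thesis .
qed

lemma comul_linear: "linear_into K L TL (comul W)"
  unfolding linear_into_def
proof (intro conjI ballI)
  show "comul W x \<in> fsum_quot LL TL" if "x \<in> carrier L" for x
    unfolding comul_eq[OF that] by (intro fsum_class_in_quot psi_lists gam_lists that)
  show "comul W (x \<oplus>\<^bsub>L\<^esub> y) = fsum_class LL TL (cop x @ cop y)"
    if "x \<in> carrier L" "y \<in> carrier L" for x y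
  proof (rule comul_class)
    have "fsum_eq LL TL (cop (x \<oplus>\<^bsub>L\<^esub> y)) (concat (map psi (gam x @ gam y)))"
      using that by (intro comul_rep_eq linear_intoD(2)[OF linear_gam]) auto
    also have "\<dots> = concat (map psi (gam x)) @ concat (map psi (gam y))" by simp
    also have "fsum_eq LL TL \<dots> (cop x @ cop y)"
      by (rule fsum_eq.append; rule fsum_eq.sym; rule comul_rep; rule that)
    finally show "fsum_eq LL TL (cop (x \<oplus>\<^bsub>L\<^esub> y)) (cop x @ cop y)" .
  qed (use that in simp)
  show "comul W (c \<odot>\<^bsub>L\<^esub> x) = fsum_class LL TL (map (\<lambda>(a, b). (c \<odot>\<^bsub>L\<^esub> a, b)) (cop x))"
    if c: "c \<in> carrier K" and x: "x \<in> carrier L" for c x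
  proof (rule comul_class)
    have "fsum_eq LL TL (cop (c \<odot>\<^bsub>L\<^esub> x)) (concat (map psi (map (\<lambda>(a, b). (c \<odot>\<^bsub>L\<^esub> a, b)) (gam x))))"
      using that by (intro comul_rep_eq linear_intoD(3)[OF linear_gam modL]) auto
    also have "concat (map psi (map (\<lambda>(a, b). (c \<odot>\<^bsub>L\<^esub> a, b)) (gam x))) =
        map (\<lambda>(a, b). (c \<odot>\<^bsub>L\<^esub> a, b)) (concat (map psi (gam x)))"
    proof -
      have "psi (c \<odot>\<^bsub>L\<^esub> m, n) = map (\<lambda>(a, b). (c \<odot>\<^bsub>L\<^esub> a, b)) (psi (m, n))" if "m \<in> carrier L" "n \<in> carrier L" for m n
        using that c algL by (auto simp: k_algebra_def dest!: E_mem)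
      then show ?thesis
        unfolding map_concat map_map comp_def using gam_mem[OF _ x]
        by (intro arg_cong[where f = concat] map_cong refl) (auto simp del: psi_simp)
    qed
    also have "fsum_eq LL TL \<dots> (map (\<lambda>(a, b). (c \<odot>\<^bsub>L\<^esub> a, b)) (cop x))"
      by (rule fsum_hom_map_pair[OF tensor_hom[OF modL modL modL modL smult_hom[OF modL c] module_hom_id]
            fsum_eq.sym[OF comul_rep[OF x]]])
    finally show "fsum_eq LL TL (cop (c \<odot>\<^bsub>L\<^esub> x))
        (map (\<lambda>(a, b). (c \<odot>\<^bsub>L\<^esub> a, b)) (cop x))" .
  qed (use that in simp)
qed

text \<open>In \<open>gam_mult\<close> the representative of \<open>Gam L (emb L r s)\<close> is
  arbitrary and has to be exchanged for a pure tensor. This is allowed because it is the left factor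
  of the product: multiplying on the right by a fixed pair respects the balancing.\<close>

lemma gam_emb_mult:
  assumes r: "r \<in> carrier R" and s: "s \<in> carrier R" and x: "x \<in> carrier L"
  shows "fsum_eq LL DL (gam (emb L r s \<cdot> x)) (map (\<lambda>(p, q). (sL r \<cdot> p, tL s \<cdot> q)) (gam x))"
proof -
  have emb: "emb L r s \<in> carrier L" by (simp add: emb_eq r s)
  have "fsum_hom LL DL LL DL (\<lambda>z. concat (map (\<lambda>i. (\<lambda>(m, n). [(m \<cdot> fst i, n \<cdot> snd i)]) z) (gam x)))"
  proof (rule fsum_hom_sum)
    fix i assume "i \<in> set (gam x)"
    then have i: "fst i \<in> carrier L" "snd i \<in> carrier L" using gam_mem[of "fst i" "snd i" x] x by auto
    show "fsum_hom LL DL LL DL (\<lambda>z. (\<lambda>(m, n). [(m \<cdot> fst i, n \<cdot> snd i)]) z)"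
      using i by (intro diamond_hom k_algebra_mult_right algL) (auto simp: L.m_assoc)
  qed
  then have h: "fsum_hom LL DL LL DL (\<lambda>(m, n). map (\<lambda>(p, q). (m \<cdot> p, n \<cdot> q)) (gam x))"
    by (rule fsum_hom_cong) (auto simp: concat_map_singleton case_prod_unfold)
  show ?thesis
    using fsum_eq.trans[OF gam_mult[OF emb x] fsum_hom_eq[OF h gam_emb[OF r s]]] by simp
qed

lemma gam_tgt_mult:
  assumes "s \<in> carrier R" and x: "x \<in> carrier L"
  shows "fsum_eq LL DL (gam (tL s \<cdot> x)) (map (\<lambda>(p, q). (p, tL s \<cdot> q)) (gam x))"
proof -
  have e: "emb L \<one>\<^bsub>R\<^esub> s = tL s" by (simp add: tgt_def)
  have *: "map (\<lambda>(p, q). (sL \<one>\<^bsub>R\<^esub> \<cdot> p, tL s \<cdot> q)) (gam x) = map (\<lambda>(p, q). (p, tL s \<cdot> q)) (gam x)"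
    using x by (intro map_pair_cong) (auto simp: src_one dest!: gam_mem)
  show ?thesis
    using gam_emb_mult[OF R.one_closed assms] unfolding e * .
qed

lemma gam_src_mult:
  assumes "s \<in> carrier R" and x: "x \<in> carrier L"
  shows "fsum_eq LL DL (gam (sL s \<cdot> x)) (map (\<lambda>(p, q). (sL s \<cdot> p, q)) (gam x))"
proof -
  have e: "emb L s \<one>\<^bsub>R\<^esub> = sL s" by (simp add: src_def)
  have *: "map (\<lambda>(p, q). (sL s \<cdot> p, tL \<one>\<^bsub>R\<^esub> \<cdot> q)) (gam x) = map (\<lambda>(p, q). (sL s \<cdot> p, q)) (gam x)"
    using x by (intro map_pair_cong) (auto simp: tgt_one dest!: gam_mem)
  show ?thesis
    using gam_emb_mult[OF assms(1) R.one_closed assms(2)] unfolding e * .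
qed

section \<open>Coassociativity and multiplicativity of the coproduct\<close>

abbreviation "LLL \<equiv> carrier L \<times> carrier L \<times> carrier L"
abbreviation "TTL \<equiv> triple_rels (carrier L) TL"

text \<open>The threefold analogue of \<open>psi\<close>: one copy of \<open>e\<close> joins the
  first two factors, the primed copy the last two, and both act on the middle factor. It leads from
  the threefold balanced product back to the threefold tensor product.\<close>

definition psi3 :: "'l \<times> 'l \<times> 'l \<Rightarrow> ('l \<times> 'l \<times> 'l) list" where
  "psi3 = (\<lambda>(l, m, n). concat (map (\<lambda>(a', b').
     map (\<lambda>(a, b). (tL a \<cdot> l, sL b \<cdot> (tL a' \<cdot> m), sL b' \<cdot> n)) E) E))"

text \<open>For a fixed term of the primed copy of \<open>e\<close>, the second factor is first
  multiplied by a target element. That commutes with source elements, hence respects the balancing,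
  and \<open>psi\<close> does the rest.\<close>

lemma psi3_left_hom:
  assumes c: "c \<in> carrier L"
  shows "fsum_hom LL DL LLL TTL (\<lambda>(l, m). psi3 (l, m, c))"
proof -
  have "fsum_hom LL DL LLL TTL (\<lambda>z. concat (map (\<lambda>i.
      concat (map (\<lambda>(p, q). [(p, q, sL (snd i) \<cdot> c)])
        (concat (map psi ((\<lambda>(l, m). [(l, tL (fst i) \<cdot> m)]) z))))) E))"
  proof (rule fsum_hom_sum)
    fix i assume "i \<in> set E"
    then have i: "fst i \<in> carrier R" "snd i \<in> carrier R" using E_mem[of "fst i" "snd i"] by auto
    have "fsum_hom LL DL LL DL (\<lambda>(l, m). [(l, tL (fst i) \<cdot> m)])"
      using i by (intro diamond_hom module_hom_id k_algebra_mult_left algL)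
        (auto simp: src_tgt_commute_left)
    from fsum_hom_comp[OF fsum_hom_comp[OF this psi_hom] triple_left_hom]
    show "fsum_hom LL DL LLL TTL (\<lambda>z. concat (map (\<lambda>(p, q). [(p, q, sL (snd i) \<cdot> c)])
        (concat (map psi ((\<lambda>(l, m). [(l, tL (fst i) \<cdot> m)]) z)))))"
      using i c by simp
  qed
  then show ?thesis
    by (rule fsum_hom_cong)
      (auto simp: psi3_def case_prod_unfold concat_map_singleton comp_def)
qed

lemma psi3_right_hom:
  assumes c: "c \<in> carrier L"
  shows "fsum_hom LL DL LLL TTL (\<lambda>(m, n). psi3 (c, m, n))"
proof -
  have "fsum_hom LL DL LLL TTL (\<lambda>z. concat (map (\<lambda>i.
      concat (map (\<lambda>(p, q). [(tL (fst i) \<cdot> c, p, q)])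
        (concat (map psi ((\<lambda>(m, n). [(sL (snd i) \<cdot> m, n)]) z))))) E))"
  proof (rule fsum_hom_sum)
    fix i assume "i \<in> set E"
    then have i: "fst i \<in> carrier R" "snd i \<in> carrier R" using E_mem[of "fst i" "snd i"] by auto
    have "fsum_hom LL DL LL DL (\<lambda>(m, n). [(sL (snd i) \<cdot> m, n)])"
      using i by (intro diamond_hom module_hom_id k_algebra_mult_left algL)
        (auto simp: src_tgt_commute_left)
    from fsum_hom_comp[OF fsum_hom_comp[OF this psi_hom] triple_right_hom]
    show "fsum_hom LL DL LLL TTL (\<lambda>z. concat (map (\<lambda>(p, q). [(tL (fst i) \<cdot> c, p, q)])
        (concat (map psi ((\<lambda>(m, n). [(sL (snd i) \<cdot> m, n)]) z)))))"
      using i c by simp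
  qed
  then show ?thesis
  proof (rule fsum_hom_cong_eq)
    fix z assume "z \<in> LL"
    then obtain m n where z: "z = (m, n)" and mn: "m \<in> carrier L" "n \<in> carrier L" by auto
    have "concat (map (\<lambda>i. concat (map (\<lambda>(p, q). [(tL (fst i) \<cdot> c, p, q)])
        (concat (map psi ((\<lambda>(m, n). [(sL (snd i) \<cdot> m, n)]) z))))) E) =
      concat (map (\<lambda>(a, b). map (\<lambda>(a', b'). (tL a \<cdot> c, tL a' \<cdot> (sL b \<cdot> m), sL b' \<cdot> n)) E) E)"
      by (simp add: z case_prod_unfold concat_map_singleton comp_def)
    \<comment> \<open>Applying \<open>psi\<close> last leaves its target element outermost; in
      \<open>psi3\<close> the source element is outermost, so the two are exchanged.\<close>
    also have "\<dots> = concat (map (\<lambda>(a, b). map (\<lambda>(a', b'). (tL a \<cdot> c, sL b \<cdot> (tL a' \<cdot> m), sL b' \<cdot> n)) E) E)"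
      using mn by (intro arg_cong[where f = concat] map_pair_cong)
        (auto simp: src_tgt_commute_left dest!: E_mem)
    also have "fsum_eq LLL TTL \<dots> (psi3 (c, m, n))"
      unfolding psi3_def prod.case using mn c by (intro fsum_eq_swap_pair) (auto dest!: E_mem)
    finally show "fsum_eq LLL TTL (concat (map (\<lambda>i. concat (map (\<lambda>(p, q). [(tL (fst i) \<cdot> c, p, q)])
        (concat (map psi ((\<lambda>(m, n). [(sL (snd i) \<cdot> m, n)]) z))))) E))
      (case z of (m, n) \<Rightarrow> psi3 (c, m, n))" by (simp add: z)
  qed
qed

lemma psi3_hom: "fsum_hom LLL (triple_rels (carrier L) DL) LLL TTL psi3"
proof (rule fsum_homI)
  fix x assume "x \<in> LLL"
  then obtain l m n where "x = (l, m, n)" "l \<in> carrier L" "m \<in> carrier L" "n \<in> carrier L" by auto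
  then show "psi3 x \<in> lists LLL"
    using psi3_left_hom[of n] unfolding fsum_hom_def by force
next
  fix xs ys assume *: "(xs, ys) \<in> triple_rels (carrier L) DL" "xs \<in> lists LLL" "ys \<in> lists LLL"
  from *(1) consider
    xs0 ys0 c where "(xs0, ys0) \<in> DL" "c \<in> carrier L"
      "xs = map (\<lambda>(a, b). (a, b, c)) xs0" "ys = map (\<lambda>(a, b). (a, b, c)) ys0"
  | xs0 ys0 c where "(xs0, ys0) \<in> DL" "c \<in> carrier L"
      "xs = map (\<lambda>(a, b). (c, a, b)) xs0" "ys = map (\<lambda>(a, b). (c, a, b)) ys0"
    unfolding triple_rels_def by blast
  then show "fsum_eq LLL TTL (concat (map psi3 xs)) (concat (map psi3 ys))"
  proof cases
    case 1
    then have "xs0 \<in> lists LL" "ys0 \<in> lists LL" using * by auto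
    from fsum_eq.gen[OF 1(1) this] have "fsum_eq LL DL xs0 ys0" .
    from fsum_hom_eq[OF psi3_left_hom[OF 1(2)] this] show ?thesis
      by (simp add: 1(3,4) case_prod_unfold comp_def)
  next
    case 2
    then have "xs0 \<in> lists LL" "ys0 \<in> lists LL" using * by auto
    from fsum_eq.gen[OF 2(1) this] have "fsum_eq LL DL xs0 ys0" .
    from fsum_hom_eq[OF psi3_right_hom[OF 2(2)] this] show ?thesis
      by (simp add: 2(3,4) case_prod_unfold comp_def)
  qed
qed

lemmas W_left_hom = comul_left_hom[OF modL comul_linear]
  and W_right_hom = comul_right_hom[OF modL comul_linear]

lemma comul_tgt_mult:
  assumes "s \<in> carrier R" "x \<in> carrier L"
  shows "fsum_eq LL TL (cop (tL s \<cdot> x))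
    (concat (map (\<lambda>(p, q). map (\<lambda>(a, b). (tL a \<cdot> p, sL b \<cdot> (tL s \<cdot> q))) E) (gam x)))"
  using comul_rep_eq[OF _ gam_tgt_mult[OF assms]] assms
  by (simp add: psi_def case_prod_unfold comp_def)

lemma comul_src_mult:
  assumes "s \<in> carrier R" "x \<in> carrier L"
  shows "fsum_eq LL TL (cop (sL s \<cdot> x))
    (concat (map (\<lambda>(p, q). map (\<lambda>(a, b). (tL a \<cdot> (sL s \<cdot> p), sL b \<cdot> q)) E) (gam x)))"
  using comul_rep_eq[OF _ gam_src_mult[OF assms]] assms
  by (simp add: psi_def case_prod_unfold comp_def)

text \<open>The inner coproduct is that of \<open>tL a' \<cdot> m\<close>. By
  \<open>gam_tgt_mult\<close> the target element ends up on the second leg of \<open>m\<close>,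
  which is the middle factor, exactly where \<open>psi3\<close> has it.\<close>

lemma coassoc_left:
  assumes x: "x \<in> carrier L"
  shows "fsum_eq LLL TTL
    (comul_left (comul W) (cop x))
    (concat (map psi3 (comul_left (Gam L) (gam x))))"
    (is "fsum_eq _ _ (concat (map ?f _)) _")
proof -
  have "fsum_eq LLL TTL (concat (map ?f (cop x))) (concat (map ?f (concat (map psi (gam x)))))"
    by (rule fsum_hom_eq[OF W_left_hom comul_rep[OF x]])
  also have "concat (map ?f (concat (map psi (gam x)))) =
      concat (map (\<lambda>(m, n). concat (map ?f (psi (m, n)))) (gam x))"
    by (simp add: concat_map_concat_map case_prod_unfold del: psi_simp)
  also have "fsum_eq LLL TTL \<dots> (concat (map (\<lambda>(m, n). concat (map psi3 (map (\<lambda>(a, b). (a, b, n)) (gam m)))) (gam x)))"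
  proof (rule fsum_eq_concat_pair_cong)
    fix m n assume "(m, n) \<in> set (gam x)"
    then have mn: "m \<in> carrier L" "n \<in> carrier L" using gam_mem x by auto
    let ?g = "\<lambda>(a', b') (p, q). map (\<lambda>(a, b). (tL a \<cdot> p, sL b \<cdot> (tL a' \<cdot> q), sL b' \<cdot> n)) E"
    have "concat (map ?f (psi (m, n))) =
        concat (map (\<lambda>(a', b'). map (\<lambda>(a, b). (a, b, sL b' \<cdot> n)) (cop (tL a' \<cdot> m))) E)"
      by (simp add: case_prod_unfold comp_def)
    also have "fsum_eq LLL TTL \<dots> (concat (map (\<lambda>(a', b'). concat (map (?g (a', b')) (gam m))) E))"
    proof (rule fsum_eq_concat_pair_cong)
      fix a' b' assume "(a', b') \<in> set E"
      then have ab: "a' \<in> carrier R" "b' \<in> carrier R" using E_mem by auto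
      have "sL b' \<cdot> n \<in> carrier L" using ab mn by simp
      from triple_left[OF this comul_tgt_mult[OF ab(1) mn(1)]]
      show "fsum_eq LLL TTL (map (\<lambda>(a, b). (a, b, sL b' \<cdot> n)) (cop (tL a' \<cdot> m)))
          (concat (map (?g (a', b')) (gam m)))"
        by (simp add: map_concat case_prod_unfold comp_def)
    qed
    also have "(concat (map (\<lambda>(a', b'). concat (map (?g (a', b')) (gam m))) E)) =
        concat (map (\<lambda>i. concat (map (?g i) (gam m))) E)"
      by (simp add: case_prod_unfold)
    also have "fsum_eq LLL TTL \<dots> (concat (map (\<lambda>j. concat (map (\<lambda>i. ?g i j) E)) (gam m)))"
      using mn by (intro fsum_eq_concat_swap) (auto dest!: E_mem gam_mem)
    also have "\<dots> = concat (map psi3 (map (\<lambda>(a, b). (a, b, n)) (gam m)))"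
      by (simp add: psi3_def case_prod_unfold comp_def)
    finally show "fsum_eq LLL TTL (concat (map ?f (psi (m, n))))
       (concat (map psi3 (map (\<lambda>(a, b). (a, b, n)) (gam m))))" .
  qed
  also have "\<dots> = concat (map psi3 (comul_left (Gam L) (gam x)))"
    by (simp add: concat_map_concat_map case_prod_unfold del: psi_simp)
  finally show ?thesis .
qed

text \<open>Mirror image: the source element in front of \<open>n\<close> goes to the first leg of
  \<open>n\<close>, again the middle factor. There it meets the target element of the new copy of
  \<open>e\<close> and commutes with it, so that both bracketings are \<open>psi3\<close> of an
  iterated \<open>Gam L\<close>.\<close>

lemma coassoc_right:
  assumes x: "x \<in> carrier L"
  shows "fsum_eq LLL TTL
    (comul_right (comul W) (cop x))
    (concat (map psi3 (comul_right (Gam L) (gam x))))"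
    (is "fsum_eq _ _ (concat (map ?f _)) _")
proof -
  have "fsum_eq LLL TTL (concat (map ?f (cop x))) (concat (map ?f (concat (map psi (gam x)))))"
    by (rule fsum_hom_eq[OF W_right_hom comul_rep[OF x]])
  also have "concat (map ?f (concat (map psi (gam x)))) =
      concat (map (\<lambda>(m, n). concat (map ?f (psi (m, n)))) (gam x))"
    by (simp add: concat_map_concat_map case_prod_unfold del: psi_simp)
  also have "fsum_eq LLL TTL \<dots> (concat (map (\<lambda>(m, n). concat (map psi3 (map (\<lambda>(a, b). (m, a, b)) (gam n)))) (gam x)))"
  proof (rule fsum_eq_concat_pair_cong)
    fix m n assume "(m, n) \<in> set (gam x)"
    then have mn: "m \<in> carrier L" "n \<in> carrier L" using gam_mem x by auto
    let ?g = "\<lambda>(a, b) (p, q). map (\<lambda>(a', b'). (tL a \<cdot> m, sL b \<cdot> (tL a' \<cdot> p), sL b' \<cdot> q)) E"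
    have "concat (map ?f (psi (m, n))) =
        concat (map (\<lambda>(a, b). map (\<lambda>(p, q). (tL a \<cdot> m, p, q)) (cop (sL b \<cdot> n))) E)"
      by (simp add: case_prod_unfold comp_def)
    also have "fsum_eq LLL TTL \<dots> (concat (map (\<lambda>(a, b). concat (map (?g (a, b)) (gam n))) E))"
    proof (rule fsum_eq_concat_pair_cong)
      fix a b assume "(a, b) \<in> set E"
      then have ab: "a \<in> carrier R" "b \<in> carrier R" using E_mem by auto
      have "tL a \<cdot> m \<in> carrier L" using ab mn by simp
      from triple_right[OF this comul_src_mult[OF ab(2) mn(2)]]
      have 1: "fsum_eq LLL TTL (map (\<lambda>(p, q). (tL a \<cdot> m, p, q)) (cop (sL b \<cdot> n)))
          (concat (map (\<lambda>(p, q). map (\<lambda>(a', b'). (tL a \<cdot> m, tL a' \<cdot> (sL b \<cdot> p), sL b' \<cdot> q)) E) (gam n)))"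
        by (simp add: map_concat case_prod_unfold comp_def)
      have 2: "concat (map (\<lambda>(p, q). map (\<lambda>(a', b'). (tL a \<cdot> m, tL a' \<cdot> (sL b \<cdot> p), sL b' \<cdot> q)) E) (gam n)) =
          concat (map (?g (a, b)) (gam n))"
        unfolding prod.case using ab mn by (intro arg_cong[where f = concat] map_pair_cong)
          (auto simp: src_tgt_commute_left dest!: E_mem gam_mem)
      show "fsum_eq LLL TTL (map (\<lambda>(p, q). (tL a \<cdot> m, p, q)) (cop (sL b \<cdot> n)))
          (concat (map (?g (a, b)) (gam n)))"
        using 1 unfolding 2 .
    qed
    also have "(concat (map (\<lambda>(a, b). concat (map (?g (a, b)) (gam n))) E)) =
        concat (map (\<lambda>i. concat (map (?g i) (gam n))) E)"
      by (simp add: case_prod_unfold)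
    also have "fsum_eq LLL TTL \<dots> (concat (map (\<lambda>j. concat (map (\<lambda>i. ?g i j) E)) (gam n)))"
      using mn by (intro fsum_eq_concat_swap) (auto dest!: E_mem gam_mem)
    also have "fsum_eq LLL TTL \<dots> (concat (map (\<lambda>j. psi3 (m, j)) (gam n)))"
    proof (rule fsum_eq_concat_cong)
      fix j assume *: "j \<in> set (gam n)"
      obtain p q where j: "j = (p, q)" by (cases j)
      have pq: "p \<in> carrier L" "q \<in> carrier L"
        using gam_mem[OF _ mn(2), of p q] * by (simp_all add: j)
      have "concat (map (\<lambda>i. ?g i j) E) = concat (map (\<lambda>(a, b). map (\<lambda>(a', b').
          (tL a \<cdot> m, sL b \<cdot> (tL a' \<cdot> p), sL b' \<cdot> q)) E) E)"
        by (simp add: j case_prod_unfold)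
      also have "fsum_eq LLL TTL \<dots> (psi3 (m, j))"
        unfolding psi3_def j prod.case using pq mn by (intro fsum_eq_swap_pair) (auto dest!: E_mem)
      finally show "fsum_eq LLL TTL (concat (map (\<lambda>i. ?g i j) E)) (psi3 (m, j))" .
    qed
    also have "\<dots> = concat (map psi3 (map (\<lambda>(a, b). (m, a, b)) (gam n)))"
      by (simp add: case_prod_unfold comp_def)
    finally show "fsum_eq LLL TTL (concat (map ?f (psi (m, n))))
       (concat (map psi3 (map (\<lambda>(a, b). (m, a, b)) (gam n))))" .
  qed
  also have "\<dots> = concat (map psi3 (comul_right (Gam L) (gam x)))"
    by (simp add: concat_map_concat_map case_prod_unfold del: psi_simp)
  finally show ?thesis .
qed

lemma comul_coassociative: "coassociative W TL (comul W)"
  unfolding coassociative_def corresponding_wb_simps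
proof
  fix x assume x: "x \<in> carrier L"
  have "coassociative L DL (Gam L)"
    using times by (simp add: times_bialgebra_def)
  then have "fsum_eq LLL (triple_rels (carrier L) DL)
      (comul_left (Gam L) (gam x))
      (comul_right (Gam L) (gam x))"
    using x by (simp add: coassociative_def)
  from fsum_eq.trans[OF fsum_eq.trans[OF coassoc_left[OF x] fsum_hom_eq[OF psi3_hom this]]
      fsum_eq.sym[OF coassoc_right[OF x]]]
  show "fsum_eq LLL TTL
    (comul_left (comul W) (cop x))
    (comul_right (comul W) (cop x))" .
qed

text \<open>Inserting \<open>tL a \<otimes> sL b\<close>, summed over \<open>e\<close>, between the
  two factors changes nothing. The condition defining \<open>times_R\<close>, applied to
  \<open>Gam L g\<close>, moves \<open>tL a\<close> to the second leg as \<open>sL a\<close>, and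
  there \<open>sL a \<cdot> sL b = sL (a \<star> b)\<close> sums to the unit. The inserted copy of
  \<open>e\<close> is the one that the coproduct of \<open>h\<close> has in front.\<close>

lemma gam_mult_inserted:
  assumes g: "g \<in> carrier L" and h: "h \<in> carrier L"
  shows "fsum_eq LL DL (gam (g \<cdot> h))
    (concat (map (\<lambda>(a, b). concat (map (\<lambda>(m, n). map (\<lambda>(p, q). (m \<cdot> (tL a \<cdot> p), n \<cdot> (sL b \<cdot> q))) (gam h)) (gam g))) E))"
proof -
  have mem: "m \<in> carrier L" "n \<in> carrier L" if "(m, n) \<in> set (gam g)" for m n
    using gam_mem[OF that g] by simp_all
  have mem': "p \<in> carrier L" "q \<in> carrier L" if "(p, q) \<in> set (gam h)" for p q
    using gam_mem[OF that h] by simp_all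
  let ?F = "\<lambda>a b m n p q. (m \<cdot> p, n \<cdot> (sL a \<cdot> (sL b \<cdot> q)))"
  let ?G = "\<lambda>a b. concat (map (\<lambda>(m, n). map (\<lambda>(p, q). (m \<cdot> (tL a \<cdot> p), n \<cdot> (sL b \<cdot> q))) (gam h)) (gam g))"
  let ?H = "\<lambda>a b. concat (map (\<lambda>(m, n). map (\<lambda>(p, q). ?F a b m n p q) (gam h)) (gam g))"
  let ?X = "concat (map (\<lambda>(m, n). map (\<lambda>(p, q). (m \<cdot> p, n \<cdot> q)) (gam h)) (gam g))"
  have "fsum_eq LL DL (concat (map (\<lambda>(a, b). ?G a b) E))
    (concat (map (\<lambda>(a, b). ?H a b) E))"
  proof (rule fsum_eq_concat_pair_cong)
    fix a b assume "(a, b) \<in> set E"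
    then have ab: "a \<in> carrier R" "b \<in> carrier R" using E_mem by auto
    have "fsum_hom LL DL LL DL (\<lambda>z. concat (map (\<lambda>i. (\<lambda>(m, n). [(m \<cdot> fst i, n \<cdot> (sL b \<cdot> snd i))]) z) (gam h)))"
    proof (rule fsum_hom_sum)
      fix i assume "i \<in> set (gam h)"
      then have i: "fst i \<in> carrier L" "snd i \<in> carrier L" using gam_mem[of "fst i" "snd i" h] h by auto
      show "fsum_hom LL DL LL DL (\<lambda>z. (\<lambda>(m, n). [(m \<cdot> fst i, n \<cdot> (sL b \<cdot> snd i))]) z)"
        using i ab by (intro diamond_hom k_algebra_mult_right algL) (auto simp: L.m_assoc)
    qed
    then have hom: "fsum_hom LL DL LL DL (\<lambda>(m, n). map (\<lambda>(p, q). (m \<cdot> p, n \<cdot> (sL b \<cdot> q))) (gam h))"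
      by (rule fsum_hom_cong) (auto simp: concat_map_singleton case_prod_unfold)
    \<comment> \<open>The condition \<open>times_R\<close> concerns \<open>Gam L g\<close> alone;
      the remaining factors are multiplied on from the right, which respects the balancing.\<close>
    from fsum_hom_eq[OF this times_R_gam[OF g ab(1)]]
    have 1: "fsum_eq LL DL
        (concat (map (\<lambda>(m, n). map (\<lambda>(p, q). (m \<cdot> tL a \<cdot> p, n \<cdot> (sL b \<cdot> q))) (gam h)) (gam g)))
        (concat (map (\<lambda>(m, n). map (\<lambda>(p, q). (m \<cdot> p, n \<cdot> sL a \<cdot> (sL b \<cdot> q))) (gam h)) (gam g)))"
      by (simp add: case_prod_unfold comp_def)
    have 2: "concat (map (\<lambda>(m, n). map (\<lambda>(p, q). (m \<cdot> tL a \<cdot> p, n \<cdot> (sL b \<cdot> q))) (gam h)) (gam g)) =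
       ?G a b"
      using ab mem mem' by (intro arg_cong[where f = concat] map_pair_cong) (auto simp: L.m_assoc)
    have 3: "concat (map (\<lambda>(m, n). map (\<lambda>(p, q). (m \<cdot> p, n \<cdot> sL a \<cdot> (sL b \<cdot> q))) (gam h)) (gam g)) =
       ?H a b"
      using ab mem mem' by (intro arg_cong[where f = concat] map_pair_cong) (auto simp: L.m_assoc)
    show "fsum_eq LL DL
       (?G a b)
       (?H a b)"
      using 1 unfolding 2 3 .
  qed
  also have "\<dots> = concat (map (\<lambda>i. concat (map (\<lambda>j. map (\<lambda>k.
      ?F (fst i) (snd i) (fst j) (snd j) (fst k) (snd k)) (gam h)) (gam g))) E)"
    by (simp add: case_prod_unfold)
  also have "fsum_eq LL DL \<dots> (concat (map (\<lambda>j. concat (map (\<lambda>i. map (\<lambda>k.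
      ?F (fst i) (snd i) (fst j) (snd j) (fst k) (snd k)) (gam h)) E)) (gam g)))"
    using mem mem' by (intro fsum_eq_concat_swap) (auto dest!: E_mem)
  also have "\<dots> = concat (map (\<lambda>(m, n). concat (map (\<lambda>(a, b). map (\<lambda>(p, q). ?F a b m n p q) (gam h)) E)) (gam g))"
    by (simp add: case_prod_unfold)
  also have "fsum_eq LL DL \<dots> (?X)"
  proof (rule fsum_eq_concat_pair_cong)
    fix m n assume "(m, n) \<in> set (gam g)"
    note mn = mem[OF this]
    have "fsum_eq LL DL (concat (map (\<lambda>(a, b). map (\<lambda>(p, q). ?F a b m n p q) (gam h)) E))
        (concat (map (\<lambda>(p, q). map (\<lambda>(a, b). ?F a b m n p q) E) (gam h)))"
      using mn mem' by (intro fsum_eq_swap_pair) (auto dest!: E_mem)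
    also have "fsum_eq LL DL \<dots> (concat (map (\<lambda>(p, q). [(m \<cdot> p, n \<cdot> q)]) (gam h)))"
    proof (rule fsum_eq_concat_pair_cong)
      fix p q assume "(p, q) \<in> set (gam h)"
      note pq = mem'[OF this]
      have hom: "(\<lambda>r. n \<cdot> (sL r \<cdot> q)) \<in> module_hom K R L"
        by (rule module_hom_comp[OF module_hom_comp[OF src_hom k_algebra_mult_right[OF algL pq(2)]]
              k_algebra_mult_left[OF algL mn(2)]])
      \<comment> \<open>Idempotency of the Frobenius system enters here: the unit in front of
        \<open>q\<close> is spread out into a sum over \<open>e\<close>.\<close>
      have "n \<cdot> q = n \<cdot> (sL (lsum R (map (\<lambda>(a, b). a \<star> b) E)) \<cdot> q)"
        using mn pq by (simp add: E_idem src_one)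
      also have "\<dots> = lsum L (map (\<lambda>r. n \<cdot> (sL r \<cdot> q)) (map (\<lambda>(a, b). a \<star> b) E))"
        by (rule module_hom_lsum[OF modR modL hom]) (auto dest!: E_mem)
      also have "\<dots> = lsum L (map (\<lambda>(a, b). n \<cdot> (sL a \<cdot> (sL b \<cdot> q))) E)"
        unfolding map_map comp_def using mn pq
        by (intro arg_cong[where f = "lsum L"]) (auto simp: src_mult L.m_assoc dest!: E_mem)
      finally have *: "lsum L (map (\<lambda>(a, b). n \<cdot> (sL a \<cdot> (sL b \<cdot> q))) E) = n \<cdot> q" ..
      have "fsum_eq LL TL [(m \<cdot> p, lsum L (map (\<lambda>(a, b). n \<cdot> (sL a \<cdot> (sL b \<cdot> q))) E))]
          (map (\<lambda>x. (m \<cdot> p, (\<lambda>(a, b). n \<cdot> (sL a \<cdot> (sL b \<cdot> q))) x)) E)"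
        using mn pq by (intro tensor_lsum_right modL) (auto dest!: E_mem)
      then have "fsum_eq LL TL [(m \<cdot> p, n \<cdot> q)] (map (\<lambda>(a, b). ?F a b m n p q) E)"
        unfolding * by (simp add: case_prod_unfold)
      from fsum_eq.sym[OF fsum_eq_mono[OF this tensor_subset]]
      show "fsum_eq LL DL (map (\<lambda>(a, b). ?F a b m n p q) E) [(m \<cdot> p, n \<cdot> q)]" .
    qed
    finally show "fsum_eq LL DL (concat (map (\<lambda>(a, b). map (\<lambda>(p, q). ?F a b m n p q) (gam h)) E))
        (map (\<lambda>(p, q). (m \<cdot> p, n \<cdot> q)) (gam h))"
      unfolding concat_map_pair_singleton .
  qed
  finally have "fsum_eq LL DL (?X)
    (concat (map (\<lambda>(a, b). ?G a b) E))"
    by (rule fsum_eq.sym)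
  from fsum_eq.trans[OF gam_mult[OF g h] this] show ?thesis .
qed

text \<open>Applying \<open>psi\<close> to \<open>gam_mult_inserted\<close> puts one copy of
  \<open>e\<close> in front of \<open>Gam L g\<close> and leaves the other in front of
  \<open>Gam L h\<close>. After regrouping this is the product of the two coproducts.\<close>

lemma comul_mult:
  assumes g: "g \<in> carrier L" and h: "h \<in> carrier L"
  shows "comul W (g \<cdot> h) = fsum_class LL TL
    (concat (map (\<lambda>(a, b). map (\<lambda>(c, d). (a \<cdot> c, b \<cdot> d)) (cop h)) (cop g)))"
proof (rule comul_class)
  let ?zs = "concat (map (\<lambda>(a, b). concat (map (\<lambda>(m, n). map (\<lambda>(p, q). (m \<cdot> (tL a \<cdot> p), n \<cdot> (sL b \<cdot> q))) (gam h)) (gam g))) E)"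
  have mem: "m \<in> carrier L" "n \<in> carrier L" if "(m, n) \<in> set (gam g)" for m n
    using gam_mem[OF that g] by simp_all
  have mem': "p \<in> carrier L" "q \<in> carrier L" if "(p, q) \<in> set (gam h)" for p q
    using gam_mem[OF that h] by simp_all
  let ?F = "\<lambda>i j k l. (tL (fst l) \<cdot> (fst j \<cdot> (tL (fst i) \<cdot> fst k)), sL (snd l) \<cdot> (snd j \<cdot> (sL (snd i) \<cdot> snd k)))"
  have "fsum_eq LL TL (cop (g \<cdot> h)) (concat (map psi ?zs))"
    using g h by (intro comul_rep_eq gam_mult_inserted) auto
  also have "\<dots> = concat (map (\<lambda>i. concat (map (\<lambda>j. concat (map (\<lambda>k. map (?F i j k) E) (gam h))) (gam g))) E)"
    by (simp add: concat_map_concat_map case_prod_unfold psi_def comp_def)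
  \<comment> \<open>The index \<open>l\<close>, which comes from \<open>psi\<close>, is grouped with
    \<open>j\<close> into the coproduct of \<open>g\<close>, and the inserted index \<open>i\<close>
    with \<open>k\<close> into that of \<open>h\<close>.\<close>
  also have "fsum_eq LL TL \<dots> (concat (map (\<lambda>j. concat (map (\<lambda>l. concat (map (\<lambda>k. map (\<lambda>i. ?F i j k l) E) (gam h))) E)) (gam g)))"
  proof (rule fsum_eq_mset)
    show "mset (concat (map (\<lambda>i. concat (map (\<lambda>j. concat (map (\<lambda>k. map (?F i j k) E) (gam h))) (gam g))) E)) =
      mset (concat (map (\<lambda>j. concat (map (\<lambda>l. concat (map (\<lambda>k. map (\<lambda>i. ?F i j k l) E) (gam h))) E)) (gam g)))"
      unfolding mset_concat_map mset_map_sum by (rule sum_mset_rotate)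
    show "concat (map (\<lambda>i. concat (map (\<lambda>j. concat (map (\<lambda>k. map (?F i j k) E) (gam h))) (gam g))) E) \<in> lists LL"
      using mem mem' by (intro concat_map_in_lists) (auto dest!: E_mem)
  qed
  also have "\<dots> = concat (map (\<lambda>j. concat (map (\<lambda>l. concat (map (\<lambda>k. map (\<lambda>i.
      (tL (fst l) \<cdot> fst j \<cdot> (tL (fst i) \<cdot> fst k), sL (snd l) \<cdot> snd j \<cdot> (sL (snd i) \<cdot> snd k))) E) (gam h))) E)) (gam g))"
    using mem mem' by (intro arg_cong[where f = concat] map_cong refl) (auto simp: L.m_assoc dest!: E_mem)
  also have "\<dots> = concat (map (\<lambda>(a, b). map (\<lambda>(c, d). (a \<cdot> c, b \<cdot> d)) (concat (map psi (gam h)))) (concat (map psi (gam g))))"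
    by (simp add: concat_map_concat_map case_prod_unfold psi_def comp_def)
      (simp add: map_concat comp_def)
  also have "fsum_eq LL TL \<dots> (concat (map (\<lambda>(a, b). map (\<lambda>(c, d). (a \<cdot> c, b \<cdot> d)) (cop h)) (cop g)))"
    by (rule tensor_mult_cong[OF algL fsum_eq.sym[OF comul_rep[OF g]] fsum_eq.sym[OF comul_rep[OF h]]])
  finally show "fsum_eq LL TL (cop (g \<cdot> h))
    (concat (map (\<lambda>(a, b). map (\<lambda>(c, d). (a \<cdot> c, b \<cdot> d)) (cop h)) (cop g)))" .
qed (use assms in simp)

section \<open>The counit axioms\<close>

abbreviation "eps x \<equiv> \<phi> (cL x)"

lemma eps_hom: "eps \<in> module_hom K L (base_module K)"
  by (rule module_hom_comp[OF Cou_hom[OF R.one_closed] phi_hom])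

lemma cL_mult: "x \<in> carrier L \<Longrightarrow> y \<in> carrier L \<Longrightarrow> cL (x \<cdot> y) = Cou L x (cL y)"
  by (simp add: Cou_mult)

lemma cL_src: "r \<in> carrier R \<Longrightarrow> x \<in> carrier L \<Longrightarrow> cL (sL r \<cdot> x) = r \<star> cL x"
  and cL_tgt: "r \<in> carrier R \<Longrightarrow> x \<in> carrier L \<Longrightarrow> cL (tL r \<cdot> x) = cL x \<star> r"
  by (simp_all add: cL_mult Cou_src Cou_tgt)

text \<open>Because \<open>cL (tL a \<cdot> m) = cL m \<star> a\<close>, the sum over
  \<open>e\<close> contracts to \<open>sL (cL m)\<close> in front of \<open>n\<close>, and what
  remains is the counit axiom \<open>cou_right\<close> over the base.\<close>

lemma counit_left:
  assumes x: "x \<in> carrier L"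
  shows "lsum L (map (\<lambda>(a, b). eps a \<odot>\<^bsub>L\<^esub> b) (cop x)) = x"
proof -
  have "lsum L (map (\<lambda>(a, b). eps a \<odot>\<^bsub>L\<^esub> b) (cop x)) =
      lsum L (map (\<lambda>(m, n). lsum L (map (\<lambda>(a, b). eps (tL a \<cdot> m) \<odot>\<^bsub>L\<^esub> (sL b \<cdot> n)) E)) (gam x))"
    by (rule comul_lsum[OF modL bilinear_smult[OF field modL modL eps_hom module_hom_id] x])
  also have "\<dots> = lsum L (map (\<lambda>(m, n). sL (cL m) \<cdot> n) (gam x))"
  proof (intro arg_cong[where f = "lsum L"] map_pair_cong)
    fix m n assume "(m, n) \<in> set (gam x)"
    then have mn: "m \<in> carrier L" "n \<in> carrier L" using gam_mem x by auto
    have "lsum L (map (\<lambda>(a, b). \<phi> (cL m \<star> a) \<odot>\<^bsub>L\<^esub> (sL b \<cdot> n)) E) = sL (cL m) \<cdot> n"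
      using mn by (intro frob_lsum_left[OF modL module_hom_comp[OF src_hom k_algebra_mult_right[OF algL]]]) auto
    moreover have "map (\<lambda>(a, b). eps (tL a \<cdot> m) \<odot>\<^bsub>L\<^esub> (sL b \<cdot> n)) E = map (\<lambda>(a, b). \<phi> (cL m \<star> a) \<odot>\<^bsub>L\<^esub> (sL b \<cdot> n)) E"
      using mn by (intro map_pair_cong) (auto simp: cL_tgt dest!: E_mem)
    ultimately show "lsum L (map (\<lambda>(a, b). eps (tL a \<cdot> m) \<odot>\<^bsub>L\<^esub> (sL b \<cdot> n)) E) = sL (cL m) \<cdot> n"
      by (simp only:)
  qed
  also have "\<dots> = x" by (rule cou_right[OF x])
  finally show ?thesis .
qed

lemma counit_right:
  assumes x: "x \<in> carrier L"
  shows "lsum L (map (\<lambda>(a, b). eps b \<odot>\<^bsub>L\<^esub> a) (cop x)) = x"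
proof -
  have "lsum L (map (\<lambda>(a, b). eps b \<odot>\<^bsub>L\<^esub> a) (cop x)) =
      lsum L (map (\<lambda>(m, n). lsum L (map (\<lambda>(a, b). eps (sL b \<cdot> n) \<odot>\<^bsub>L\<^esub> (tL a \<cdot> m)) E)) (gam x))"
    by (rule comul_lsum[OF modL bilinear_map_flip[OF bilinear_smult[OF field modL modL eps_hom module_hom_id]] x])
  also have "\<dots> = lsum L (map (\<lambda>(m, n). tL (cL n) \<cdot> m) (gam x))"
  proof (intro arg_cong[where f = "lsum L"] map_pair_cong)
    fix m n assume "(m, n) \<in> set (gam x)"
    then have mn: "m \<in> carrier L" "n \<in> carrier L" using gam_mem x by auto
    have "lsum L (map (\<lambda>(a, b). \<phi> (b \<star> cL n) \<odot>\<^bsub>L\<^esub> (tL a \<cdot> m)) E) = tL (cL n) \<cdot> m"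
      using mn by (intro frob_lsum_right[OF modL module_hom_comp[OF tgt_hom k_algebra_mult_right[OF algL]]]) auto
    moreover have "map (\<lambda>(a, b). eps (sL b \<cdot> n) \<odot>\<^bsub>L\<^esub> (tL a \<cdot> m)) E = map (\<lambda>(a, b). \<phi> (b \<star> cL n) \<odot>\<^bsub>L\<^esub> (tL a \<cdot> m)) E"
      using mn by (intro map_pair_cong) (auto simp: cL_src dest!: E_mem)
    ultimately show "lsum L (map (\<lambda>(a, b). eps (sL b \<cdot> n) \<odot>\<^bsub>L\<^esub> (tL a \<cdot> m)) E) = tL (cL n) \<cdot> m"
      by (simp only:)
  qed
  also have "\<dots> = x" by (rule cou_left[OF x])
  finally show ?thesis .
qed

lemmas modK = module_base_module[OF field]

lemma lsum_hom_gam: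
  assumes "\<Phi> \<in> module_hom K L (base_module K)" "\<And>m n. (m, n) \<in> set xs \<Longrightarrow> f m n \<in> carrier L"
  shows "lsum K (map (\<lambda>(m, n). \<Phi> (f m n)) xs) = \<Phi> (lsum L (map (\<lambda>(m, n). f m n) xs))"
proof -
  have "\<Phi> (lsum L (map (\<lambda>(m, n). f m n) xs)) = lsum (base_module K) (map \<Phi> (map (\<lambda>(m, n). f m n) xs))"
    using assms(2) by (intro module_hom_lsum[OF modL modK assms(1)]) auto
  then show ?thesis by (simp add: case_prod_unfold comp_def)
qed

text \<open>The linear form in which both counit identities end. Its argument stands for the middle
  factor \<open>g\<close>, which a counit axiom over the base recovers from
  \<open>Gam L g\<close>.\<close>

lemma counit_mult_hom:
  assumes f: "f \<in> carrier L" and h: "h \<in> carrier L"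
  shows "(\<lambda>z. \<phi> (Cou L f (cL (z \<cdot> h)))) \<in> module_hom K L (base_module K)"
  by (rule module_hom_comp[OF module_hom_comp[OF module_hom_comp[OF k_algebra_mult_right[OF algL h]
        Cou_hom[OF R.one_closed]] Cou_hom'[OF f]] phi_hom])

text \<open>The counit need not be multiplicative, but \<open>Cou L\<close> is. It makes the two
  values \<open>\<phi> (Cou L f (cL m \<star> a))\<close> and
  \<open>\<phi> (b \<star> cL (n \<cdot> h))\<close>; contracting \<open>e\<close> puts
  \<open>cL (n \<cdot> h)\<close> in the place of \<open>a\<close>, and \<open>cou_right\<close>
  reassembles \<open>g\<close>.\<close>

lemma counit_mult_1:
  assumes f: "f \<in> carrier L" and g: "g \<in> carrier L" and h: "h \<in> carrier L"
  shows "eps (f \<cdot> g \<cdot> h) =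
    lsum K (map (\<lambda>(a, b). eps (f \<cdot> a) \<otimes>\<^bsub>K\<^esub> eps (b \<cdot> h)) (cop g))"
proof -
  let ?\<Phi> = "\<lambda>z. \<phi> (Cou L f (cL (z \<cdot> h)))"
  have bil: "bilinear_map K L L (base_module K) (\<lambda>a b. eps (f \<cdot> a) \<otimes>\<^bsub>K\<^esub> eps (b \<cdot> h))"
    using bilinear_smult[OF field modL modK
        module_hom_comp[OF k_algebra_mult_left[OF algL f] eps_hom]
        module_hom_comp[OF k_algebra_mult_right[OF algL h] eps_hom]] by simp
  have "lsum K (map (\<lambda>(a, b). eps (f \<cdot> a) \<otimes>\<^bsub>K\<^esub> eps (b \<cdot> h)) (cop g)) =
    lsum K (map (\<lambda>(m, n). lsum K (map (\<lambda>(a, b). eps (f \<cdot> (tL a \<cdot> m)) \<otimes>\<^bsub>K\<^esub> eps (sL b \<cdot> n \<cdot> h)) E)) (gam g))"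
    using comul_lsum[OF modK bil g] by simp
  also have "\<dots> = lsum K (map (\<lambda>(m, n). ?\<Phi> (sL (cL m) \<cdot> n)) (gam g))"
  proof (intro arg_cong[where f = "lsum K"] map_pair_cong)
    fix m n assume "(m, n) \<in> set (gam g)"
    then have mn: "m \<in> carrier L" "n \<in> carrier L" using gam_mem g by auto
    have hom: "(\<lambda>r. \<phi> (Cou L f (cL m \<star> r))) \<in> module_hom K R (base_module K)"
      using mn by (intro module_hom_comp[OF module_hom_comp[OF k_algebra_mult_left[OF alg]
        Cou_hom'[OF f]] phi_hom]) simp
    have 1: "map (\<lambda>(a, b). eps (f \<cdot> (tL a \<cdot> m)) \<otimes>\<^bsub>K\<^esub> eps (sL b \<cdot> n \<cdot> h)) E =
        map (\<lambda>(a, b). \<phi> (b \<star> cL (n \<cdot> h)) \<otimes>\<^bsub>K\<^esub> \<phi> (Cou L f (cL m \<star> a))) E"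
      using mn f h by (intro map_pair_cong)
        (auto simp: cL_mult[of f] cL_src cL_tgt L.m_assoc RM.R.m_comm dest!: E_mem)
    have 2: "lsum K (map (\<lambda>(a, b). \<phi> (b \<star> cL (n \<cdot> h)) \<otimes>\<^bsub>K\<^esub> \<phi> (Cou L f (cL m \<star> a))) E) =
        \<phi> (Cou L f (cL m \<star> cL (n \<cdot> h)))"
      using frob_lsum_right[OF modK hom, of "cL (n \<cdot> h)"] mn h by simp
    show "lsum K (map (\<lambda>(a, b). eps (f \<cdot> (tL a \<cdot> m)) \<otimes>\<^bsub>K\<^esub> eps (sL b \<cdot> n \<cdot> h)) E) = ?\<Phi> (sL (cL m) \<cdot> n)"
      unfolding 1 2 using mn h by (simp add: L.m_assoc cL_src)
  qed
  also have "\<dots> = ?\<Phi> (lsum L (map (\<lambda>(m, n). sL (cL m) \<cdot> n) (gam g)))"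
    using gam_mem[OF _ g] by (intro lsum_hom_gam counit_mult_hom f h) auto
  also have "\<dots> = eps (f \<cdot> g \<cdot> h)"
    using f g h by (simp add: cou_right[OF g] L.m_assoc cL_mult[of f])
  finally show ?thesis ..
qed

text \<open>With the legs exchanged, the other Frobenius identity contracts \<open>e\<close>: now
  \<open>cL (m \<cdot> h)\<close> takes the place of \<open>b\<close>, and \<open>cou_left\<close>
  reassembles \<open>g\<close>.\<close>

lemma counit_mult_2:
  assumes f: "f \<in> carrier L" and g: "g \<in> carrier L" and h: "h \<in> carrier L"
  shows "eps (f \<cdot> g \<cdot> h) =
    lsum K (map (\<lambda>(a, b). eps (f \<cdot> b) \<otimes>\<^bsub>K\<^esub> eps (a \<cdot> h)) (cop g))"
proof -
  let ?\<Phi> = "\<lambda>z. \<phi> (Cou L f (cL (z \<cdot> h)))"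
  have bil: "bilinear_map K L L (base_module K) (\<lambda>a b. eps (f \<cdot> b) \<otimes>\<^bsub>K\<^esub> eps (a \<cdot> h))"
    using bilinear_map_flip[OF bilinear_smult[OF field modL modK
        module_hom_comp[OF k_algebra_mult_left[OF algL f] eps_hom]
        module_hom_comp[OF k_algebra_mult_right[OF algL h] eps_hom]]] by simp
  have "lsum K (map (\<lambda>(a, b). eps (f \<cdot> b) \<otimes>\<^bsub>K\<^esub> eps (a \<cdot> h)) (cop g)) =
    lsum K (map (\<lambda>(m, n). lsum K (map (\<lambda>(a, b). eps (f \<cdot> (sL b \<cdot> n)) \<otimes>\<^bsub>K\<^esub> eps (tL a \<cdot> m \<cdot> h)) E)) (gam g))"
    using comul_lsum[OF modK bil g] by simp
  also have "\<dots> = lsum K (map (\<lambda>(m, n). ?\<Phi> (tL (cL n) \<cdot> m)) (gam g))"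
  proof (intro arg_cong[where f = "lsum K"] map_pair_cong)
    fix m n assume "(m, n) \<in> set (gam g)"
    then have mn: "m \<in> carrier L" "n \<in> carrier L" using gam_mem g by auto
    have hom: "(\<lambda>r. \<phi> (Cou L f (r \<star> cL n))) \<in> module_hom K R (base_module K)"
      using mn by (intro module_hom_comp[OF module_hom_comp[OF k_algebra_mult_right[OF alg]
        Cou_hom'[OF f]] phi_hom]) simp
    have 1: "map (\<lambda>(a, b). eps (f \<cdot> (sL b \<cdot> n)) \<otimes>\<^bsub>K\<^esub> eps (tL a \<cdot> m \<cdot> h)) E =
        map (\<lambda>(a, b). \<phi> (cL (m \<cdot> h) \<star> a) \<otimes>\<^bsub>K\<^esub> \<phi> (Cou L f (b \<star> cL n))) E"
      using mn f h by (intro map_pair_cong)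
        (auto simp: cL_mult[of f] cL_src cL_tgt L.m_assoc RM.R.m_comm dest!: E_mem)
    have 2: "lsum K (map (\<lambda>(a, b). \<phi> (cL (m \<cdot> h) \<star> a) \<otimes>\<^bsub>K\<^esub> \<phi> (Cou L f (b \<star> cL n))) E) =
        \<phi> (Cou L f (cL (m \<cdot> h) \<star> cL n))"
      using frob_lsum_left[OF modK hom, of "cL (m \<cdot> h)"] mn h by simp
    show "lsum K (map (\<lambda>(a, b). eps (f \<cdot> (sL b \<cdot> n)) \<otimes>\<^bsub>K\<^esub> eps (tL a \<cdot> m \<cdot> h)) E) = ?\<Phi> (tL (cL n) \<cdot> m)"
      unfolding 1 2 using mn h by (simp add: L.m_assoc cL_tgt)
  qed
  also have "\<dots> = ?\<Phi> (lsum L (map (\<lambda>(m, n). tL (cL n) \<cdot> m) (gam g)))"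
    using gam_mem[OF _ g] by (intro lsum_hom_gam counit_mult_hom f h) auto
  also have "\<dots> = eps (f \<cdot> g \<cdot> h)"
    using f g h by (simp add: cou_left[OF g] L.m_assoc cL_mult[of f])
  finally show ?thesis ..
qed

section \<open>The coproduct of the unit and its iterate\<close>

lemma comul_emb:
  assumes "r \<in> carrier R" "s \<in> carrier R"
  shows "fsum_eq LL TL (cop (emb L r s)) (map (\<lambda>(a, b). (tL a \<cdot> sL r, sL b \<cdot> tL s)) E)"
  using comul_rep_eq[OF _ gam_emb[OF assms]] assms by (simp add: emb_eq)

lemma comul_one: "fsum_eq LL TL (cop \<one>\<^bsub>L\<^esub>) (map (\<lambda>(a, b). (tL a, sL b)) E)"
proof -
  have 1: "emb L \<one>\<^bsub>R\<^esub> \<one>\<^bsub>R\<^esub> = \<one>\<^bsub>L\<^esub>" using src_one by (simp add: src_def)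
  have 2: "map (\<lambda>(a, b). (tL a \<cdot> sL \<one>\<^bsub>R\<^esub>, sL b \<cdot> tL \<one>\<^bsub>R\<^esub>)) E = map (\<lambda>(a, b). (tL a, sL b)) E"
    by (intro map_pair_cong) (auto simp: src_one tgt_one dest!: E_mem)
  show ?thesis using comul_emb[OF R.one_closed R.one_closed] unfolding 1 2 .
qed

lemma comul_tgt:
  assumes s: "s \<in> carrier R"
  shows "fsum_eq LL TL (cop (tL s)) (map (\<lambda>(a, b). (tL a, sL b \<cdot> tL s)) E)"
proof -
  have 1: "emb L \<one>\<^bsub>R\<^esub> s = tL s" by (simp add: tgt_def)
  have 2: "map (\<lambda>(a, b). (tL a \<cdot> sL \<one>\<^bsub>R\<^esub>, sL b \<cdot> tL s)) E = map (\<lambda>(a, b). (tL a, sL b \<cdot> tL s)) E"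
    using s by (intro map_pair_cong) (auto simp: src_one dest!: E_mem)
  show ?thesis using comul_emb[OF R.one_closed s] unfolding 1 2 .
qed

text \<open>The coproduct of the unit is the sum of \<open>tL c \<otimes> sL d\<close>, and that of
  \<open>tL c\<close> keeps \<open>tL c\<close> on its second leg. So the two copies of
  \<open>e\<close> meet in the middle factor, as they do in the products of the next lemma.\<close>

lemma comul_one_iterated:
  "fsum_eq LLL TTL
    (comul_left (comul W) (cop \<one>\<^bsub>L\<^esub>))
    (concat (map (\<lambda>(a, b). map (\<lambda>(c, d). (tL a, sL b \<cdot> tL c, sL d)) E) E))"
proof -
  let ?f = "\<lambda>(m, n). map (\<lambda>(a, b). (a, b, n)) (cop m)"
  have "fsum_eq LLL TTL (concat (map ?f (cop \<one>\<^bsub>L\<^esub>))) (concat (map ?f (map (\<lambda>(a, b). (tL a, sL b)) E)))"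
    by (rule fsum_hom_eq[OF W_left_hom comul_one])
  also have "concat (map ?f (map (\<lambda>(a, b). (tL a, sL b)) E)) =
      concat (map (\<lambda>(c, d). map (\<lambda>(a, b). (a, b, sL d)) (cop (tL c))) E)"
    by (simp add: case_prod_unfold comp_def)
  also have "fsum_eq LLL TTL \<dots> (concat (map (\<lambda>(c, d). map (\<lambda>(a, b). (tL a, sL b \<cdot> tL c, sL d)) E) E))"
  proof (rule fsum_eq_concat_pair_cong)
    fix c d assume "(c, d) \<in> set E"
    then have cd: "c \<in> carrier R" "d \<in> carrier R" using E_mem by auto
    have "map (\<lambda>(a, b). (a, b, sL d)) (map (\<lambda>(a, b). (tL a, sL b \<cdot> tL c)) E) =
        map (\<lambda>(a, b). (tL a, sL b \<cdot> tL c, sL d)) E"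
      by (simp add: case_prod_unfold)
    then show "fsum_eq LLL TTL (map (\<lambda>(a, b). (a, b, sL d)) (cop (tL c)))
        (map (\<lambda>(a, b). (tL a, sL b \<cdot> tL c, sL d)) E)"
      using triple_left[OF src_closed[OF cd(2)] comul_tgt[OF cd(1)]] by (simp only:)
  qed
  also have "fsum_eq LLL TTL \<dots> (concat (map (\<lambda>(a, b). map (\<lambda>(c, d). (tL a, sL b \<cdot> tL c, sL d)) E) E))"
    by (rule fsum_eq_swap_pair) (auto dest!: E_mem)
  finally show ?thesis .
qed

text \<open>The middle factor is a product of a source and a target element. These commute, so both
  orders allowed for \<open>f\<close> give the same value.\<close>

lemma comul_one_product:
  assumes f: "f = mult L \<or> f = (\<lambda>b c. c \<cdot> b)"
  shows "fsum_eq LLL TTL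
    (concat (map (\<lambda>(a, b). map (\<lambda>(c, d). (a, f b c, d)) (cop \<one>\<^bsub>L\<^esub>)) (cop \<one>\<^bsub>L\<^esub>)))
    (concat (map (\<lambda>(a, b). map (\<lambda>(c, d). (tL a, sL b \<cdot> tL c, sL d)) E) E))"
proof -
  have "fsum_eq LLL TTL
    (concat (map (\<lambda>(a, b). map (\<lambda>(c, d). (a, f b c, d)) (cop \<one>\<^bsub>L\<^esub>)) (cop \<one>\<^bsub>L\<^esub>)))
    (concat (map (\<lambda>(a, b). map (\<lambda>(c, d). (a, f b c, d)) (map (\<lambda>(a, b). (tL a, sL b)) E))
      (map (\<lambda>(a, b). (tL a, sL b)) E)))"
    by (rule triple_mult_cong[OF algL f comul_one comul_one])
  also have "\<dots> = concat (map (\<lambda>(a, b). map (\<lambda>(c, d). (tL a, f (sL b) (tL c), sL d)) E) E)"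
    by (simp add: case_prod_unfold comp_def)
  also have "\<dots> = concat (map (\<lambda>(a, b). map (\<lambda>(c, d). (tL a, sL b \<cdot> tL c, sL d)) E) E)"
    using f by (intro arg_cong[where f = concat] map_pair_cong) (auto simp: src_tgt_commute dest!: E_mem)
  finally show ?thesis .
qed

theorem weak_bialgebra_corresponding_wb: "weak_bialgebra K W"
  unfolding weak_bialgebra_def Let_def corresponding_wb_simps tensor_rels_corresponding_wb
    lsum_corresponding_wb tensor_class_def
proof (intro conjI ballI)
  show "k_algebra K W" by (rule k_algebra_corresponding_wb[OF algL])
  show "linear_into K W TL (comul W)"
    using comul_linear by (simp add: linear_into_def)
  show "coassociative W TL (comul W)" by (rule comul_coassociative)
  show "eps \<in> module_hom K W (base_module K)"
    using eps_hom by (simp add: module_hom_def)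
  fix x assume x: "x \<in> carrier L"
  show "lsum L (map (\<lambda>(a, b). eps a \<odot>\<^bsub>L\<^esub> b) (cop x)) = x"
    "lsum L (map (\<lambda>(a, b). eps b \<odot>\<^bsub>L\<^esub> a) (cop x)) = x"
    using x by (rule counit_left counit_right)+
next
  fix g h assume "g \<in> carrier L" "h \<in> carrier L"
  then show "comul W (g \<cdot> h) = fsum_class LL TL
      (concat (map (\<lambda>(a, b). map (\<lambda>(c, d). (a \<cdot> c, b \<cdot> d)) (cop h)) (cop g)))"
    by (rule comul_mult)
next
  fix f g h assume *: "f \<in> carrier L" "g \<in> carrier L" "h \<in> carrier L"
  show "eps (f \<cdot> g \<cdot> h) =
    lsum K (map (\<lambda>(a, b). eps (f \<cdot> a) \<otimes>\<^bsub>K\<^esub> eps (b \<cdot> h)) (cop g))"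
    "eps (f \<cdot> g \<cdot> h) =
    lsum K (map (\<lambda>(a, b). eps (f \<cdot> b) \<otimes>\<^bsub>K\<^esub> eps (a \<cdot> h)) (cop g))"
    using * by (rule counit_mult_1 counit_mult_2)+
next
  let ?D = "cop \<one>\<^bsub>L\<^esub>"
  show "fsum_eq LLL TTL (comul_left (comul W) ?D)
     (concat (map (\<lambda>(a, b). map (\<lambda>(c, d). (a, b \<cdot> c, d)) ?D) ?D))"
    by (rule fsum_eq.trans[OF comul_one_iterated fsum_eq.sym[OF comul_one_product]]) simp
  show "fsum_eq LLL TTL (comul_left (comul W) ?D)
     (concat (map (\<lambda>(a, b). map (\<lambda>(c, d). (a, c \<cdot> b, d)) ?D) ?D))"
    by (rule fsum_eq.trans[OF comul_one_iterated fsum_eq.sym[OF comul_one_product]]) simp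
qed

end


section \<open>Transport along isomorphisms\<close>

text \<open>\<open>zero\<close> is a separate assumption because a map in \<open>module_hom\<close>
  is known to preserve zero only when its target is known to be a module, which for \<open>B\<close>
  is part of the claim.\<close>

lemma k_algebra_transport:
  assumes A: "k_algebra K A" and bij: "bij_betw F (carrier A) (carrier B)"
    and hom: "F \<in> module_hom K A B"
    and mult: "\<And>x y. x \<in> carrier A \<Longrightarrow> y \<in> carrier A \<Longrightarrow> F (x \<otimes>\<^bsub>A\<^esub> y) = F x \<otimes>\<^bsub>B\<^esub> F y"
    and one: "F \<one>\<^bsub>A\<^esub> = \<one>\<^bsub>B\<^esub>" and zero: "F \<zero>\<^bsub>A\<^esub> = \<zero>\<^bsub>B\<^esub>"
  shows "k_algebra K B"
proof -
  interpret A: ring A using A by (rule k_algebraD)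
  interpret AM: module K A using A by (rule k_algebraD)
  have carr: "carrier B = F ` carrier A" using bij by (simp add: bij_betw_def)
  note ops = mult[symmetric] one[symmetric] zero[symmetric] module_hom_add[OF hom, symmetric]
    module_hom_smult[OF hom, symmetric]
  have ab: "abelian_group B"
  proof (rule abelian_groupI)
    fix x assume "x \<in> carrier B"
    then obtain a where "a \<in> carrier A" "x = F a" by (auto simp: carr)
    then show "\<exists>y\<in>carrier B. y \<oplus>\<^bsub>B\<^esub> x = \<zero>\<^bsub>B\<^esub>"
      by (intro bexI[of _ "F (\<ominus>\<^bsub>A\<^esub> a)"]) (auto simp: ops A.l_neg carr)
  qed (auto simp: carr ops A.a_ac)
  have "ring B"
    by (rule ringI[OF ab monoidI]) (auto simp: carr ops A.m_assoc A.l_distr A.r_distr)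
  moreover have "module K B"
    by (rule moduleI[OF AM.is_cring ab])
      (auto simp: carr ops AM.smult_l_distr AM.smult_r_distr AM.smult_assoc1)
  ultimately show ?thesis
    using A by (auto simp: k_algebra_def vectorspace_def carr ops)
qed

text \<open>Of \<open>B\<close> nothing is known but that its operations agree with those of
  \<open>A\<close> along \<open>F\<close>; all its axioms are to be derived. In the application
  \<open>B\<close> is the opposite of the dual.\<close>

locale weak_bialgebra_transport =
  fixes K :: "('k, 'x) ring_scheme" and A :: "('k, 'a, 'm) bialg_scheme"
    and B :: "('k, 'b, 'n) bialg_scheme" and F :: "'a \<Rightarrow> 'b"
  assumes W: "weak_bialgebra K A" and bij: "bij_betw F (carrier A) (carrier B)"
    and hom: "F \<in> module_hom K A B"
    and mult: "x \<in> carrier A \<Longrightarrow> y \<in> carrier A \<Longrightarrow> F (x \<otimes>\<^bsub>A\<^esub> y) = F x \<otimes>\<^bsub>B\<^esub> F y"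
    and one: "F \<one>\<^bsub>A\<^esub> = \<one>\<^bsub>B\<^esub>" and zero: "F \<zero>\<^bsub>A\<^esub> = \<zero>\<^bsub>B\<^esub>"
    and comul: "x \<in> carrier A \<Longrightarrow>
      comul B (F x) = tensor_class K B B (map (\<lambda>(a, b). (F a, F b)) (rep (comul A x)))"
    and counit: "x \<in> carrier A \<Longrightarrow> counit B (F x) = counit A x"
begin

abbreviation mulA (infixl "\<cdot>" 70) where "x \<cdot> y \<equiv> x \<otimes>\<^bsub>A\<^esub> y"
abbreviation mulB (infixl "\<star>" 70) where "x \<star> y \<equiv> x \<otimes>\<^bsub>B\<^esub> y"
abbreviation "AA \<equiv> carrier A \<times> carrier A"
abbreviation "TA \<equiv> tensor_rels K A A"
abbreviation "BB \<equiv> carrier B \<times> carrier B"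
abbreviation "TB \<equiv> tensor_rels K B B"
abbreviation "BBB \<equiv> carrier B \<times> carrier B \<times> carrier B"
abbreviation "TTB \<equiv> triple_rels (carrier B) TB"
abbreviation "FF xs \<equiv> map (\<lambda>(a, b). (F a, F b)) xs"
abbreviation "FFF xs \<equiv> map (\<lambda>(a, b, c). (F a, F b, F c)) xs"
abbreviation "\<Delta> x \<equiv> rep (comul A x)"
abbreviation "\<Delta>' x \<equiv> rep (comul B x)"

lemma algA: "k_algebra K A"
  using W by (simp add: weak_bialgebra_def)

lemma algB: "k_algebra K B"
  by (rule k_algebra_transport[OF algA bij hom mult one zero])

lemmas modA = k_algebraD(1)[OF algA] and modB = k_algebraD(1)[OF algB]
  and field = k_algebraD(3)[OF algA]
lemmas modK = module_base_module[OF field]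

lemma carr: "carrier B = F ` carrier A"
  using bij by (simp add: bij_betw_def)

lemma F_closed [simp]: "x \<in> carrier A \<Longrightarrow> F x \<in> carrier B"
  by (simp add: carr)

lemma linA: "linear_into K A TA (comul A)"
  using W by (simp add: weak_bialgebra_def)

lemma A_mem: "(a, b) \<in> set (\<Delta> x) \<Longrightarrow> x \<in> carrier A \<Longrightarrow> a \<in> carrier A \<and> b \<in> carrier A"
  using lists_pair_mem[OF linear_intoD(1)[OF linA]] .

lemmas FF_hom = tensor_hom[OF modA modA modB modB hom hom]
lemmas FF_eq = fsum_hom_map_pair[OF FF_hom]

lemma FF_lists: "zs \<in> lists AA \<Longrightarrow> FF zs \<in> lists BB"
  using fsum_eq_lists[OF FF_eq[OF fsum_eq.refl]] by blast

lemma comul_rep: "x \<in> carrier A \<Longrightarrow> fsum_eq BB TB (\<Delta>' (F x)) (FF (\<Delta> x))"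
  using comul[of x] linear_intoD(1)[OF linA]
  by (intro fsum_eq_rep_classD FF_lists) (simp_all add: tensor_class_def)

lemma comul_class:
  assumes "x \<in> carrier A" "fsum_eq BB TB (FF (\<Delta> x)) zs"
  shows "comul B (F x) = fsum_class BB TB zs"
  unfolding comul[OF assms(1)] tensor_class_def
  using assms(2) fsum_eq_lists[OF assms(2)] by (subst fsum_class_eq_iff) simp_all

lemma comul_linear: "linear_into K B TB (comul B)"
  unfolding linear_into_def
proof (intro conjI ballI)
  fix x' assume "x' \<in> carrier B"
  then obtain x where x: "x' = F x" "x \<in> carrier A" by (auto simp: carr)
  show "comul B x' \<in> fsum_quot BB TB"
    unfolding x(1) comul[OF x(2)] tensor_class_def
    by (intro fsum_class_in_quot FF_lists linear_intoD(1)[OF linA] x)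
  fix y' assume "y' \<in> carrier B"
  then obtain y where y: "y' = F y" "y \<in> carrier A" by (auto simp: carr)
  have "fsum_eq BB TB (FF (\<Delta> (x \<oplus>\<^bsub>A\<^esub> y))) (FF (\<Delta> x @ \<Delta> y))"
    by (intro FF_eq linear_intoD(2)[OF linA] x y)
  also have "FF (\<Delta> x @ \<Delta> y) = FF (\<Delta> x) @ FF (\<Delta> y)" by simp
  also have "fsum_eq BB TB \<dots> (\<Delta>' x' @ \<Delta>' y')"
    unfolding x(1) y(1)
    by (rule fsum_eq.append[OF fsum_eq.sym[OF comul_rep[OF x(2)]] fsum_eq.sym[OF comul_rep[OF y(2)]]])
  finally have "comul B (F (x \<oplus>\<^bsub>A\<^esub> y)) = fsum_class BB TB (\<Delta>' x' @ \<Delta>' y')"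
  proof (rule comul_class[rotated])
    interpret module K A by (rule modA)
    show "x \<oplus>\<^bsub>A\<^esub> y \<in> carrier A" using x y by simp
  qed
  then show "comul B (x' \<oplus>\<^bsub>B\<^esub> y') = fsum_class BB TB (\<Delta>' x' @ \<Delta>' y')"
    using x y by (simp add: module_hom_add[OF hom])
next
  fix c x' assume c: "c \<in> carrier K" and "x' \<in> carrier B"
  then obtain x where x: "x' = F x" "x \<in> carrier A" by (auto simp: carr)
  have "fsum_eq BB TB (FF (\<Delta> (c \<odot>\<^bsub>A\<^esub> x))) (FF (map (\<lambda>(a, b). (c \<odot>\<^bsub>A\<^esub> a, b)) (\<Delta> x)))"
    by (intro FF_eq linear_intoD(3)[OF linA] modA c x)
  also have "\<dots> = map (\<lambda>(a, b). (F (c \<odot>\<^bsub>A\<^esub> a), F b)) (\<Delta> x)"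
    by (simp add: case_prod_unfold)
  also have "\<dots> = map (\<lambda>(a, b). (c \<odot>\<^bsub>B\<^esub> F a, F b)) (\<Delta> x)"
    using A_mem[OF _ x(2)] c by (intro map_pair_cong) (auto simp: module_hom_smult[OF hom])
  also have "\<dots> = map (\<lambda>(a, b). (c \<odot>\<^bsub>B\<^esub> a, b)) (FF (\<Delta> x))"
    by (simp add: case_prod_unfold)
  also have "fsum_eq BB TB \<dots> (map (\<lambda>(a, b). (c \<odot>\<^bsub>B\<^esub> a, b)) (\<Delta>' x'))"
    unfolding x(1)
    by (rule fsum_hom_map_pair[OF tensor_hom[OF modB modB modB modB smult_hom[OF modB c] module_hom_id]
          fsum_eq.sym[OF comul_rep[OF x(2)]]])
  finally have "comul B (F (c \<odot>\<^bsub>A\<^esub> x)) = fsum_class BB TB (map (\<lambda>(a, b). (c \<odot>\<^bsub>B\<^esub> a, b)) (\<Delta>' x'))"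
  proof (rule comul_class[rotated])
    interpret module K A by (rule modA)
    show "c \<odot>\<^bsub>A\<^esub> x \<in> carrier A" using x c by simp
  qed
  then show "comul B (c \<odot>\<^bsub>B\<^esub> x') = fsum_class BB TB (map (\<lambda>(a, b). (c \<odot>\<^bsub>B\<^esub> a, b)) (\<Delta>' x'))"
    using x c by (simp add: module_hom_smult[OF hom])
qed

text \<open>This is \<open>F \<otimes> F \<otimes> F\<close> on threefold tensors. Each relation
  involves two neighbouring factors and so is covered by \<open>FF_eq\<close>.\<close>

lemma FFF_eq:
  assumes "fsum_eq (carrier A \<times> carrier A \<times> carrier A) (triple_rels (carrier A) TA) xs ys"
  shows "fsum_eq BBB TTB (FFF xs) (FFF ys)"
proof -
  have "fsum_hom (carrier A \<times> carrier A \<times> carrier A) (triple_rels (carrier A) TA) BBB TTB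
    (\<lambda>x. [(\<lambda>(a, b, c). (F a, F b, F c)) x])"
  proof (rule fsum_homI)
    fix xs ys assume *: "(xs, ys) \<in> triple_rels (carrier A) TA"
      "xs \<in> lists (carrier A \<times> carrier A \<times> carrier A)" "ys \<in> lists (carrier A \<times> carrier A \<times> carrier A)"
    from *(1) consider
      xs0 ys0 c where "(xs0, ys0) \<in> TA" "c \<in> carrier A"
        "xs = map (\<lambda>(a, b). (a, b, c)) xs0" "ys = map (\<lambda>(a, b). (a, b, c)) ys0"
    | xs0 ys0 c where "(xs0, ys0) \<in> TA" "c \<in> carrier A"
        "xs = map (\<lambda>(a, b). (c, a, b)) xs0" "ys = map (\<lambda>(a, b). (c, a, b)) ys0"
      unfolding triple_rels_def by blast
    then have "fsum_eq BBB TTB (FFF xs) (FFF ys)"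
    proof cases
      case 1
      then have "xs0 \<in> lists AA" "ys0 \<in> lists AA" using * by auto
      from triple_left[OF F_closed[OF 1(2)] FF_eq[OF fsum_eq.gen[OF 1(1) this]]]
      show ?thesis by (simp add: 1(3,4) case_prod_unfold comp_def)
    next
      case 2
      then have "xs0 \<in> lists AA" "ys0 \<in> lists AA" using * by auto
      from triple_right[OF F_closed[OF 2(2)] FF_eq[OF fsum_eq.gen[OF 2(1) this]]]
      show ?thesis by (simp add: 2(3,4) case_prod_unfold comp_def)
    qed
    then show "fsum_eq BBB TTB (concat (map (\<lambda>x. [(\<lambda>(a, b, c). (F a, F b, F c)) x]) xs))
        (concat (map (\<lambda>x. [(\<lambda>(a, b, c). (F a, F b, F c)) x]) ys))"
      by (simp only: concat_map_singleton)
  qed auto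
  from fsum_hom_map[OF this assms] show ?thesis .
qed

text \<open>Representatives are exchanged twice: once for the coproduct of \<open>F x\<close> as a
  whole, by \<open>comul_left_hom\<close>, and once for the coproduct of each of its left
  legs.\<close>

lemma iterated_left:
  assumes x: "x \<in> carrier A"
  shows "fsum_eq BBB TTB
    (comul_left (comul B) (\<Delta>' (F x)))
    (FFF (comul_left (comul A) (\<Delta> x)))"
proof -
  let ?f = "\<lambda>(m, n). map (\<lambda>(a, b). (a, b, n)) (\<Delta>' m)"
  have "fsum_eq BBB TTB (concat (map ?f (\<Delta>' (F x)))) (concat (map ?f (FF (\<Delta> x))))"
    by (rule fsum_hom_eq[OF comul_left_hom[OF modB comul_linear] comul_rep[OF x]])
  also have "concat (map ?f (FF (\<Delta> x))) = concat (map (\<lambda>(m, n). map (\<lambda>(a, b). (a, b, F n)) (\<Delta>' (F m))) (\<Delta> x))"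
    by (simp add: case_prod_unfold comp_def)
  also have "fsum_eq BBB TTB \<dots> (concat (map (\<lambda>(m, n). map (\<lambda>(a, b). (a, b, F n)) (FF (\<Delta> m))) (\<Delta> x)))"
  proof (rule fsum_eq_concat_pair_cong)
    fix m n assume "(m, n) \<in> set (\<Delta> x)"
    then have mn: "m \<in> carrier A" "n \<in> carrier A" using A_mem x by auto
    show "fsum_eq BBB TTB (map (\<lambda>(a, b). (a, b, F n)) (\<Delta>' (F m))) (map (\<lambda>(a, b). (a, b, F n)) (FF (\<Delta> m)))"
      by (rule triple_left[OF F_closed[OF mn(2)] comul_rep[OF mn(1)]])
  qed
  also have "\<dots> = FFF (comul_left (comul A) (\<Delta> x))"
    by (simp add: map_concat case_prod_unfold comp_def)
  finally show ?thesis .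
qed

lemma iterated_right:
  assumes x: "x \<in> carrier A"
  shows "fsum_eq BBB TTB
    (comul_right (comul B) (\<Delta>' (F x)))
    (FFF (comul_right (comul A) (\<Delta> x)))"
proof -
  let ?f = "\<lambda>(m, n). map (\<lambda>(a, b). (m, a, b)) (\<Delta>' n)"
  have "fsum_eq BBB TTB (concat (map ?f (\<Delta>' (F x)))) (concat (map ?f (FF (\<Delta> x))))"
    by (rule fsum_hom_eq[OF comul_right_hom[OF modB comul_linear] comul_rep[OF x]])
  also have "concat (map ?f (FF (\<Delta> x))) = concat (map (\<lambda>(m, n). map (\<lambda>(a, b). (F m, a, b)) (\<Delta>' (F n))) (\<Delta> x))"
    by (simp add: case_prod_unfold comp_def)
  also have "fsum_eq BBB TTB \<dots> (concat (map (\<lambda>(m, n). map (\<lambda>(a, b). (F m, a, b)) (FF (\<Delta> n))) (\<Delta> x)))"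
  proof (rule fsum_eq_concat_pair_cong)
    fix m n assume "(m, n) \<in> set (\<Delta> x)"
    then have mn: "m \<in> carrier A" "n \<in> carrier A" using A_mem x by auto
    show "fsum_eq BBB TTB (map (\<lambda>(a, b). (F m, a, b)) (\<Delta>' (F n))) (map (\<lambda>(a, b). (F m, a, b)) (FF (\<Delta> n)))"
      by (rule triple_right[OF F_closed[OF mn(1)] comul_rep[OF mn(2)]])
  qed
  also have "\<dots> = FFF (comul_right (comul A) (\<Delta> x))"
    by (simp add: map_concat case_prod_unfold comp_def)
  finally show ?thesis .
qed

lemma comul_lsum:
  assumes P: "module K P" and f: "bilinear_map K B B P f" and x: "x \<in> carrier A"
  shows "lsum P (map (\<lambda>(a, b). f a b) (\<Delta>' (F x))) = lsum P (map (\<lambda>(a, b). f (F a) (F b)) (\<Delta> x))"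
  using tensor_lsum[OF modB modB P f comul_rep[OF x]] by (simp add: case_prod_unfold comp_def)

lemma mid_mult:
  assumes f: "(f = mult A \<and> f' = mult B) \<or>
      (f = (\<lambda>b c. c \<cdot> b) \<and> f' = (\<lambda>b c. c \<star> b))" and x: "x \<in> carrier A"
  shows "fsum_eq BBB TTB
    (concat (map (\<lambda>(a, b). map (\<lambda>(c, d). (a, f' b c, d)) (\<Delta>' (F x))) (\<Delta>' (F x))))
    (FFF (concat (map (\<lambda>(a, b). map (\<lambda>(c, d). (a, f b c, d)) (\<Delta> x)) (\<Delta> x))))"
proof -
  have "fsum_eq BBB TTB
    (concat (map (\<lambda>(a, b). map (\<lambda>(c, d). (a, f' b c, d)) (\<Delta>' (F x))) (\<Delta>' (F x))))
    (concat (map (\<lambda>(a, b). map (\<lambda>(c, d). (a, f' b c, d)) (FF (\<Delta> x))) (FF (\<Delta> x))))"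
    using f by (intro triple_mult_cong[OF algB _ comul_rep[OF x] comul_rep[OF x]]) auto
  also have "\<dots> = concat (map (\<lambda>(a, b). map (\<lambda>(c, d). (F a, f' (F b) (F c), F d)) (\<Delta> x)) (\<Delta> x))"
    by (simp add: case_prod_unfold comp_def)
  also have "\<dots> = concat (map (\<lambda>(a, b). map (\<lambda>(c, d). (F a, F (f b c), F d)) (\<Delta> x)) (\<Delta> x))"
    using f A_mem[OF _ x] by (intro arg_cong[where f = concat] map_pair_cong) (auto simp: mult)
  also have "\<dots> = FFF (concat (map (\<lambda>(a, b). map (\<lambda>(c, d). (a, f b c, d)) (\<Delta> x)) (\<Delta> x)))"
    by (simp add: map_concat case_prod_unfold comp_def)
  finally show ?thesis .
qed

lemma counit_hom: "counit B \<in> module_hom K B (base_module K)"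
proof (rule module_homI)
  have "counit A \<in> module_hom K A (base_module K)"
    using W by (simp add: weak_bialgebra_def)
  note h = module_hom_carrier[OF this] module_hom_add[OF this] module_hom_smult[OF this]
  interpret module K A by (rule modA)
  show "counit B x \<in> carrier (base_module K)" if "x \<in> carrier B" for x
    using that h(1) by (auto simp: carr counit)
  show "counit B (x \<oplus>\<^bsub>B\<^esub> y) = counit B x \<oplus>\<^bsub>base_module K\<^esub> counit B y"
    if "x \<in> carrier B" "y \<in> carrier B" for x y
    using that by (auto simp: carr counit h(2) simp flip: module_hom_add[OF hom])
  show "counit B (c \<odot>\<^bsub>B\<^esub> x) = c \<odot>\<^bsub>base_module K\<^esub> counit B x"
    if "c \<in> carrier K" "x \<in> carrier B" for c x
    using that by (auto simp: carr counit h(3) simp flip: module_hom_smult[OF hom])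
qed

lemma F_lsum: "(\<And>x. x \<in> set xs \<Longrightarrow> f x \<in> carrier A) \<Longrightarrow> lsum B (map (\<lambda>x. F (f x)) xs) = F (lsum A (map f xs))"
  by (subst module_hom_lsum[OF modA modB hom]) (auto simp: comp_def)

theorem weak_bialgebra: "weak_bialgebra K B"
proof -
  interpret A: ring A using algA by (rule k_algebraD)
  interpret AM: module K A by (rule modA)
  note W' = W[unfolded weak_bialgebra_def Let_def]
  have counitA: "x \<in> carrier A \<Longrightarrow> counit A x \<in> carrier K" for x
    using W' module_hom_carrier[of "counit A" K A "base_module K"] by simp
  show ?thesis
    unfolding weak_bialgebra_def Let_def
  proof (intro conjI ballI)
    show "coassociative B TB (comul B)"
      unfolding coassociative_def
    proof
      fix x' assume "x' \<in> carrier B"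
      then obtain x where x: "x' = F x" "x \<in> carrier A" by (auto simp: carr)
      have "fsum_eq (carrier A \<times> carrier A \<times> carrier A) (triple_rels (carrier A) TA)
        (comul_left (comul A) (\<Delta> x))
        (comul_right (comul A) (\<Delta> x))"
        using W' x by (simp add: coassociative_def)
      from fsum_eq.trans[OF fsum_eq.trans[OF iterated_left[OF x(2)] FFF_eq[OF this]]
          fsum_eq.sym[OF iterated_right[OF x(2)]]]
      show "fsum_eq BBB TTB
          (comul_left (comul B) (\<Delta>' x'))
          (comul_right (comul B) (\<Delta>' x'))"
        unfolding x(1) .
    qed
  next
    fix x' assume "x' \<in> carrier B"
    then obtain x where x: "x' = F x" "x \<in> carrier A" by (auto simp: carr)
    note mem = A_mem[OF _ x(2)]
    have "lsum B (map (\<lambda>(a, b). counit B a \<odot>\<^bsub>B\<^esub> b) (\<Delta>' x')) =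
        lsum B (map (\<lambda>(a, b). counit B (F a) \<odot>\<^bsub>B\<^esub> F b) (\<Delta> x))"
      unfolding x(1)
      by (rule comul_lsum[OF modB bilinear_smult[OF field modB modB counit_hom module_hom_id] x(2)])
    also have "map (\<lambda>(a, b). counit B (F a) \<odot>\<^bsub>B\<^esub> F b) (\<Delta> x) =
        map (\<lambda>z. F ((\<lambda>(a, b). counit A a \<odot>\<^bsub>A\<^esub> b) z)) (\<Delta> x)"
      using mem counitA by (auto simp: counit module_hom_smult[OF hom])
    also have "lsum B \<dots> = F (lsum A (map (\<lambda>(a, b). counit A a \<odot>\<^bsub>A\<^esub> b) (\<Delta> x)))"
      using mem counitA by (intro F_lsum) auto
    also have "\<dots> = x'"
      using W' x by simp
    finally show "lsum B (map (\<lambda>(a, b). counit B a \<odot>\<^bsub>B\<^esub> b) (\<Delta>' x')) = x'" .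
    have "lsum B (map (\<lambda>(a, b). counit B b \<odot>\<^bsub>B\<^esub> a) (\<Delta>' x')) =
        lsum B (map (\<lambda>(a, b). counit B (F b) \<odot>\<^bsub>B\<^esub> F a) (\<Delta> x))"
      unfolding x(1)
      by (rule comul_lsum[OF modB bilinear_map_flip[OF bilinear_smult[OF field modB modB counit_hom module_hom_id]] x(2)])
    also have "map (\<lambda>(a, b). counit B (F b) \<odot>\<^bsub>B\<^esub> F a) (\<Delta> x) =
        map (\<lambda>z. F ((\<lambda>(a, b). counit A b \<odot>\<^bsub>A\<^esub> a) z)) (\<Delta> x)"
      using mem counitA by (auto simp: counit module_hom_smult[OF hom])
    also have "lsum B \<dots> = F (lsum A (map (\<lambda>(a, b). counit A b \<odot>\<^bsub>A\<^esub> a) (\<Delta> x)))"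
      using mem counitA by (intro F_lsum) auto
    also have "\<dots> = x'"
      using W' x by simp
    finally show "lsum B (map (\<lambda>(a, b). counit B b \<odot>\<^bsub>B\<^esub> a) (\<Delta>' x')) = x'" .
  next
    fix g' h' assume "g' \<in> carrier B" "h' \<in> carrier B"
    then obtain g h where g: "g' = F g" "g \<in> carrier A" and h: "h' = F h" "h \<in> carrier A"
      by (auto simp: carr)
    let ?m = "concat (map (\<lambda>(a, b). map (\<lambda>(c, d). (a \<cdot> c, b \<cdot> d)) (\<Delta> h)) (\<Delta> g))"
    have "comul A (g \<cdot> h) = fsum_class AA TA ?m"
      using W' g h by (simp add: tensor_class_def)
    moreover have "?m \<in> lists AA"
      using A_mem[OF _ g(2)] A_mem[OF _ h(2)] by auto
    ultimately have "fsum_eq AA TA (\<Delta> (g \<cdot> h)) ?m"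
      by (rule fsum_eq_rep_classD)
    then have "fsum_eq BB TB (FF (\<Delta> (g \<cdot> h))) (FF ?m)"
      by (rule FF_eq)
    also have "FF ?m = concat (map (\<lambda>(a, b). map (\<lambda>(c, d). (F (a \<cdot> c), F (b \<cdot> d))) (\<Delta> h)) (\<Delta> g))"
      by (simp add: map_concat case_prod_unfold comp_def)
    also have "\<dots> = concat (map (\<lambda>(a, b). map (\<lambda>(c, d). (F a \<star> F c, F b \<star> F d)) (\<Delta> h)) (\<Delta> g))"
      using A_mem[OF _ g(2)] A_mem[OF _ h(2)]
      by (intro arg_cong[where f = concat] map_pair_cong) (auto simp: mult)
    also have "\<dots> = concat (map (\<lambda>(a, b). map (\<lambda>(c, d). (a \<star> c, b \<star> d)) (FF (\<Delta> h))) (FF (\<Delta> g)))"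
      by (simp add: case_prod_unfold comp_def)
    also have "fsum_eq BB TB \<dots>
        (concat (map (\<lambda>(a, b). map (\<lambda>(c, d). (a \<star> c, b \<star> d)) (\<Delta>' h')) (\<Delta>' g')))"
      unfolding g(1) h(1)
      by (rule tensor_mult_cong[OF algB fsum_eq.sym[OF comul_rep[OF g(2)]] fsum_eq.sym[OF comul_rep[OF h(2)]]])
    finally show "comul B (g' \<star> h') = tensor_class K B B
        (concat (map (\<lambda>(a, b). map (\<lambda>(c, d). (a \<star> c, b \<star> d)) (\<Delta>' h')) (\<Delta>' g')))"
      using comul_class[of "g \<cdot> h"] g h by (simp add: mult tensor_class_def)
  next
    fix f' g' h' assume "f' \<in> carrier B" "g' \<in> carrier B" "h' \<in> carrier B"
    then obtain f g h where f: "f' = F f" "f \<in> carrier A" and g: "g' = F g" "g \<in> carrier A"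
      and h: "h' = F h" "h \<in> carrier A"
      by (auto simp: carr)
    note mem = A_mem[OF _ g(2)]
    note bil = bilinear_smult[OF field modB modK
        module_hom_comp[OF k_algebra_mult_left[OF algB F_closed[OF f(2)]] counit_hom]
        module_hom_comp[OF k_algebra_mult_right[OF algB F_closed[OF h(2)]] counit_hom]]
    have "lsum K (map (\<lambda>(a, b). counit B (f' \<star> a) \<otimes>\<^bsub>K\<^esub> counit B (b \<star> h')) (\<Delta>' g')) =
        lsum K (map (\<lambda>(a, b). counit B (F f \<star> F a) \<otimes>\<^bsub>K\<^esub> counit B (F b \<star> F h)) (\<Delta> g))"
      unfolding f(1) g(1) h(1) using comul_lsum[OF modK bil g(2)] by simp
    also have "\<dots> = lsum K (map (\<lambda>(a, b). counit A (f \<cdot> a) \<otimes>\<^bsub>K\<^esub> counit A (b \<cdot> h)) (\<Delta> g))"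
      using mem f h by (intro arg_cong[where f = "lsum K"] map_pair_cong) (auto simp: counit simp flip: mult)
    also have "\<dots> = counit A (f \<cdot> g \<cdot> h)"
      using W' f g h by metis
    also have "\<dots> = counit B (f' \<star> g' \<star> h')"
      using f g h by (simp add: counit flip: mult)
    finally show "counit B (f' \<star> g' \<star> h') =
        lsum K (map (\<lambda>(a, b). counit B (f' \<star> a) \<otimes>\<^bsub>K\<^esub> counit B (b \<star> h')) (\<Delta>' g'))" ..
    have "lsum K (map (\<lambda>(a, b). counit B (f' \<star> b) \<otimes>\<^bsub>K\<^esub> counit B (a \<star> h')) (\<Delta>' g')) =
        lsum K (map (\<lambda>(a, b). counit B (F f \<star> F b) \<otimes>\<^bsub>K\<^esub> counit B (F a \<star> F h)) (\<Delta> g))"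
      unfolding f(1) g(1) h(1) using comul_lsum[OF modK bilinear_map_flip[OF bil] g(2)] by simp
    also have "\<dots> = lsum K (map (\<lambda>(a, b). counit A (f \<cdot> b) \<otimes>\<^bsub>K\<^esub> counit A (a \<cdot> h)) (\<Delta> g))"
      using mem f h by (intro arg_cong[where f = "lsum K"] map_pair_cong) (auto simp: counit simp flip: mult)
    also have "\<dots> = counit A (f \<cdot> g \<cdot> h)"
      using W' f g h by metis
    also have "\<dots> = counit B (f' \<star> g' \<star> h')"
      using f g h by (simp add: counit flip: mult)
    finally show "counit B (f' \<star> g' \<star> h') =
        lsum K (map (\<lambda>(a, b). counit B (f' \<star> b) \<otimes>\<^bsub>K\<^esub> counit B (a \<star> h')) (\<Delta>' g'))" ..
  next
    have A1: "fsum_eq (carrier A \<times> carrier A \<times> carrier A) (triple_rels (carrier A) TA)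
        (comul_left (comul A) (\<Delta> \<one>\<^bsub>A\<^esub>))
        (concat (map (\<lambda>(a, b). map (\<lambda>(c, d). (a, b \<cdot> c, d)) (\<Delta> \<one>\<^bsub>A\<^esub>)) (\<Delta> \<one>\<^bsub>A\<^esub>)))"
      and A2: "fsum_eq (carrier A \<times> carrier A \<times> carrier A) (triple_rels (carrier A) TA)
        (comul_left (comul A) (\<Delta> \<one>\<^bsub>A\<^esub>))
        (concat (map (\<lambda>(a, b). map (\<lambda>(c, d). (a, c \<cdot> b, d)) (\<Delta> \<one>\<^bsub>A\<^esub>)) (\<Delta> \<one>\<^bsub>A\<^esub>)))"
      using W' by simp_all
    note left = iterated_left[OF A.one_closed, unfolded one]
    have r1: "fsum_eq BBB TTB
        (concat (map (\<lambda>(a, b). map (\<lambda>(c, d). (a, b \<star> c, d)) (\<Delta>' \<one>\<^bsub>B\<^esub>)) (\<Delta>' \<one>\<^bsub>B\<^esub>)))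
        (FFF (concat (map (\<lambda>(a, b). map (\<lambda>(c, d). (a, b \<cdot> c, d)) (\<Delta> \<one>\<^bsub>A\<^esub>)) (\<Delta> \<one>\<^bsub>A\<^esub>))))"
      and r2: "fsum_eq BBB TTB
        (concat (map (\<lambda>(a, b). map (\<lambda>(c, d). (a, c \<star> b, d)) (\<Delta>' \<one>\<^bsub>B\<^esub>)) (\<Delta>' \<one>\<^bsub>B\<^esub>)))
        (FFF (concat (map (\<lambda>(a, b). map (\<lambda>(c, d). (a, c \<cdot> b, d)) (\<Delta> \<one>\<^bsub>A\<^esub>)) (\<Delta> \<one>\<^bsub>A\<^esub>))))"
      using mid_mult[of "mult A" "mult B" "\<one>\<^bsub>A\<^esub>"]
        mid_mult[of "\<lambda>b c. c \<cdot> b" "\<lambda>b c. c \<star> b" "\<one>\<^bsub>A\<^esub>"] by (simp_all add: one)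
    show "fsum_eq BBB TTB
        (comul_left (comul B) (\<Delta>' \<one>\<^bsub>B\<^esub>))
        (concat (map (\<lambda>(a, b). map (\<lambda>(c, d). (a, b \<star> c, d)) (\<Delta>' \<one>\<^bsub>B\<^esub>)) (\<Delta>' \<one>\<^bsub>B\<^esub>)))"
      by (rule fsum_eq.trans[OF fsum_eq.trans[OF left FFF_eq[OF A1]] fsum_eq.sym[OF r1]])
    show "fsum_eq BBB TTB
        (comul_left (comul B) (\<Delta>' \<one>\<^bsub>B\<^esub>))
        (concat (map (\<lambda>(a, b). map (\<lambda>(c, d). (a, c \<star> b, d)) (\<Delta>' \<one>\<^bsub>B\<^esub>)) (\<Delta>' \<one>\<^bsub>B\<^esub>)))"
      by (rule fsum_eq.trans[OF fsum_eq.trans[OF left FFF_eq[OF A2]] fsum_eq.sym[OF r2]])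
  qed (rule algB comul_linear counit_hom)+
qed

end


section \<open>The dual of a finite dimensional bialgebra\<close>

lemma dual_bialg_simps [simp]:
  "carrier (dual_bialg K A) = dual_space K A"
  "mult (dual_bialg K A) = mult (dual_module K A)"
  "one (dual_bialg K A) = (\<lambda>h\<in>carrier A. counit A h)"
  "zero (dual_bialg K A) = (\<lambda>h\<in>carrier A. \<zero>\<^bsub>K\<^esub>)"
  "add (dual_bialg K A) = (\<lambda>f g. \<lambda>h\<in>carrier A. f h \<oplus>\<^bsub>K\<^esub> g h)"
  "smult (dual_bialg K A) = (\<lambda>c f. \<lambda>h\<in>carrier A. c \<otimes>\<^bsub>K\<^esub> f h)"
  "counit (dual_bialg K A) = (\<lambda>f. f \<one>\<^bsub>A\<^esub>)"
  by (simp_all add: dual_bialg_def dual_module_def module.extend_def)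

lemma dual_module_simps [simp]:
  "carrier (dual_module K A) = dual_space K A"
  "mult (dual_module K A) = (\<lambda>f g. \<lambda>h\<in>carrier A. lsum K (map (\<lambda>(a, b). f a \<otimes>\<^bsub>K\<^esub> g b) (rep (comul A h))))"
  "zero (dual_module K A) = (\<lambda>h\<in>carrier A. \<zero>\<^bsub>K\<^esub>)"
  "add (dual_module K A) = (\<lambda>f g. \<lambda>h\<in>carrier A. f h \<oplus>\<^bsub>K\<^esub> g h)"
  "smult (dual_module K A) = (\<lambda>c f. \<lambda>h\<in>carrier A. c \<otimes>\<^bsub>K\<^esub> f h)"
  by (simp_all add: dual_module_def)

lemma op_bialg_simps [simp]:
  "carrier (op_bialg A) = carrier A"
  "mult (op_bialg A) = (\<lambda>x y. y \<otimes>\<^bsub>A\<^esub> x)"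
  "one (op_bialg A) = one A"
  "zero (op_bialg A) = zero A"
  "add (op_bialg A) = add A"
  "smult (op_bialg A) = smult A"
  "comul (op_bialg A) = comul A"
  "counit (op_bialg A) = counit A"
  by (simp_all add: op_bialg_def)

lemma dual_spaceD:
  assumes "f \<in> dual_space K A"
  shows "f \<in> module_hom K A (base_module K)" "f \<in> extensional (carrier A)"
    "x \<in> carrier A \<Longrightarrow> f x \<in> carrier K"
  using assms module_hom_carrier[of f K A "base_module K"] by (auto simp: dual_space_def)

lemma restrict_dual_space:
  assumes "module K A" "f \<in> module_hom K A (base_module K)"
  shows "restrict f (carrier A) \<in> dual_space K A"
proof -
  interpret module K A by fact
  have "restrict f (carrier A) \<in> module_hom K A (base_module K)"
    using assms(2) by (auto simp: module_hom_def)
  then show ?thesis by (simp add: dual_space_def)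
qed

text \<open>Basis elements and their coordinate functionals are kept as pairs in one list, so that
  the expansion is an \<open>lsum\<close> and fits the calculus of formal sums.\<close>

lemma dual_basis_exists:
  assumes V: "vectorspace K V" and findim: "vectorspace.fin_dim K V"
  obtains ps where "\<And>b f. (b, f) \<in> set ps \<Longrightarrow> b \<in> carrier V \<and> f \<in> module_hom K V (base_module K)"
    and "\<And>v. v \<in> carrier V \<Longrightarrow> v = lsum V (map (\<lambda>(b, f). f v \<odot>\<^bsub>V\<^esub> b) ps)"
proof -
  interpret vectorspace K V by fact
  from finite_basis_exists[OF findim] obtain B where "finite B \<and> basis B" ..
  then have B: "finite B" "basis B" by simp_all
  then have Bc: "B \<subseteq> carrier V" by (simp add: basis_def)
  have ex1: "\<exists>!a. a \<in> B \<rightarrow>\<^sub>E carrier K \<and> lincomb a B = v" if "v \<in> carrier V" for v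
    using basis_criterion[OF B(1) Bc] B(2) that by simp
  \<comment> \<open>Coordinates are unique as functions only if their values off \<open>B\<close>
    are fixed, hence the extensional function space.\<close>
  define cf where "cf v = (THE a. a \<in> B \<rightarrow>\<^sub>E carrier K \<and> lincomb a B = v)" for v
  have cf: "cf v \<in> B \<rightarrow>\<^sub>E carrier K" "lincomb (cf v) B = v" if "v \<in> carrier V" for v
    unfolding cf_def using theI'[OF ex1[OF that]] by (rule conjunct1, rule conjunct2)
  \<comment> \<open>Linearity of the coordinates follows by exhibiting coefficients for a sum or a
    scalar multiple; this accepts coefficient functions that are not extensional.\<close>
  have uniq: "cf v b = a b" if "a \<in> B \<rightarrow> carrier K" "lincomb a B = v" "v \<in> carrier V" "b \<in> B" for a v b
  proof -
    have "lincomb (restrict a B) B = v"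
      using that Bc by (subst lincomb_cong[of B B _ a]) auto
    moreover have "restrict a B \<in> B \<rightarrow>\<^sub>E carrier K"
      using that(1) by auto
    ultimately have "restrict a B = cf v"
      using ex1[OF that(3)] cf[OF that(3)] by blast
    then show ?thesis using that(4) by (auto dest: fun_cong[of _ _ b])
  qed
  have cfPi: "cf v \<in> B \<rightarrow> carrier K" if "v \<in> carrier V" for v
    using cf(1)[OF that] by auto
  have hom: "(\<lambda>v. cf v b) \<in> module_hom K V (base_module K)" if b: "b \<in> B" for b
  proof (rule module_homI)
    show "cf v b \<in> carrier (base_module K)" if "v \<in> carrier V" for v
      using cfPi[OF that] b by auto
    show "cf (v \<oplus>\<^bsub>V\<^esub> w) b = cf v b \<oplus>\<^bsub>base_module K\<^esub> cf w b" if "v \<in> carrier V" "w \<in> carrier V" for v w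
      using uniq[of "\<lambda>b. cf v b \<oplus>\<^bsub>K\<^esub> cf w b" "v \<oplus>\<^bsub>V\<^esub> w" b] that b cfPi[OF that(1)] cfPi[OF that(2)]
        lincomb_sum[OF B(1) Bc cfPi[OF that(1)] cfPi[OF that(2)]] cf(2)
      by (auto simp: Pi_iff)
    show "cf (c \<odot>\<^bsub>V\<^esub> v) b = c \<odot>\<^bsub>base_module K\<^esub> cf v b" if "c \<in> carrier K" "v \<in> carrier V" for c v
      using uniq[of "\<lambda>b. c \<otimes>\<^bsub>K\<^esub> cf v b" "c \<odot>\<^bsub>V\<^esub> v" b] that b cfPi[OF that(2)]
        lincomb_smult[OF Bc cfPi[OF that(2)] that(1)] cf(2)
      by (auto simp: Pi_iff)
  qed
  obtain bs where bs: "set bs = B" "distinct bs"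
    using finite_distinct_list[OF B(1)] by blast
  show ?thesis
  proof (rule that[of "map (\<lambda>b. (b, \<lambda>v. cf v b)) bs"])
    show "b \<in> carrier V \<and> f \<in> module_hom K V (base_module K)"
      if "(b, f) \<in> set (map (\<lambda>b. (b, \<lambda>v. cf v b)) bs)" for b f
      using that bs Bc hom by auto
    fix v assume v: "v \<in> carrier V"
    have "lsum V (map (\<lambda>b. cf v b \<odot>\<^bsub>V\<^esub> b) bs) = finsum V (\<lambda>b. cf v b \<odot>\<^bsub>V\<^esub> b) (set bs)"
      using bs Bc cfPi[OF v] by (intro M.lsum_finsum) auto
    also have "\<dots> = v"
      using cf(2)[OF v] by (simp add: lincomb_def bs)
    finally show "v = lsum V (map (\<lambda>(b, f). f v \<odot>\<^bsub>V\<^esub> b) (map (\<lambda>b. (b, \<lambda>v. cf v b)) bs))"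
      by (simp add: comp_def)
  qed
qed

text \<open>The canonical map from the tensor product of two duals to bilinear forms, evaluated at
  \<open>(g, h)\<close>. The comultiplication in \<open>dual_bialg\<close> is characterized by these
  values.\<close>

abbreviation pairing_sum :: "('k, 'x) ring_scheme \<Rightarrow> 'a \<Rightarrow> 'b \<Rightarrow> (('a \<Rightarrow> 'k) \<times> ('b \<Rightarrow> 'k)) list \<Rightarrow> 'k" where
  "pairing_sum K g h xs \<equiv> lsum K (map (\<lambda>(f1, f2). f1 g \<otimes>\<^bsub>K\<^esub> f2 h) xs)"

lemma dual_eval_hom:
  assumes "g \<in> carrier A"
  shows "(\<lambda>f. f g) \<in> module_hom K (dual_module K A) (base_module K)"
  using assms by (intro module_homI) (auto simp: dual_spaceD(3))

lemma dual_lsum_apply: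
  assumes "field K" "module K (dual_module K A)" "g \<in> carrier A" "\<And>x. x \<in> set xs \<Longrightarrow> f x \<in> dual_space K A"
  shows "lsum (dual_module K A) (map f xs) g = lsum K (map (\<lambda>x. f x g) xs)"
  using module_hom_lsum[OF assms(2) module_base_module[OF assms(1)] dual_eval_hom[OF assms(3)], of "map f xs"] assms(4)
  by (auto simp: comp_def)

text \<open>Expanding the second factor along a dual basis \<open>ps\<close> shows that an element of the tensor square
  of the dual is determined by its values on pairs.\<close>

lemma dual_tensor_eqI:
  fixes A :: "('k, 'a, 'm) bialg_scheme"
  assumes field: "field K" and A: "module K A" and D: "module K (dual_module K A)"
    and ps: "\<And>b f. (b, f) \<in> set ps \<Longrightarrow> b \<in> carrier A \<and> f \<in> dual_space K A"
    and basis: "\<And>x. x \<in> carrier A \<Longrightarrow> x = lsum A (map (\<lambda>(b, f). f x \<odot>\<^bsub>A\<^esub> b) ps)"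
    and xs: "xs \<in> lists (dual_space K A \<times> dual_space K A)" and ys: "ys \<in> lists (dual_space K A \<times> dual_space K A)"
    and eq: "\<And>g h. g \<in> carrier A \<Longrightarrow> h \<in> carrier A \<Longrightarrow>
      pairing_sum K g h xs = pairing_sum K g h ys"
  shows "fsum_eq (dual_space K A \<times> dual_space K A) (tensor_rels K (dual_module K A) (dual_module K A)) xs ys"
proof -
  let ?V = "dual_space K A"
  let ?D = "dual_module K A"
  let ?E = "fsum_eq (carrier ?D \<times> carrier ?D) (tensor_rels K ?D ?D)"
  interpret A: module K A by fact
  interpret D: module K ?D by fact
  note K = module_base_module[OF field]
  let ?e = "\<lambda>f. lsum ?D (map (\<lambda>(b, u). f b \<odot>\<^bsub>?D\<^esub> u) ps)"
  \<comment> \<open>The coordinate functionals span the dual: the coefficients of \<open>f\<close>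
    are its values at the basis elements.\<close>
  have expand: "f = ?e f" if f: "f \<in> ?V" for f
  proof (rule extensionalityI)
    have mem: "(\<lambda>(b, u). f b \<odot>\<^bsub>?D\<^esub> u) x \<in> ?V" if "x \<in> set ps" for x
      using D.smult_closed[of "f (fst x)" "snd x"] ps[of "fst x" "snd x"] that dual_spaceD(3)[OF f]
      by (simp add: case_prod_unfold)
    show "f \<in> extensional (carrier A)" by (rule dual_spaceD(2)[OF f])
    have "?e f \<in> carrier ?D"
      using mem by (intro D.M.lsum_closed) auto
    then show "?e f \<in> extensional (carrier A)"
      using dual_spaceD(2) by (metis dual_module_simps(1))
    fix x assume x: "x \<in> carrier A"
    have "?e f x = lsum K (map (\<lambda>z. (\<lambda>(b, u). f b \<odot>\<^bsub>?D\<^esub> u) z x) ps)"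
      by (rule dual_lsum_apply[OF field D x mem])
    also have "\<dots> = lsum K (map f (map (\<lambda>(b, u). u x \<odot>\<^bsub>A\<^esub> b) ps))"
      unfolding map_map
    proof (rule arg_cong[where f = "lsum K"], rule map_cong[OF HOL.refl])
      fix z assume "z \<in> set ps"
      moreover obtain b u where z: "z = (b, u)" by (cases z)
      ultimately have bu: "b \<in> carrier A" "u \<in> ?V" using ps by auto
      show "(\<lambda>(b, u). f b \<odot>\<^bsub>?D\<^esub> u) z x = (f \<circ> (\<lambda>(b, u). u x \<odot>\<^bsub>A\<^esub> b)) z"
        using x bu dual_spaceD(3)[OF bu(2)] dual_spaceD(3)[OF f]
        by (simp add: z module_hom_smult[OF dual_spaceD(1)[OF f]] A.R.m_comm)
    qed
    also have "\<dots> = f (lsum A (map (\<lambda>(b, u). u x \<odot>\<^bsub>A\<^esub> b) ps))"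
    proof -
      have "set (map (\<lambda>(b, u). u x \<odot>\<^bsub>A\<^esub> b) ps) \<subseteq> carrier A"
        by (auto dest!: ps intro!: A.smult_closed dual_spaceD(3)[OF _ x])
      from module_hom_lsum[OF A K dual_spaceD(1)[OF f] this] show ?thesis by simp
    qed
    also have "\<dots> = f x" by (rule arg_cong[OF basis[OF x, symmetric]])
    finally show "f x = ?e f x" ..
  qed
  \<comment> \<open>\<open>?s b zs\<close> is the form sending \<open>g\<close> to the value of
    \<open>zs\<close> at \<open>(g, b)\<close>. Collecting terms by the coordinate functionals
    \<open>u\<close> gives every formal sum the normal form \<open>?n\<close>, whose coefficients
    thus depend only on the values of the sum.\<close>
  let ?s = "\<lambda>b zs. lsum ?D (map (\<lambda>(f1, f2). f2 b \<odot>\<^bsub>?D\<^esub> f1) zs)"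
  let ?n = "\<lambda>xs. concat (map (\<lambda>(b, u). [(?s b xs, u)]) ps)"
  have normal: "?E xs (?n xs)" if xs: "xs \<in> lists (?V \<times> ?V)" for xs
  proof -
    note xs_mem = lists_pair_mem[OF xs]
    have sm: "f b \<odot>\<^bsub>?D\<^esub> u \<in> ?V"
      if "f \<in> ?V" "b \<in> carrier A" "u \<in> ?V" for f b u
      using D.smult_closed[of "f b" u] dual_spaceD(3)[OF that(1,2)] that(3) by simp
    have "xs = concat (map (\<lambda>(f1, f2). [(f1, f2)]) xs)"
      by (simp add: concat_map_pair_singleton)
    also have "?E \<dots> (concat (map (\<lambda>(f1, f2). map (\<lambda>(b, u). (f2 b \<odot>\<^bsub>?D\<^esub> f1, u)) ps) xs))"
    proof (rule fsum_eq_concat_pair_cong)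
      fix f1 f2 assume "(f1, f2) \<in> set xs"
      then have f: "f1 \<in> ?V" "f2 \<in> ?V" using xs_mem by auto
      have "?E [(f1, lsum ?D (map (\<lambda>(b, u). f2 b \<odot>\<^bsub>?D\<^esub> u) ps))]
          (map (\<lambda>z. (f1, (\<lambda>(b, u). f2 b \<odot>\<^bsub>?D\<^esub> u) z)) ps)"
        using f ps sm by (intro tensor_lsum_right D) (auto simp del: dual_module_simps(5))
      then have "?E [(f1, f2)] (map (\<lambda>z. (f1, (\<lambda>(b, u). f2 b \<odot>\<^bsub>?D\<^esub> u) z)) ps)"
        unfolding expand[OF f(2), symmetric] .
      also have "\<dots> = map (\<lambda>(b, u). (f1, f2 b \<odot>\<^bsub>?D\<^esub> u)) ps"
        by (simp add: case_prod_unfold)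
      also have "?E \<dots> (map (\<lambda>(b, u). (f2 b \<odot>\<^bsub>?D\<^esub> f1, u)) ps)"
      proof (rule fsum_eq_map_pair)
        fix b u assume "(b, u) \<in> set ps"
        then have bu: "b \<in> carrier A" "u \<in> ?V" using ps by auto
        have "?E [(f2 b \<odot>\<^bsub>?D\<^esub> f1, u)] [(f1, f2 b \<odot>\<^bsub>?D\<^esub> u)]"
          using f bu dual_spaceD(3)[OF f(2) bu(1)] sm[OF f(2) bu(1)]
          by (intro fsum_eq.gen tensor_rels.scalar) (auto simp del: dual_module_simps(5))
        then show "?E [(f1, f2 b \<odot>\<^bsub>?D\<^esub> u)] [(f2 b \<odot>\<^bsub>?D\<^esub> f1, u)]" by (rule fsum_eq.sym)
      qed
      finally show "?E [(f1, f2)] (map (\<lambda>(b, u). (f2 b \<odot>\<^bsub>?D\<^esub> f1, u)) ps)" .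
    qed
    also have "?E \<dots> (concat (map (\<lambda>(b, u). map (\<lambda>(f1, f2). (f2 b \<odot>\<^bsub>?D\<^esub> f1, u)) xs) ps))"
      using xs_mem ps sm by (intro fsum_eq_swap_pair) (auto simp del: dual_module_simps(5))
    also have "?E \<dots> (?n xs)"
    proof (rule fsum_eq_concat_pair_cong)
      fix b u assume "(b, u) \<in> set ps"
      then have bu: "b \<in> carrier A" "u \<in> ?V" using ps by auto
      have "?E [(?s b xs, u)]
        (map (\<lambda>z. ((\<lambda>(f1, f2). f2 b \<odot>\<^bsub>?D\<^esub> f1) z, u)) xs)"
        using bu xs_mem sm by (intro tensor_lsum_left D) (auto simp del: dual_module_simps(5))
      then have "?E (map (\<lambda>z. ((\<lambda>(f1, f2). f2 b \<odot>\<^bsub>?D\<^esub> f1) z, u)) xs)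
          [(?s b xs, u)]"
        by (rule fsum_eq.sym)
      then show "?E (map (\<lambda>(f1, f2). (f2 b \<odot>\<^bsub>?D\<^esub> f1, u)) xs)
          [(?s b xs, u)]"
        by (simp add: case_prod_unfold del: dual_module_simps(5))
    qed
    finally show ?thesis .
  qed
  have "?s b xs = ?s b ys"
    if b: "b \<in> carrier A" for b
  proof (rule extensionalityI)
    have mem: "(\<lambda>(f1, f2). f2 b \<odot>\<^bsub>?D\<^esub> f1) z \<in> ?V"
      if "zs \<in> lists (?V \<times> ?V)" "z \<in> set zs" for z zs
      using D.smult_closed[of "snd z b" "fst z"] lists_pair_mem[OF that(1), of "fst z" "snd z"] that(2)
        dual_spaceD(3)[of "snd z" K A b] b by (simp add: case_prod_unfold)
    have ext: "?s b zs \<in> extensional (carrier A)"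
      if "zs \<in> lists (?V \<times> ?V)" for zs
    proof (rule dual_spaceD(2))
      have "?s b zs \<in> carrier ?D"
        using mem[OF that] by (intro D.M.lsum_closed) auto
      then show "?s b zs \<in> ?V"
        by (simp only: dual_module_simps(1))
    qed
    show "?s b xs \<in> extensional (carrier A)"
      "?s b ys \<in> extensional (carrier A)"
      by (rule ext[OF xs], rule ext[OF ys])
    fix g assume g: "g \<in> carrier A"
    have ev: "?s b zs g = lsum K (map (\<lambda>(f1, f2). f1 g \<otimes>\<^bsub>K\<^esub> f2 b) zs)"
      if zs: "zs \<in> lists (?V \<times> ?V)" for zs
    proof -
      have "?s b zs g = lsum K (map (\<lambda>z. (\<lambda>(f1, f2). f2 b \<odot>\<^bsub>?D\<^esub> f1) z g) zs)"
        by (rule dual_lsum_apply[OF field D g mem[OF zs]])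
      also have "map (\<lambda>z. (\<lambda>(f1, f2). f2 b \<odot>\<^bsub>?D\<^esub> f1) z g) zs = map (\<lambda>(f1, f2). f1 g \<otimes>\<^bsub>K\<^esub> f2 b) zs"
      proof (rule map_cong[OF HOL.refl])
        fix z assume z: "z \<in> set zs"
        obtain f1 f2 where f: "z = (f1, f2)" by (cases z)
        have "f1 g \<in> carrier K" "f2 b \<in> carrier K"
          using lists_pair_mem[OF zs, of f1 f2] z f dual_spaceD(3)[of f1 K A g] dual_spaceD(3)[of f2 K A b] g b
          by simp_all
        then show "(\<lambda>(f1, f2). f2 b \<odot>\<^bsub>?D\<^esub> f1) z g = (\<lambda>(f1, f2). f1 g \<otimes>\<^bsub>K\<^esub> f2 b) z"
          using g by (simp add: f A.R.m_comm)
      qed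
      finally show ?thesis .
    qed
    show "?s b xs g = ?s b ys g"
      unfolding ev[OF xs] ev[OF ys] by (rule eq[OF g b])
  qed
  then have n: "?n xs = ?n ys"
    using ps by (intro arg_cong[where f = concat] map_pair_cong) simp
  have "?E xs (?n ys)"
    using normal[OF xs] unfolding n .
  from fsum_eq.trans[OF this fsum_eq.sym[OF normal[OF ys]]] show ?thesis by simp
qed


section \<open>The isomorphism\<close>

locale base_bialgebra_dual = base_bialgebra K R \<phi> e L
  for K :: "('k, 'x) ring_scheme" and R :: "('k, 'r, 'm) module_scheme"
    and \<phi> :: "'r \<Rightarrow> 'k" and e :: "('r \<times> 'r) list set" and L :: "('k, 'r, 'l, 'n) times_bialg_scheme" +
  fixes Lv :: "('k, 'r, 'l \<Rightarrow> 'r, 'p) times_bialg_scheme"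
  assumes findim: "vectorspace.fin_dim K L" and vee: "is_vee K R L Lv"
begin

interpretation R: ring R using alg by (rule k_algebraD)
interpretation RM: module K R using alg by (rule k_algebraD)
interpretation L: ring L using algL by (rule k_algebraD)
interpretation LM: module K L using algL by (rule k_algebraD)

text \<open>\<open>is_vee\<close> makes \<open>Lv\<close> a bialgebra over \<open>R\<close> as well,
  so all that was proved for \<open>L\<close> is available for \<open>Lv\<close>, in particular that
  its weak bialgebra satisfies the axioms.\<close>

lemma base_Lv: "base_bialgebra K R \<phi> e Lv"
  using vee by (intro base_bialgebra.intro base_bialgebra_axioms.intro frobenius_base_axioms)
    (simp add: is_vee_def)

abbreviation mulLv (infixl "\<bullet>" 70) where "\<xi> \<bullet> \<zeta> \<equiv> \<xi> \<otimes>\<^bsub>Lv\<^esub> \<zeta>"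

lemma Lv_carrier: "carrier Lv = hom_Rbar K R L"
  using vee by (simp add: is_vee_def)

lemma pairing: "skew_pairing K R Lv L (\<lambda>\<xi> h. \<xi> h)"
  using vee by (simp add: is_vee_def)

lemmas algLv = base_bialgebra.algL[OF base_Lv]

interpretation Lv: ring Lv using algLv by (rule k_algebraD)
interpretation LvM: module K Lv using algLv by (rule k_algebraD)

lemmas modLv = LvM.module_axioms

section \<open>The skew pairing as rules for evaluation\<close>

lemma Lv_hom: "\<xi> \<in> carrier Lv \<Longrightarrow> \<xi> \<in> module_hom K L R"
  and Lv_ext: "\<xi> \<in> carrier Lv \<Longrightarrow> \<xi> \<in> extensional (carrier L)"
  by (simp_all add: Lv_carrier hom_Rbar_def)

lemma Lv_tgt: "\<xi> \<in> carrier Lv \<Longrightarrow> v \<in> carrier R \<Longrightarrow> h \<in> carrier L \<Longrightarrow> \<xi> (tL v \<cdot> h) = \<xi> h \<star> v"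
  by (simp add: Lv_carrier hom_Rbar_def)

lemma Lv_closed [simp]: "\<xi> \<in> carrier Lv \<Longrightarrow> h \<in> carrier L \<Longrightarrow> \<xi> h \<in> carrier R"
  using module_hom_carrier[OF Lv_hom] .

lemma eval_hom: "h \<in> carrier L \<Longrightarrow> (\<lambda>\<xi>. \<xi> h) \<in> module_hom K Lv R"
  using pairing bilinear_mapD(2)[of K Lv L R "\<lambda>\<xi> h. \<xi> h"] by (simp add: skew_pairing_def)

lemma emb_one: "emb L \<one>\<^bsub>R\<^esub> \<one>\<^bsub>R\<^esub> = \<one>\<^bsub>L\<^esub>"
  using src_one by (simp add: src_def)

text \<open>In the bimodule law of the skew pairing the elements \<open>s\<close>, \<open>t\<close>,
  \<open>u\<close> and \<open>v\<close> are all taken to be the unit.\<close>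

lemma Lv_src_apply:
  assumes "r \<in> carrier R" "\<xi> \<in> carrier Lv" "h \<in> carrier L"
  shows "(src R Lv r \<bullet> \<xi>) h = r \<star> \<xi> h"
proof -
  have 1: "emb Lv \<one>\<^bsub>R\<^esub> \<one>\<^bsub>R\<^esub> = \<one>\<^bsub>Lv\<^esub>"
    using base_bialgebra.src_one[OF base_Lv] by (simp add: src_def)
  have cl: "src R Lv r \<bullet> \<xi> \<in> carrier Lv"
    using assms base_bialgebra.src_closed[OF base_Lv] by simp
  have "\<forall>r\<in>carrier R. \<forall>s\<in>carrier R. \<forall>t\<in>carrier R. \<forall>u\<in>carrier R. \<forall>v\<in>carrier R.
        \<forall>\<xi>\<in>carrier Lv. \<forall>h\<in>carrier L.
        (emb Lv r s \<bullet> \<xi> \<bullet> emb Lv t u) h \<star> v =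
        r \<star> \<xi> (emb L t v \<cdot> h \<cdot> emb L u s)"
    using pairing by (simp add: skew_pairing_def)
  from this[rule_format, OF assms(1) R.one_closed R.one_closed R.one_closed R.one_closed assms(2,3)]
  have "(src R Lv r \<bullet> \<xi> \<bullet> \<one>\<^bsub>Lv\<^esub>) h \<star> \<one>\<^bsub>R\<^esub> = r \<star> \<xi> (\<one>\<^bsub>L\<^esub> \<cdot> h \<cdot> \<one>\<^bsub>L\<^esub>)"
    unfolding 1 emb_one src_def .
  then show ?thesis using assms cl by simp
qed

lemma Lv_mult_arg:
  "\<xi> \<in> carrier Lv \<Longrightarrow> g \<in> carrier L \<Longrightarrow> h \<in> carrier L \<Longrightarrow>
    \<xi> (g \<cdot> h) = lsum Lv (map (\<lambda>(m, n). tgt R Lv (n h) \<bullet> m) (rep (Gam Lv \<xi>))) g"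
  and Lv_one_arg: "\<xi> \<in> carrier Lv \<Longrightarrow> \<xi> \<one>\<^bsub>L\<^esub> = Cou Lv \<xi> \<one>\<^bsub>R\<^esub>"
  and Lv_mult_apply: "\<xi> \<in> carrier Lv \<Longrightarrow> \<zeta> \<in> carrier Lv \<Longrightarrow> h \<in> carrier L \<Longrightarrow>
    (\<xi> \<bullet> \<zeta>) h = \<xi> (lsum L (map (\<lambda>(m, n). sL (\<zeta> m) \<cdot> n) (gam h)))"
  and Lv_one_apply: "h \<in> carrier L \<Longrightarrow> \<one>\<^bsub>Lv\<^esub> h = cL h"
  using pairing by (simp_all add: skew_pairing_def)

section \<open>The map \<open>\<Theta>\<close> and its inverse\<close>

abbreviation "Wv \<equiv> corresponding_wb K R \<phi> e Lv"
abbreviation "D \<equiv> dual_bialg K W"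
abbreviation "M \<equiv> dual_module K W"

definition \<Theta> :: "('l \<Rightarrow> 'r) \<Rightarrow> 'l \<Rightarrow> 'k" where
  "\<Theta> \<xi> = (\<lambda>h\<in>carrier L. \<phi> (\<xi> h))"

lemma \<Theta>_apply [simp]: "h \<in> carrier L \<Longrightarrow> \<Theta> \<xi> h = \<phi> (\<xi> h)"
  by (simp add: \<Theta>_def)

lemma modW: "module K W"
  by (rule k_algebraD[OF k_algebra_corresponding_wb[OF algL]])

lemma dual_space_W: "dual_space K W = dual_space K L"
  by (simp add: dual_space_def module_hom_def)

lemma dual_hom: "f \<in> dual_space K W \<Longrightarrow> f \<in> module_hom K L (base_module K)"
  and dual_ext: "f \<in> dual_space K W \<Longrightarrow> f \<in> extensional (carrier L)"
  by (simp_all add: dual_space_def module_hom_def)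

lemma \<Theta>_closed: "\<xi> \<in> carrier Lv \<Longrightarrow> \<Theta> \<xi> \<in> dual_space K W"
  using restrict_dual_space[OF modL module_hom_comp[OF Lv_hom phi_hom], of \<xi>]
  unfolding \<Theta>_def dual_space_W by simp

text \<open>By \<open>Lv_tgt\<close>, the value of \<open>\<Theta> \<xi>\<close> at
  \<open>tL a \<cdot> h\<close> is \<open>\<phi> (\<xi> h \<star> a)\<close>, so the Frobenius
  identity recovers \<open>\<xi> h\<close> from values of \<open>\<Theta> \<xi>\<close>.\<close>

lemma \<Theta>_inj: "inj_on \<Theta> (carrier Lv)"
proof (rule inj_onI)
  fix \<xi> \<zeta> assume \<xi>: "\<xi> \<in> carrier Lv" and \<zeta>: "\<zeta> \<in> carrier Lv" and eq: "\<Theta> \<xi> = \<Theta> \<zeta>"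
  show "\<xi> = \<zeta>"
  proof (rule extensionalityI[OF Lv_ext[OF \<xi>] Lv_ext[OF \<zeta>]])
    fix h assume h: "h \<in> carrier L"
    have *: "lsum R (map (\<lambda>(a, b). \<Theta> \<xi> (tL a \<cdot> h) \<odot>\<^bsub>R\<^esub> b) E) = \<xi> h" if "\<xi> \<in> carrier Lv" for \<xi>
    proof -
      have "map (\<lambda>(a, b). \<Theta> \<xi> (tL a \<cdot> h) \<odot>\<^bsub>R\<^esub> b) E = map (\<lambda>(a, b). \<phi> (\<xi> h \<star> a) \<odot>\<^bsub>R\<^esub> b) E"
        using that h by (intro map_pair_cong) (auto simp: Lv_tgt dest!: E_mem)
      then show ?thesis
        using frob_lsum_left[OF modR module_hom_id Lv_closed[OF that h]] by (simp only:)
    qed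
    show "\<xi> h = \<zeta> h"
      using *[OF \<xi>] *[OF \<zeta>] unfolding eq by simp
  qed
qed

lemma \<Theta>_surj:
  assumes f: "f \<in> dual_space K W"
  shows "\<exists>\<xi>\<in>carrier Lv. \<Theta> \<xi> = f"
proof -
  note fh = dual_hom[OF f]
  define \<xi> where "\<xi> = (\<lambda>h\<in>carrier L. lsum R (map (\<lambda>(a, b). f (tL a \<cdot> h) \<odot>\<^bsub>R\<^esub> b) E))"
  have fcl [simp]: "h \<in> carrier L \<Longrightarrow> f h \<in> carrier K" for h
    using module_hom_carrier[OF fh] by simp
  have "(\<lambda>h. lsum R (map (\<lambda>i. f (tL (fst i) \<cdot> h) \<odot>\<^bsub>R\<^esub> snd i) E)) \<in> module_hom K L R"
  proof (rule module_hom_lsum_map[OF modL modR])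
    fix i assume "i \<in> set E"
    then have i: "fst i \<in> carrier R" "snd i \<in> carrier R" using E_mem[of "fst i" "snd i"] by auto
    show "(\<lambda>h. f (tL (fst i) \<cdot> h) \<odot>\<^bsub>R\<^esub> snd i) \<in> module_hom K L R"
      using i by (intro module_hom_comp[OF module_hom_comp[OF k_algebra_mult_left[OF algL] fh]
          smult_left_hom[OF field modR]]) auto
  qed
  then have "(\<lambda>h. lsum R (map (\<lambda>(a, b). f (tL a \<cdot> h) \<odot>\<^bsub>R\<^esub> b) E)) \<in> module_hom K L R"
    by (simp add: case_prod_unfold)
  then have hom: "\<xi> \<in> module_hom K L R"
    by (auto simp: \<xi>_def module_hom_def)
  \<comment> \<open>Membership in \<open>Lv\<close> asks for this compatibility with target
    elements. Since \<open>tL a \<cdot> tL v\<close> is \<open>tL (v \<star> a)\<close>, the Casimir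
    property turns \<open>v\<close> into a right factor of \<open>b\<close>.\<close>
  have bar: "\<xi> (tL v \<cdot> h) = \<xi> h \<star> v" if v: "v \<in> carrier R" and h: "h \<in> carrier L" for v h
  proof -
    have bil: "bilinear_map K R R R (\<lambda>a b. f (tL a \<cdot> h) \<odot>\<^bsub>R\<^esub> b)"
      by (rule bilinear_smult[OF field modR modR
            module_hom_comp[OF module_hom_comp[OF tgt_hom k_algebra_mult_right[OF algL h]] fh] module_hom_id])
    have "\<xi> (tL v \<cdot> h) = lsum R (map (\<lambda>(a, b). f (tL a \<cdot> (tL v \<cdot> h)) \<odot>\<^bsub>R\<^esub> b) E)"
      using v h by (simp add: \<xi>_def)
    also have "map (\<lambda>(a, b). f (tL a \<cdot> (tL v \<cdot> h)) \<odot>\<^bsub>R\<^esub> b) E = map (\<lambda>(a, b). f (tL (v \<star> a) \<cdot> h) \<odot>\<^bsub>R\<^esub> b) E"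
      using v h by (intro map_pair_cong) (auto simp: tgt_mult L.m_assoc dest!: E_mem)
    also have "\<dots> = map (\<lambda>(a, b). f (tL a \<cdot> h) \<odot>\<^bsub>R\<^esub> b) (map (\<lambda>(a, b). (v \<star> a, b)) E)"
      by (simp add: case_prod_unfold comp_def)
    also have "lsum R \<dots> = lsum R (map (\<lambda>(a, b). f (tL a \<cdot> h) \<odot>\<^bsub>R\<^esub> b) (map (\<lambda>(a, b). (a, b \<star> v)) E))"
      by (rule tensor_lsum[OF modR modR modR bil casimir[OF v]])
    also have "map (\<lambda>(a, b). f (tL a \<cdot> h) \<odot>\<^bsub>R\<^esub> b) (map (\<lambda>(a, b). (a, b \<star> v)) E) =
        map (\<lambda>(a, b). f (tL a \<cdot> h) \<odot>\<^bsub>R\<^esub> (b \<star> v)) E"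
      by (simp add: case_prod_unfold comp_def)
    also have "\<dots> = map (\<lambda>x. x \<star> v) (map (\<lambda>(a, b). f (tL a \<cdot> h) \<odot>\<^bsub>R\<^esub> b) E)"
      unfolding map_map comp_def
      using v h alg by (intro map_cong HOL.refl) (auto simp: k_algebra_def dest!: E_mem)
    also have "lsum R \<dots> = lsum R (map (\<lambda>(a, b). f (tL a \<cdot> h) \<odot>\<^bsub>R\<^esub> b) E) \<star> v"
      using h by (intro module_hom_lsum[OF modR modR k_algebra_mult_right[OF alg v], symmetric])
        (auto dest!: E_mem)
    finally show ?thesis using h by (simp add: \<xi>_def)
  qed
  have \<xi>: "\<xi> \<in> carrier Lv"
    using hom bar by (auto simp: Lv_carrier hom_Rbar_def \<xi>_def)
  moreover have "\<Theta> \<xi> = f"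
  proof (rule extensionalityI[OF dual_ext[OF \<Theta>_closed[OF \<xi>]] dual_ext[OF f]])
    fix h assume h: "h \<in> carrier L"
    have gh: "(\<lambda>r. f (tL r \<cdot> h)) \<in> module_hom K R (base_module K)"
      by (rule module_hom_comp[OF module_hom_comp[OF tgt_hom k_algebra_mult_right[OF algL h]] fh])
    have "\<Theta> \<xi> h = \<phi> (lsum R (map (\<lambda>(a, b). f (tL a \<cdot> h) \<odot>\<^bsub>R\<^esub> b) E))"
      using h by (simp add: \<xi>_def)
    also have "\<dots> = lsum (base_module K) (map \<phi> (map (\<lambda>(a, b). f (tL a \<cdot> h) \<odot>\<^bsub>R\<^esub> b) E))"
      using h by (intro module_hom_lsum[OF modR modK phi_hom]) (auto dest!: E_mem)
    also have "map \<phi> (map (\<lambda>(a, b). f (tL a \<cdot> h) \<odot>\<^bsub>R\<^esub> b) E) =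
        map (\<lambda>(a, b). \<phi> (b \<star> \<one>\<^bsub>R\<^esub>) \<odot>\<^bsub>base_module K\<^esub> f (tL a \<cdot> h)) E"
      unfolding map_map comp_def using h
      by (intro map_cong HOL.refl) (auto simp: module_hom_smult[OF phi_hom] RM.R.m_comm dest!: E_mem)
    also have "lsum (base_module K) \<dots> = f (tL \<one>\<^bsub>R\<^esub> \<cdot> h)"
      by (rule frob_lsum_right[OF modK gh R.one_closed])
    also have "\<dots> = f h" using h by (simp add: tgt_one)
    finally show "\<Theta> \<xi> h = f h" .
  qed
  ultimately show ?thesis by blast
qed

lemma \<Theta>_bij: "bij_betw \<Theta> (carrier Lv) (dual_space K W)"
  using \<Theta>_inj \<Theta>_closed \<Theta>_surj by (auto simp: bij_betw_def)

section \<open>Compatibility of \<open>\<Theta>\<close> with the algebra structures\<close>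

lemma \<Theta>_hom: "\<Theta> \<in> module_hom K Lv M"
proof (rule module_homI)
  show "\<Theta> \<xi> \<in> carrier M" if "\<xi> \<in> carrier Lv" for \<xi>
    using \<Theta>_closed[OF that] by simp
  show "\<Theta> (\<xi> \<oplus>\<^bsub>Lv\<^esub> \<zeta>) = \<Theta> \<xi> \<oplus>\<^bsub>M\<^esub> \<Theta> \<zeta>" if "\<xi> \<in> carrier Lv" "\<zeta> \<in> carrier Lv" for \<xi> \<zeta>
    using that by (auto simp: \<Theta>_def restrict_def fun_eq_iff module_hom_add[OF eval_hom] module_hom_add[OF phi_hom])
  show "\<Theta> (c \<odot>\<^bsub>Lv\<^esub> \<xi>) = c \<odot>\<^bsub>M\<^esub> \<Theta> \<xi>" if "c \<in> carrier K" "\<xi> \<in> carrier Lv" for c \<xi>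
    using that by (auto simp: \<Theta>_def restrict_def fun_eq_iff module_hom_smult[OF eval_hom] module_hom_smult[OF phi_hom])
qed

lemma \<Theta>_zero: "\<Theta> \<zero>\<^bsub>Lv\<^esub> = \<zero>\<^bsub>M\<^esub>"
proof -
  have "\<phi> (\<zero>\<^bsub>Lv\<^esub> h) = \<zero>\<^bsub>K\<^esub>" if "h \<in> carrier L" for h
    using module_hom_zero[OF modLv modR eval_hom[OF that]] module_hom_zero[OF modR modK phi_hom] by simp
  then show ?thesis by (auto simp: \<Theta>_def restrict_def fun_eq_iff)
qed

lemma \<Theta>_one: "\<Theta> \<one>\<^bsub>Lv\<^esub> = one D"
  by (auto simp: \<Theta>_def restrict_def fun_eq_iff Lv_one_apply)

text \<open>The convolution evaluates \<open>\<Theta> \<zeta>\<close> at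
  \<open>tL a \<cdot> m\<close>, which gives \<open>\<phi> (\<zeta> m \<star> a)\<close>.
  Contracting \<open>e\<close> places \<open>\<zeta> m\<close> as a source element before
  \<open>n\<close>, and this is the argument that the skew pairing hands to \<open>\<xi>\<close>. So
  \<open>\<zeta>\<close> takes the first leg of the coproduct, and the order of the product is
  reversed.\<close>

lemma \<Theta>_mult:
  assumes \<xi>: "\<xi> \<in> carrier Lv" and \<zeta>: "\<zeta> \<in> carrier Lv"
  shows "\<Theta> (\<xi> \<bullet> \<zeta>) = \<Theta> \<zeta> \<otimes>\<^bsub>D\<^esub> \<Theta> \<xi>"
proof -
  have "lsum K (map (\<lambda>(a, b). \<Theta> \<zeta> a \<otimes>\<^bsub>K\<^esub> \<Theta> \<xi> b) (cop h)) = \<phi> ((\<xi> \<bullet> \<zeta>) h)"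
    if h: "h \<in> carrier L" for h
  proof -
    have bil: "bilinear_map K L L (base_module K) (\<lambda>a b. \<Theta> \<zeta> a \<otimes>\<^bsub>K\<^esub> \<Theta> \<xi> b)"
      using bilinear_smult[OF field modL modK dual_hom[OF \<Theta>_closed[OF \<zeta>]] dual_hom[OF \<Theta>_closed[OF \<xi>]]] by simp
    have "lsum K (map (\<lambda>(a, b). \<Theta> \<zeta> a \<otimes>\<^bsub>K\<^esub> \<Theta> \<xi> b) (cop h)) =
      lsum K (map (\<lambda>(m, n). lsum K (map (\<lambda>(a, b). \<Theta> \<zeta> (tL a \<cdot> m) \<otimes>\<^bsub>K\<^esub> \<Theta> \<xi> (sL b \<cdot> n)) E)) (gam h))"
      using comul_lsum[OF modK bil h] by simp
    also have "\<dots> = lsum K (map (\<lambda>(m, n). \<phi> (\<xi> (sL (\<zeta> m) \<cdot> n))) (gam h))"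
    proof (intro arg_cong[where f = "lsum K"] map_pair_cong)
      fix m n assume "(m, n) \<in> set (gam h)"
      then have mn: "m \<in> carrier L" "n \<in> carrier L" using gam_mem h by auto
      have hom: "(\<lambda>r. \<phi> (\<xi> (sL r \<cdot> n))) \<in> module_hom K R (base_module K)"
        by (rule module_hom_comp[OF module_hom_comp[OF module_hom_comp[OF src_hom
            k_algebra_mult_right[OF algL mn(2)]] Lv_hom[OF \<xi>]] phi_hom])
      have 1: "map (\<lambda>(a, b). \<Theta> \<zeta> (tL a \<cdot> m) \<otimes>\<^bsub>K\<^esub> \<Theta> \<xi> (sL b \<cdot> n)) E =
          map (\<lambda>(a, b). \<phi> (\<zeta> m \<star> a) \<otimes>\<^bsub>K\<^esub> \<phi> (\<xi> (sL b \<cdot> n))) E"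
        using mn \<zeta> by (intro map_pair_cong) (auto simp: Lv_tgt dest!: E_mem)
      show "lsum K (map (\<lambda>(a, b). \<Theta> \<zeta> (tL a \<cdot> m) \<otimes>\<^bsub>K\<^esub> \<Theta> \<xi> (sL b \<cdot> n)) E) = \<phi> (\<xi> (sL (\<zeta> m) \<cdot> n))"
        unfolding 1 using frob_lsum_left[OF modK hom Lv_closed[OF \<zeta> mn(1)]] by simp
    qed
    also have "\<dots> = \<phi> (\<xi> (lsum L (map (\<lambda>(m, n). sL (\<zeta> m) \<cdot> n) (gam h))))"
      using gam_mem[OF _ h] \<zeta> by (intro lsum_hom_gam[of "\<lambda>z. \<phi> (\<xi> z)"] module_hom_comp[OF Lv_hom[OF \<xi>] phi_hom]) auto
    also have "\<dots> = \<phi> ((\<xi> \<bullet> \<zeta>) h)"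
      by (simp add: Lv_mult_apply[OF \<xi> \<zeta> h])
    finally show ?thesis .
  qed
  then show ?thesis
    by (auto simp: \<Theta>_def[of "\<xi> \<bullet> \<zeta>"] restrict_def fun_eq_iff)
qed

text \<open>The algebra axioms for convolution are inherited from \<open>Lv\<close> along
  \<open>\<Theta>\<close>. They come before the comultiplication because computing in the tensor
  square of the dual presupposes that the dual is a module.\<close>

lemma algD: "k_algebra K (op_bialg D)"
proof (rule k_algebra_transport[OF algLv, where F = \<Theta>])
  show "bij_betw \<Theta> (carrier Lv) (carrier (op_bialg D))"
    using \<Theta>_bij by simp
  show "\<Theta> \<in> module_hom K Lv (op_bialg D)"
    using \<Theta>_hom by (simp add: module_hom_def)
  show "\<Theta> (\<xi> \<bullet> \<zeta>) = \<Theta> \<xi> \<otimes>\<^bsub>op_bialg D\<^esub> \<Theta> \<zeta>" if "\<xi> \<in> carrier Lv" "\<zeta> \<in> carrier Lv" for \<xi> \<zeta>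
    using \<Theta>_mult[OF that] by simp
qed (use \<Theta>_one \<Theta>_zero in simp_all)

lemma modM: "module K M"
  by (rule module_cong[OF k_algebraD(1)[OF algD]]) simp_all

section \<open>Compatibility of \<open>\<Theta>\<close> with the comultiplications\<close>

abbreviation "MM \<equiv> dual_space K W \<times> dual_space K W"
abbreviation "TM \<equiv> tensor_rels K M M"

lemma tensor_rels_op_dual: "tensor_rels K (op_bialg D) (op_bialg D) = TM"
  by (rule tensor_rels_cong) simp_all

lemma dual_tensor_unique:
  assumes "xs \<in> lists MM" "ys \<in> lists MM"
    and "\<And>g h. g \<in> carrier L \<Longrightarrow> h \<in> carrier L \<Longrightarrow>
      pairing_sum K g h xs = pairing_sum K g h ys"
  shows "fsum_eq MM TM xs ys"
proof -
  have "vectorspace K L"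
    using algL by (simp add: k_algebra_def)
  then obtain ps where ps: "\<And>b f. (b, f) \<in> set ps \<Longrightarrow> b \<in> carrier L \<and> f \<in> module_hom K L (base_module K)"
    and basis: "\<And>v. v \<in> carrier L \<Longrightarrow> v = lsum L (map (\<lambda>(b, f). f v \<odot>\<^bsub>L\<^esub> b) ps)"
    using dual_basis_exists[OF _ findim] by blast
  \<comment> \<open>The coordinate functionals have unspecified values off \<open>carrier L\<close>,
    whereas elements of \<open>dual_space\<close> are extensional.\<close>
  let ?ps = "map (\<lambda>(b, f). (b, restrict f (carrier L))) ps"
  show ?thesis
  proof (rule dual_tensor_eqI[OF field modW modM _ _ assms(1,2), of ?ps])
    show "b \<in> carrier W \<and> f \<in> dual_space K W" if "(b, f) \<in> set ?ps" for b f
      using that ps restrict_dual_space[OF modL] by (auto simp: dual_space_W)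
    show "x = lsum W (map (\<lambda>(b, f). f x \<odot>\<^bsub>W\<^esub> b) ?ps)" if "x \<in> carrier W" for x
      using basis[of x] that by (simp add: case_prod_unfold comp_def)
    show "pairing_sum K g h xs = pairing_sum K g h ys"
      if "g \<in> carrier W" "h \<in> carrier W" for g h
      using assms(3) that by simp
  qed
qed

lemma dual_eval_lsum:
  assumes "fsum_eq MM TM xs ys" "g \<in> carrier L" "h \<in> carrier L"
  shows "pairing_sum K g h xs = pairing_sum K g h ys"
  using tensor_lsum[OF modM modM modK bilinear_smult[OF field modM modK dual_eval_hom dual_eval_hom],
      where xs = xs and ys = ys] assms by simp

text \<open>By \<open>Lv_src_apply\<close> the second leg contributes
  \<open>\<phi> (b \<star> n h)\<close>. Contracting \<open>e\<close> leaves the value at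
  \<open>g\<close> of \<open>m\<close> multiplied by the target element of \<open>n h\<close>, and
  summed over \<open>Gam Lv \<xi>\<close> this is the formula of the skew pairing for
  \<open>\<xi> (g \<cdot> h)\<close>.\<close>

lemma Wv_pairing:
  assumes \<xi>: "\<xi> \<in> carrier Lv" and g: "g \<in> carrier L" and h: "h \<in> carrier L"
  shows "lsum K (map (\<lambda>(f1, f2). f1 g \<otimes>\<^bsub>K\<^esub> f2 h)
      (map (\<lambda>(a, b). (\<Theta> a, \<Theta> b)) (rep (comul Wv \<xi>)))) = \<Theta> \<xi> (g \<cdot> h)"
proof -
  let ?t = "tgt R Lv" and ?s = "src R Lv" and ?G = "rep (Gam Lv \<xi>)"
  note gam_mem = base_bialgebra.gam_mem[OF base_Lv _ \<xi>]
  note closed = base_bialgebra.src_closed[OF base_Lv] base_bialgebra.tgt_closed[OF base_Lv]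
  note evg = module_hom_comp[OF eval_hom[OF g] phi_hom] and evh = module_hom_comp[OF eval_hom[OF h] phi_hom]
  have bil: "bilinear_map K Lv Lv (base_module K) (\<lambda>a b. \<phi> (a g) \<otimes>\<^bsub>K\<^esub> \<phi> (b h))"
    using bilinear_smult[OF field modLv modK evg evh] by simp
  have "pairing_sum K g h (map (\<lambda>(a, b). (\<Theta> a, \<Theta> b)) (rep (comul Wv \<xi>))) =
      lsum K (map (\<lambda>(a, b). \<phi> (a g) \<otimes>\<^bsub>K\<^esub> \<phi> (b h)) (rep (comul Wv \<xi>)))"
    using g h by (simp add: case_prod_unfold comp_def)
  also have "\<dots> = lsum K (map (\<lambda>(m, n). lsum K (map (\<lambda>(a, b).
      \<phi> ((?t a \<bullet> m) g) \<otimes>\<^bsub>K\<^esub> \<phi> ((?s b \<bullet> n) h)) E)) ?G)"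
    using base_bialgebra.comul_lsum[OF base_Lv modK bil \<xi>] by simp
  also have "\<dots> = lsum K (map (\<lambda>(m, n). \<phi> ((?t (n h) \<bullet> m) g)) ?G)"
  proof (intro arg_cong[where f = "lsum K"] map_pair_cong)
    fix m n assume "(m, n) \<in> set ?G"
    then have mn: "m \<in> carrier Lv" "n \<in> carrier Lv" using gam_mem by auto
    have hom: "(\<lambda>r. \<phi> ((?t r \<bullet> m) g)) \<in> module_hom K R (base_module K)"
      by (rule module_hom_comp[OF module_hom_comp[OF base_bialgebra.tgt_hom[OF base_Lv]
            k_algebra_mult_right[OF algLv mn(1)]] evg])
    have 1: "map (\<lambda>(a, b). \<phi> ((?t a \<bullet> m) g) \<otimes>\<^bsub>K\<^esub> \<phi> ((?s b \<bullet> n) h)) E =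
        map (\<lambda>(a, b). \<phi> (b \<star> n h) \<otimes>\<^bsub>K\<^esub> \<phi> ((?t a \<bullet> m) g)) E"
      using mn g h by (intro map_pair_cong) (auto simp: Lv_src_apply closed RM.R.m_comm dest!: E_mem)
    show "lsum K (map (\<lambda>(a, b). \<phi> ((?t a \<bullet> m) g) \<otimes>\<^bsub>K\<^esub> \<phi> ((?s b \<bullet> n) h)) E) =
        \<phi> ((?t (n h) \<bullet> m) g)"
      unfolding 1 using frob_lsum_right[OF modK hom Lv_closed[OF mn(2) h]] by simp
  qed
  also have "\<dots> = \<phi> (lsum Lv (map (\<lambda>(m, n). ?t (n h) \<bullet> m) ?G) g)"
    using gam_mem h closed by (intro base_bialgebra.lsum_hom_gam[OF base_Lv evg]) auto
  also have "\<dots> = \<Theta> \<xi> (g \<cdot> h)"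
    using \<xi> g h by (simp add: Lv_mult_arg)
  finally show ?thesis .
qed

text \<open>The comultiplication of the dual is a definite description. Existence is
  \<open>Wv_pairing\<close>: the image of the coproduct of \<open>\<xi>\<close> has the required
  values. Uniqueness is \<open>dual_tensor_unique\<close>, applied to a representative of a
  competing class.\<close>

lemma \<Theta>_comul:
  assumes \<xi>: "\<xi> \<in> carrier Lv"
  shows "comul D (\<Theta> \<xi>) = fsum_class MM TM (map (\<lambda>(a, b). (\<Theta> a, \<Theta> b)) (rep (comul Wv \<xi>)))"
    (is "_ = fsum_class MM TM ?zs")
proof -
  have zs: "?zs \<in> lists MM"
    using lists_pair_mem[OF base_bialgebra.comul_lists[OF base_Lv \<xi>]] \<Theta>_closed by auto
  have "comul D (\<Theta> \<xi>) = (THE t. t \<in> fsum_quot MM TM \<and>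
      (\<forall>g\<in>carrier L. \<forall>h\<in>carrier L.
        pairing_sum K g h (rep t) = \<Theta> \<xi> (g \<cdot> h)))"
    by (simp add: dual_bialg_def module.extend_def tensor_def)
  also have "\<dots> = fsum_class MM TM ?zs"
  proof (rule the_equality)
    have rep: "fsum_eq MM TM (rep (fsum_class MM TM ?zs)) ?zs"
      by (rule fsum_eq_rep_classD[OF HOL.refl zs])
    show "fsum_class MM TM ?zs \<in> fsum_quot MM TM \<and> (\<forall>g\<in>carrier L. \<forall>h\<in>carrier L.
        pairing_sum K g h (rep (fsum_class MM TM ?zs)) = \<Theta> \<xi> (g \<cdot> h))"
      using fsum_class_in_quot[OF zs] dual_eval_lsum[OF rep] Wv_pairing[OF \<xi>] by simp
  next
    fix t assume t: "t \<in> fsum_quot MM TM \<and> (\<forall>g\<in>carrier L. \<forall>h\<in>carrier L.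
        pairing_sum K g h (rep t) = \<Theta> \<xi> (g \<cdot> h))"
    have "fsum_eq MM TM (rep t) ?zs"
      using t Wv_pairing[OF \<xi>] by (intro dual_tensor_unique[OF rep_in_lists[of t MM TM] zs]) simp_all
    then have "fsum_class MM TM (rep t) = fsum_class MM TM ?zs"
      using fsum_class_eq_iff[OF zs] by simp
    then show "t = fsum_class MM TM ?zs"
      using fsum_class_rep[of t MM TM] t by simp
  qed
  finally show ?thesis .
qed

theorem weak_bialgebra_iso_dual: "weak_bialgebra_iso K Wv (op_bialg D) \<Theta>"
proof -
  interpret tr: weak_bialgebra_transport K Wv "op_bialg D" \<Theta>
  proof unfold_locales
    show "weak_bialgebra K Wv"
      by (rule base_bialgebra.weak_bialgebra_corresponding_wb[OF base_Lv])
    show "bij_betw \<Theta> (carrier Wv) (carrier (op_bialg D))"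
      using \<Theta>_bij by simp
    show "\<Theta> \<in> module_hom K Wv (op_bialg D)"
      using \<Theta>_hom by (simp add: module_hom_def)
    show "\<Theta> \<one>\<^bsub>Wv\<^esub> = \<one>\<^bsub>op_bialg D\<^esub>" "\<Theta> \<zero>\<^bsub>Wv\<^esub> = \<zero>\<^bsub>op_bialg D\<^esub>"
      using \<Theta>_one \<Theta>_zero by simp_all
    fix \<xi> assume "\<xi> \<in> carrier Wv"
    then have \<xi>: "\<xi> \<in> carrier Lv" by simp
    show "comul (op_bialg D) (\<Theta> \<xi>) = tensor_class K (op_bialg D) (op_bialg D)
        (map (\<lambda>(a, b). (\<Theta> a, \<Theta> b)) (rep (comul Wv \<xi>)))"
      using \<Theta>_comul[OF \<xi>] by (simp add: tensor_class_def tensor_rels_op_dual)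
    show "counit (op_bialg D) (\<Theta> \<xi>) = counit Wv \<xi>"
      using \<xi> by (simp add: Lv_one_arg)
    fix \<zeta> assume "\<zeta> \<in> carrier Wv"
    then show "\<Theta> (\<xi> \<otimes>\<^bsub>Wv\<^esub> \<zeta>) = \<Theta> \<xi> \<otimes>\<^bsub>op_bialg D\<^esub> \<Theta> \<zeta>"
      using \<Theta>_mult[OF \<xi>] by simp
  qed
  show ?thesis
    unfolding weak_bialgebra_iso_def
    using tr.W tr.weak_bialgebra tr.bij tr.hom tr.mult tr.one tr.comul tr.counit by blast
qed

end

theorem proposition7p2:
  fixes K :: "'k ring"
    and R :: "('k, 'r) module"
    and H :: "('k, 'r, 'h) times_bialg"
    and Hv :: "('k, 'r, 'h \<Rightarrow> 'r) times_bialg"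
    and \<phi> :: "'r \<Rightarrow> 'k" and e :: "('r \<times> 'r) list set"
  assumes "field K"
    and "k_algebra K R"
    and "idempotent_frobenius_system K R \<phi> e"
    and "times_bialgebra K R H"
    and "vectorspace.fin_dim K H"
    and "is_vee K R H Hv"
  shows "weak_bialgebra_iso K
           (corresponding_wb K R \<phi> e Hv)
           (op_bialg (dual_bialg K (corresponding_wb K R \<phi> e H)))
           (\<lambda>\<xi>. \<lambda>h\<in>carrier H. \<phi> (\<xi> h))"
proof -
  interpret base_bialgebra_dual K R \<phi> e H Hv
    by (intro base_bialgebra_dual.intro base_bialgebra.intro frobenius_base.intro
        base_bialgebra_axioms.intro base_bialgebra_dual_axioms.intro assms)
  have "(\<lambda>\<xi>. \<lambda>h\<in>carrier H. \<phi> (\<xi> h)) = \<Theta>"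
    by (simp add: fun_eq_iff \<Theta>_def)
  then show ?thesis
    using weak_bialgebra_iso_dual by simp
qed

end
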